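(* On projective 3-manifolds $(M,p)$ the projective Weyl curvature $W_{ab}{}^c{}_d$ sharply obstructs the existence of an Einstein Levi-Civita connection in the projective class $p$; that is, the vanishing of $W_{ab}{}^c{}_d$ is necessary and sufficient for the existence in $p$ of the Levi-Civita connection of an Einstein metric.
   Context: A projective manifold $(M^n,p)$ is a smooth manifold with an equivalence class $p$ of torsion-free affine connections, where $\nabla\sim\widehat\nabla$ iff there is a 1-form $\Upsilon_a$ with $\widehat\nabla_aY^b=\nabla_aY^b+\Upsilon_aY^b+\Upsilon_cY^c\delta_a^b$; a projective 3-manifold is one with $n=3$. For $\nabla\in p$ with curvature $(\nabla_a\nabla_b-\nabla_b\nabla_a)v^c=R_{ab}{}^c{}_dv^d$, the projective Weyl tensor (projective Weyl curvature) $W_{ab}{}^c{}_d$ is the completely trace-free tensor in the unique decomposition $R_{ab}{}^c{}_d=W_{ab}{}^c{}_d+2\delta^c_{[a}P_{b]d}+\beta_{ab}\delta^c_d$, $\beta_{ab}=-2P_{[ab]}$; it depends only on $p$. Metrics are pseudo-Riemannian of any signature; Einstein means the Ricci tensor is a constant multiple of the metric (zero allowed). A sharp obstruction is a projective invariant whose vanishing is necessary and sufficient for the existence in question.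
   Formalization: Existence in p of an Einstein Levi-Civita connection is taken locally, near each point of M; global existence can fail when W = 0, e.g. for the flat projective structure on the Hopf manifold (R^3 minus 0)/(x ~ 2x). *)

theory Defs
  imports "HOL-Analysis.Analysis"
begin

text \<open>Smoothness on open subsets of Euclidean space: all iterated partial derivatives exist
  (as derivatives of differentiable functions) and are continuous.\<close>

primrec C_k_on :: "nat \<Rightarrow> (real ^ 'n) set \<Rightarrow> (real ^ 'n \<Rightarrow> real) \<Rightarrow> bool" where
  "C_k_on 0 S f \<longleftrightarrow> continuous_on S f"
| "C_k_on (Suc k) S f \<longleftrightarrow> (\<forall>z\<in>S. f differentiable (at z)) \<and>
     (\<forall>i. C_k_on k S (\<lambda>z. frechet_derivative f (at z) (axis i 1)))"

definition smooth_on :: "(real ^ 'n) set \<Rightarrow> (real ^ 'n \<Rightarrow> real) \<Rightarrow> bool" where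
  "smooth_on S f \<longleftrightarrow> (\<forall>k. C_k_on k S f)"

type_synonym ('m, 'n) chart = "'m set \<times> ('m \<Rightarrow> real ^ 'n)"

text \<open>An atlas is not required to be maximal; the notions below do not depend on which atlas of a
  smooth structure is chosen.\<close>

definition smooth_manifold :: "'m topology \<Rightarrow> ('m, 'n::finite) chart set \<Rightarrow> bool" where
  "smooth_manifold M A \<longleftrightarrow>
     Hausdorff_space M \<and> second_countable M \<and> (\<Union>c\<in>A. fst c) = topspace M \<and>
     (\<forall>(U, \<phi>)\<in>A. openin M U \<and> open (\<phi> ` U) \<and>
        homeomorphic_map (subtopology M U) (top_of_set (\<phi> ` U)) \<phi>) \<and>
     (\<forall>(U, \<phi>)\<in>A. \<forall>(V, \<psi>)\<in>A. \<forall>i.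
        smooth_on (\<phi> ` (U \<inter> V)) (\<lambda>z. \<psi> (inv_into U \<phi> z) $ i))"

text \<open>The coordinate derivative \<open>\<partial>f/\<partial>x\<^sup>i\<close> in the chart \<open>c\<close>, as a function on the manifold, and the
  Jacobian entry \<open>\<partial>y\<^sup>i/\<partial>x\<^sup>j\<close> of the change from the coordinates \<open>x\<close> of \<open>c\<close> to the
  coordinates \<open>y\<close> of \<open>d\<close>.\<close>

definition pderiv_in :: "('m, 'n::finite) chart \<Rightarrow> 'n \<Rightarrow> ('m \<Rightarrow> real) \<Rightarrow> 'm \<Rightarrow> real" where
  "pderiv_in c i f x =
     frechet_derivative (f \<circ> inv_into (fst c) (snd c)) (at (snd c x)) (axis i 1)"

definition jac :: "('m, 'n::finite) chart \<Rightarrow> ('m, 'n) chart \<Rightarrow> 'n \<Rightarrow> 'n \<Rightarrow> 'm \<Rightarrow> real" where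
  "jac c d i j x = pderiv_in c j (\<lambda>y. snd d y $ i) x"

text \<open>A tensor field on an open set \<open>U\<close> is given by its components in every chart \<open>c\<close> of the
  atlas, as functions on \<open>U \<inter> fst c\<close>, subject to the tensorial transformation law. Values outside
  \<open>U \<inter> fst c\<close> are irrelevant. Vector fields \<open>Y\<^sup>b\<close> and 1-forms \<open>\<Upsilon>\<^sub>a\<close> have one index; in
  \<open>T\<^sub>a\<^sup>b\<close> and \<open>g\<^sub>a\<^sub>b\<close> the index \<open>a\<close> comes first.\<close>

type_synonym ('m, 'n) field1 = "('m, 'n) chart \<Rightarrow> 'n \<Rightarrow> 'm \<Rightarrow> real"
type_synonym ('m, 'n) field2 = "('m, 'n) chart \<Rightarrow> 'n \<Rightarrow> 'n \<Rightarrow> 'm \<Rightarrow> real"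

text \<open>A connection acts on the vector fields of every open set: \<open>D U Y\<close> is the field
  \<open>\<nabla>\<^sub>a Y\<^sup>b\<close> on \<open>U\<close> for a vector field \<open>Y\<close> on \<open>U\<close>.\<close>

type_synonym ('m, 'n) connection = "'m set \<Rightarrow> ('m, 'n) field1 \<Rightarrow> ('m, 'n) field2"

definition kron :: "'n \<Rightarrow> 'n \<Rightarrow> real" where
  "kron a b = (if a = b then 1 else 0)"

text \<open>The Lie bracket \<open>[Y, Z]\<close> and the derivative \<open>\<nabla>\<^sub>Y Z\<close>.\<close>

definition lie_bracket :: "('m, 'n::finite) field1 \<Rightarrow> ('m, 'n) field1 \<Rightarrow> ('m, 'n) field1" where
  "lie_bracket Y Z = (\<lambda>c b x.
     \<Sum>a\<in>UNIV. Y c a x * pderiv_in c a (Z c b) x - Z c a x * pderiv_in c a (Y c b) x)"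

definition cov :: "('m, 'n::finite) connection \<Rightarrow> 'm set \<Rightarrow> ('m, 'n) field1 \<Rightarrow> ('m, 'n) field1 \<Rightarrow>
    ('m, 'n) field1" where
  "cov D U Y Z = (\<lambda>c b x. \<Sum>a\<in>UNIV. Y c a x * D U Z c a b x)"

text \<open>Contractions with \<open>W\<^sub>a\<^sub>b\<^sup>c\<^sub>d\<close> written as \<open>w a b c d\<close>.\<close>

definition completely_trace_free :: "('n::finite \<Rightarrow> 'n \<Rightarrow> 'n \<Rightarrow> 'n \<Rightarrow> real) \<Rightarrow> bool" where
  "completely_trace_free w \<longleftrightarrow>
     (\<forall>b d. (\<Sum>a\<in>UNIV. w a b a d) = 0) \<and>
     (\<forall>a d. (\<Sum>b\<in>UNIV. w a b b d) = 0) \<and>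
     (\<forall>a b. (\<Sum>c\<in>UNIV. w a b c c) = 0)"

context
  fixes M :: "'m topology" and A :: "('m, 'n::finite) chart set"
begin

definition smooth_fun :: "'m set \<Rightarrow> ('m \<Rightarrow> real) \<Rightarrow> bool" where
  "smooth_fun U f \<longleftrightarrow>
     (\<forall>c\<in>A. smooth_on (snd c ` (U \<inter> fst c)) (f \<circ> inv_into (fst c) (snd c)))"

definition smooth_components :: "'m set \<Rightarrow> (('m, 'n) chart \<Rightarrow> 'm \<Rightarrow> real) \<Rightarrow> bool" where
  "smooth_components U f \<longleftrightarrow>
     (\<forall>c\<in>A. smooth_on (snd c ` (U \<inter> fst c)) (f c \<circ> inv_into (fst c) (snd c)))"

definition vector_field :: "'m set \<Rightarrow> ('m, 'n) field1 \<Rightarrow> bool" where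
  "vector_field U Y \<longleftrightarrow>
     (\<forall>b. smooth_components U (\<lambda>c. Y c b)) \<and>
     (\<forall>c\<in>A. \<forall>d\<in>A. \<forall>x\<in>U \<inter> fst c \<inter> fst d. \<forall>b.
        Y d b x = (\<Sum>j\<in>UNIV. jac c d b j x * Y c j x))"

definition one_form :: "'m set \<Rightarrow> ('m, 'n) field1 \<Rightarrow> bool" where
  "one_form U \<Upsilon> \<longleftrightarrow>
     (\<forall>a. smooth_components U (\<lambda>c. \<Upsilon> c a)) \<and>
     (\<forall>c\<in>A. \<forall>d\<in>A. \<forall>x\<in>U \<inter> fst c \<inter> fst d. \<forall>a.
        \<Upsilon> d a x = (\<Sum>i\<in>UNIV. jac d c i a x * \<Upsilon> c i x))"

definition tensor_field_11 :: "'m set \<Rightarrow> ('m, 'n) field2 \<Rightarrow> bool" where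
  "tensor_field_11 U T \<longleftrightarrow>
     (\<forall>a b. smooth_components U (\<lambda>c. T c a b)) \<and>
     (\<forall>c\<in>A. \<forall>d\<in>A. \<forall>x\<in>U \<inter> fst c \<inter> fst d. \<forall>a b.
        T d a b x = (\<Sum>i\<in>UNIV. \<Sum>j\<in>UNIV. jac d c i a x * jac c d b j x * T c i j x))"

text \<open>Pseudo-Riemannian metrics; nondegeneracy leaves the signature arbitrary.\<close>

definition metric :: "'m set \<Rightarrow> ('m, 'n) field2 \<Rightarrow> bool" where
  "metric U g \<longleftrightarrow>
     (\<forall>a b. smooth_components U (\<lambda>c. g c a b)) \<and>
     (\<forall>c\<in>A. \<forall>d\<in>A. \<forall>x\<in>U \<inter> fst c \<inter> fst d. \<forall>a b.
        g d a b x = (\<Sum>i\<in>UNIV. \<Sum>j\<in>UNIV. jac d c i a x * jac d c j b x * g c i j x)) \<and>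
     (\<forall>c\<in>A. \<forall>x\<in>U \<inter> fst c. (\<forall>a b. g c a b x = g c b a x) \<and> det (\<chi> a b. g c a b x) \<noteq> 0)"

text \<open>Affine connections on an open set \<open>N\<close>, as morphisms of sheaves over \<open>N\<close>: the last
  condition is compatibility with restriction. A connection acting on the vector fields on all of
  \<open>N\<close> extends uniquely to such a family. Linearity over \<open>\<real>\<close> is the Leibniz rule for constant
  functions.\<close>

definition affine_connection :: "'m set \<Rightarrow> ('m, 'n) connection \<Rightarrow> bool" where
  "affine_connection N D \<longleftrightarrow>
     (\<forall>U Y. openin M U \<longrightarrow> U \<subseteq> N \<longrightarrow> vector_field U Y \<longrightarrow>
        tensor_field_11 U (D U Y) \<and>
        (\<forall>Z. vector_field U Z \<longrightarrow> (\<forall>c\<in>A. \<forall>x\<in>U \<inter> fst c. \<forall>a b.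
           D U (\<lambda>c b x. Y c b x + Z c b x) c a b x = D U Y c a b x + D U Z c a b x)) \<and>
        (\<forall>f. smooth_fun U f \<longrightarrow> (\<forall>c\<in>A. \<forall>x\<in>U \<inter> fst c. \<forall>a b.
           D U (\<lambda>c b x. f x * Y c b x) c a b x
             = pderiv_in c a f x * Y c b x + f x * D U Y c a b x)) \<and>
        (\<forall>V Z. openin M V \<longrightarrow> V \<subseteq> U \<longrightarrow> vector_field V Z \<longrightarrow>
           (\<forall>c\<in>A. \<forall>x\<in>V \<inter> fst c. \<forall>b. Z c b x = Y c b x) \<longrightarrow>
           (\<forall>c\<in>A. \<forall>x\<in>V \<inter> fst c. \<forall>a b. D V Z c a b x = D U Y c a b x)))"

definition torsion_free :: "'m set \<Rightarrow> ('m, 'n) connection \<Rightarrow> bool" where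
  "torsion_free N D \<longleftrightarrow>
     (\<forall>U Y Z. openin M U \<longrightarrow> U \<subseteq> N \<longrightarrow> vector_field U Y \<longrightarrow> vector_field U Z \<longrightarrow>
        (\<forall>c\<in>A. \<forall>x\<in>U \<inter> fst c. \<forall>b.
           cov D U Y Z c b x - cov D U Z Y c b x = lie_bracket Y Z c b x))"

definition torsion_free_connections :: "'m set \<Rightarrow> ('m, 'n) connection set" where
  "torsion_free_connections N = {D. affine_connection N D \<and> torsion_free N D}"

definition proj_equivalent :: "'m set \<Rightarrow> ('m, 'n) connection \<Rightarrow> ('m, 'n) connection \<Rightarrow> bool" where
  "proj_equivalent N D D' \<longleftrightarrow>
     (\<exists>\<Upsilon>. one_form N \<Upsilon> \<and>
        (\<forall>U Y. openin M U \<longrightarrow> U \<subseteq> N \<longrightarrow> vector_field U Y \<longrightarrow>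
           (\<forall>c\<in>A. \<forall>x\<in>U \<inter> fst c. \<forall>a b.
              D' U Y c a b x = D U Y c a b x + \<Upsilon> c a x * Y c b x
                + (\<Sum>e\<in>UNIV. \<Upsilon> c e x * Y c e x) * kron a b)))"

definition projective_structures :: "('m, 'n) connection set set" where
  "projective_structures =
     torsion_free_connections (topspace M) //
       {(D, D'). D \<in> torsion_free_connections (topspace M) \<and>
          D' \<in> torsion_free_connections (topspace M) \<and> proj_equivalent (topspace M) D D'}"

text \<open>The projective structure that a projective structure on \<open>M\<close> induces on an open subset.\<close>

definition restrict_proj :: "('m, 'n) connection set \<Rightarrow> 'm set \<Rightarrow> ('m, 'n) connection set" where
  "restrict_proj p U = {D' \<in> torsion_free_connections U. \<exists>D\<in>p. proj_equivalent U D D'}"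

text \<open>The components \<open>R\<^sub>a\<^sub>b\<^sup>c\<^sub>d\<close> at \<open>x\<close>, in the chart \<open>c\<close>, of the curvature of a
  torsion-free connection on \<open>N\<close>. For torsion-free connections
  \<open>Y\<^sup>a Z\<^sup>b (\<nabla>\<^sub>a \<nabla>\<^sub>b - \<nabla>\<^sub>b \<nabla>\<^sub>a) V\<^sup>c\<close> is
  \<open>\<nabla>\<^sub>Y \<nabla>\<^sub>Z V - \<nabla>\<^sub>Z \<nabla>\<^sub>Y V - \<nabla>\<^bsub>[Y, Z]\<^esub> V\<close>.\<close>

definition riemann :: "'m set \<Rightarrow> ('m, 'n) connection \<Rightarrow> ('m, 'n) chart \<Rightarrow> 'm \<Rightarrow>
    'n \<Rightarrow> 'n \<Rightarrow> 'n \<Rightarrow> 'n \<Rightarrow> real" where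
  "riemann N D c x = (THE R.
     \<forall>U Y Z V. openin M U \<longrightarrow> U \<subseteq> N \<longrightarrow> x \<in> U \<longrightarrow>
       vector_field U Y \<longrightarrow> vector_field U Z \<longrightarrow> vector_field U V \<longrightarrow>
       (\<forall>i. cov D U Y (cov D U Z V) c i x - cov D U Z (cov D U Y V) c i x
              - cov D U (lie_bracket Y Z) V c i x
            = (\<Sum>a\<in>UNIV. \<Sum>b\<in>UNIV. \<Sum>d\<in>UNIV. Y c a x * Z c b x * R a b i d * V c d x)))"

definition ricci :: "'m set \<Rightarrow> ('m, 'n) connection \<Rightarrow> ('m, 'n) chart \<Rightarrow> 'm \<Rightarrow>
    'n \<Rightarrow> 'n \<Rightarrow> real" where
  "ricci N D c x b d = (\<Sum>a\<in>UNIV. riemann N D c x a b a d)"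

definition proj_weyl :: "'m set \<Rightarrow> ('m, 'n) connection \<Rightarrow> ('m, 'n) chart \<Rightarrow> 'm \<Rightarrow>
    'n \<Rightarrow> 'n \<Rightarrow> 'n \<Rightarrow> 'n \<Rightarrow> real" where
  "proj_weyl N D c x = (THE w. completely_trace_free w \<and>
     (\<exists>P \<beta>. (\<forall>a b. \<beta> a b = P b a - P a b) \<and>
        (\<forall>a b i d. riemann N D c x a b i d =
           w a b i d + (kron a i * P b d - kron b i * P a d) + \<beta> a b * kron i d)))"

definition metric_compatible :: "'m set \<Rightarrow> ('m, 'n) field2 \<Rightarrow> ('m, 'n) connection \<Rightarrow> bool" where
  "metric_compatible N g D \<longleftrightarrow>
     (\<forall>U Y Z. openin M U \<longrightarrow> U \<subseteq> N \<longrightarrow> vector_field U Y \<longrightarrow> vector_field U Z \<longrightarrow>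
        (\<forall>c\<in>A. \<forall>x\<in>U \<inter> fst c. \<forall>e.
           pderiv_in c e (\<lambda>y. \<Sum>a\<in>UNIV. \<Sum>b\<in>UNIV. g c a b y * Y c a y * Z c b y) x
             = (\<Sum>a\<in>UNIV. \<Sum>b\<in>UNIV.
                  g c a b x * D U Y c e a x * Z c b x + g c a b x * Y c a x * D U Z c e b x)))"

definition levi_civita :: "'m set \<Rightarrow> ('m, 'n) field2 \<Rightarrow> ('m, 'n) connection \<Rightarrow> bool" where
  "levi_civita N g D \<longleftrightarrow> D \<in> torsion_free_connections N \<and> metric_compatible N g D"

definition einstein_metric :: "'m set \<Rightarrow> ('m, 'n) field2 \<Rightarrow> bool" where
  "einstein_metric N g \<longleftrightarrow> metric N g \<and>
     (\<exists>D K. levi_civita N g D \<and>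
        (\<forall>c\<in>A. \<forall>x\<in>N \<inter> fst c. \<forall>a b. ricci N D c x a b = K * g c a b x))"

text \<open>Existence in \<open>p\<close> of an Einstein Levi-Civita connection near every point of \<open>M\<close>. Existence
  on all of \<open>M\<close> implies this, but has obstructions beyond the projective curvature: the Hopf manifold
  \<open>(\<real>\<^sup>3 - {0}) / (x \<sim> 2x)\<close>, diffeomorphic to \<open>S\<^sup>2 \<times> S\<^sup>1\<close>, is projectively flat
  but carries no metric of constant curvature.\<close>

definition locally_einstein :: "('m, 'n) connection set \<Rightarrow> bool" where
  "locally_einstein p \<longleftrightarrow>
     (\<forall>x\<in>topspace M. \<exists>U g D. openin M U \<and> x \<in> U \<and>
        einstein_metric U g \<and> levi_civita U g D \<and> D \<in> restrict_proj p U)"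

end

end

theory Submission
  imports Defs
begin

text \<open>In dimension three the projective Weyl tensor determines everything. If \<open>\<nabla>\<close> is the Levi-Civita connection of an
  Einstein metric, then the curvature with the Einstein part removed is skew in both index pairs and trace-free, and such
  a tensor is zero in dimension three; hence \<open>W = 0\<close>.

  Conversely let \<open>W = 0\<close>. Near a point a projective change makes \<open>\<Gamma>\<close> trace-free, so that the Schouten tensor \<open>P\<close> is
  symmetric, and the Bianchi identity with three distinct indices gives \<open>\<nabla>\<^sub>[\<^sub>a P\<^sub>b\<^sub>]\<^sub>d = 0\<close>. Then the linear system
  \<open>\<nabla>\<^sub>a \<nabla>\<^sub>b t + P\<^sub>a\<^sub>b t = 0\<close> is flat and has four independent solutions. Their quotients \<open>t\<^sub>k / t\<^sub>0\<close> are
  coordinates whose differentials are parallel for the connection of the class given by \<open>\<Upsilon> = - d t\<^sub>0 / t\<^sub>0\<close>, which is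
  therefore the Levi-Civita connection of the flat metric with these differentials as orthonormal coframe.\<close>

subsection \<open>Smooth functions on Euclidean space\<close>

text \<open>The obstacle is that \<open>riemann\<close> and \<open>proj_weyl\<close> are definite
  descriptions over fields given in all charts, whereas the geometry is analysis in one chart.
  Existence and uniqueness of the described objects have to be settled before anything can be
  computed; afterwards curvature is an expression in \<open>pchrist\<close>. Dimension three enters
  twice. A tensor skew in two pairs is a 3 by 3 matrix, recovered from its trace by a cofactor
  identity that needs no orthonormal frame and so holds in every signature. And two indices always
  leave a third one for the Bianchi identity. The change making \<Gamma> trace-free is -1/4 of its
  trace, in dimension n it would be -1/(n+1). This is a chart-dependent expression and no 1-form; no
  harm results, because the total \<Upsilon> is read as components in one chart and extended by the
  transformation law. All four solutions must live on one neighbourhood, so the radius on which the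
  flat system is solved may not depend on the initial values. The quotients then cost a further
  shrinking, to where the denominator and the Jacobian do not vanish.\<close>

definition pd :: "'n::finite \<Rightarrow> (real ^ 'n \<Rightarrow> real) \<Rightarrow> real ^ 'n \<Rightarrow> real" where
  "pd i f z = frechet_derivative f (at z) (axis i 1)"

lemma C_k_on_Suc:
  "C_k_on (Suc k) S f \<longleftrightarrow> (\<forall>z\<in>S. f differentiable (at z)) \<and> (\<forall>i. C_k_on k S (pd i f))"
  by (simp add: pd_def[abs_def])

declare C_k_on.simps(2) [simp del]

lemma vec_eq_sum_axis: "(v :: real ^ 'n::finite) = (\<Sum>i\<in>UNIV. (v $ i) *\<^sub>R axis i 1)"
  by (simp add: vec_eq_iff axis_def if_distrib [of "\<lambda>t. _ * t"] cong: if_cong)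

lemma has_derivative_pd:
  fixes f :: "real ^ 'n::finite \<Rightarrow> real"
  assumes "f differentiable (at z)"
  shows "(f has_derivative (\<lambda>h. \<Sum>i\<in>UNIV. h $ i * pd i f z)) (at z)"
proof -
  have D: "(f has_derivative frechet_derivative f (at z)) (at z)"
    using assms frechet_derivative_works by blast
  interpret linear "frechet_derivative f (at z)"
    by (rule linear_frechet_derivative[OF assms])
  have "frechet_derivative f (at z) h = (\<Sum>i\<in>UNIV. h $ i * pd i f z)" for h
    by (subst vec_eq_sum_axis[of h]) (simp add: sum scaleR pd_def)
  then have "frechet_derivative f (at z) = (\<lambda>h. \<Sum>i\<in>UNIV. h $ i * pd i f z)" by auto
  with D show ?thesis by simp
qed

lemma pd_eqI:
  assumes "(f has_derivative f') (at z)"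
  shows "pd i f z = f' (axis i 1)"
  using frechet_derivative_at[OF assms] by (simp add: pd_def)

text \<open>Partial derivatives are found by exhibiting a total derivative in coordinate form and
  reading off its coefficients; the addition, product, inverse and chain rules for \<open>pd\<close>
  all come from the rule for \<open>has_derivative\<close> in this way.\<close>

lemma pd_eq_coeff:
  fixes f :: "real ^ 'n::finite \<Rightarrow> real"
  assumes "(f has_derivative (\<lambda>h. \<Sum>i\<in>UNIV. h $ i * c i)) (at z)"
  shows "pd i f z = c i"
  by (simp add: pd_eqI[OF assms] axis_def if_distrib [of "\<lambda>t. t * _"] cong: if_cong)

lemma has_derivative_cong_open:
  assumes "open S" "z \<in> S" "\<And>y. y \<in> S \<Longrightarrow> f y = g y"
  shows "(f has_derivative f') (at z) \<longleftrightarrow> (g has_derivative f') (at z)"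
  using assms by (metis has_derivative_transform_within_open)

lemma differentiable_cong_open:
  assumes "open S" "z \<in> S" "\<And>y. y \<in> S \<Longrightarrow> f y = g y"
  shows "f differentiable (at z) \<longleftrightarrow> g differentiable (at z)"
  unfolding differentiable_def using has_derivative_cong_open[OF assms(1,2), of f g] assms(3) by auto

lemma pd_cong_open:
  assumes "open S" "z \<in> S" "\<And>y. y \<in> S \<Longrightarrow> f y = g y"
  shows "pd i f z = pd i g z"
  unfolding pd_def frechet_derivative_def using has_derivative_cong_open[OF assms(1,2), of f g] assms(3) by simp

lemma C_k_on_cong:
  assumes "open S" "\<And>y. y \<in> S \<Longrightarrow> f y = g y"
  shows "C_k_on k S f \<longleftrightarrow> C_k_on k S g"
  using assms(2)
proof (induction k arbitrary: f g)
  case 0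
  then show ?case by (simp cong: continuous_on_cong)
next
  case (Suc k)
  have "C_k_on k S (pd i f) \<longleftrightarrow> C_k_on k S (pd i g)" for i
    by (rule Suc.IH) (use pd_cong_open[OF assms(1)] Suc.prems in blast)
  moreover have "(\<forall>z\<in>S. f differentiable (at z)) \<longleftrightarrow> (\<forall>z\<in>S. g differentiable (at z))"
    using differentiable_cong_open[OF assms(1)] Suc.prems by blast
  ultimately show ?case by (simp add: C_k_on_Suc)
qed

lemma C_k_on_subset: "C_k_on k S f \<Longrightarrow> T \<subseteq> S \<Longrightarrow> C_k_on k T f"
  by (induction k arbitrary: f) (auto simp: C_k_on_Suc intro: continuous_on_subset)

lemma C_k_on_imp_continuous: "C_k_on k S f \<Longrightarrow> continuous_on S f"
  by (cases k) (auto simp: C_k_on_Suc intro!: continuous_at_imp_continuous_on differentiable_imp_continuous_within)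

lemma C_k_on_SucD: "C_k_on (Suc k) S f \<Longrightarrow> C_k_on k S f"
  by (induction k arbitrary: f) (auto simp: C_k_on_Suc intro!: continuous_at_imp_continuous_on differentiable_imp_continuous_within)

lemma C_k_on_const: "C_k_on k S (\<lambda>z. c)"
proof (induction k arbitrary: c)
  case (Suc k)
  have "pd i (\<lambda>z. c) = (\<lambda>z. 0)" for i :: 'a
    by (auto simp: pd_def)
  then show ?case using Suc by (simp add: C_k_on_Suc)
qed simp

lemma pd_const [simp]: "pd i (\<lambda>z. c) z = 0"
  by (simp add: pd_def)

lemma pd_add:
  assumes "f differentiable (at z)" "g differentiable (at z)"
  shows "pd i (\<lambda>z. f z + g z) z = pd i f z + pd i g z"
  by (rule pd_eq_coeff)
    (rule has_derivative_eq_rhs[OF has_derivative_add[OF has_derivative_pd has_derivative_pd]],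
      use assms in \<open>auto simp: sum.distrib algebra_simps\<close>)

lemma pd_minus:
  assumes "f differentiable (at z)"
  shows "pd i (\<lambda>z. - f z) z = - pd i f z"
  by (rule pd_eq_coeff)
    (rule has_derivative_eq_rhs[OF has_derivative_minus[OF has_derivative_pd]],
      use assms in \<open>auto simp: sum_negf\<close>)

lemma pd_diff:
  assumes "f differentiable (at z)" "g differentiable (at z)"
  shows "pd i (\<lambda>z. f z - g z) z = pd i f z - pd i g z"
  using pd_add[of f z "\<lambda>z. - g z"] assms by (simp add: pd_minus)

lemma pd_mult:
  assumes "f differentiable (at z)" "g differentiable (at z)"
  shows "pd i (\<lambda>z. f z * g z) z = pd i f z * g z + f z * pd i g z"
  by (rule pd_eq_coeff)
    (rule has_derivative_eq_rhs[OF has_derivative_mult[OF has_derivative_pd has_derivative_pd]],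
      use assms in \<open>auto simp: sum.distrib algebra_simps sum_distrib_left\<close>)

lemma pd_cmult:
  assumes "f differentiable (at z)"
  shows "pd i (\<lambda>z. c * f z) z = c * pd i f z"
  using pd_mult[of "\<lambda>z. c" z f i] assms by simp

lemma pd_sum:
  assumes "\<And>j. j \<in> J \<Longrightarrow> f j differentiable (at z)"
  shows "pd i (\<lambda>z. \<Sum>j\<in>J. f j z) z = (\<Sum>j\<in>J. pd i (f j) z)"
  using assms
proof (induction J rule: infinite_finite_induct)
  case (insert x F)
  have "(\<lambda>z. \<Sum>j\<in>F. f j z) differentiable (at z)"
    using insert by (cases "F = {}") (auto intro!: differentiable_sum)
  then show ?case using insert by (simp add: pd_add)
qed auto

lemma pd_inverse:
  assumes "f differentiable (at z)" "f z \<noteq> 0"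
  shows "pd i (\<lambda>z. inverse (f z)) z = - (inverse (f z) * inverse (f z) * pd i f z)"
  by (rule pd_eq_coeff[where c = "\<lambda>i. - (inverse (f z) * inverse (f z) * pd i f z)"])
    (rule has_derivative_eq_rhs[OF Deriv.has_derivative_inverse[of f z, OF assms(2) has_derivative_pd]],
      use assms in \<open>auto simp: sum_negf sum_distrib_left sum_distrib_right algebra_simps\<close>)

lemma differentiable_inverse':
  fixes f :: "real ^ 'n::finite \<Rightarrow> real"
  assumes "f differentiable (at z)" "f z \<noteq> 0"
  shows "(\<lambda>z. inverse (f z)) differentiable (at z)"
  using Deriv.has_derivative_inverse[of f z, OF assms(2) has_derivative_pd[OF assms(1)]]
  by (auto simp: differentiable_def)

lemma pd_coord: "pd i (\<lambda>z :: real ^ 'n::finite. z $ j) z = kron i j"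
  by (subst pd_eqI[OF bounded_linear_imp_has_derivative[OF bounded_linear_vec_nth]])
    (auto simp: axis_def kron_def)

lemma C_k_on_add:
  assumes "open S" shows "C_k_on k S f \<Longrightarrow> C_k_on k S g \<Longrightarrow> C_k_on k S (\<lambda>z. f z + g z)"
proof (induction k arbitrary: f g)
  case (Suc k)
  have "C_k_on k S (pd i (\<lambda>z. f z + g z))" for i
    using C_k_on_cong[OF assms, of "pd i (\<lambda>z. f z + g z)" "\<lambda>z. pd i f z + pd i g z" k] Suc
    by (auto simp: C_k_on_Suc pd_add)
  then show ?case using Suc.prems by (auto simp: C_k_on_Suc)
qed (auto intro: continuous_intros)

lemma C_k_on_minus:
  assumes "open S" shows "C_k_on k S f \<Longrightarrow> C_k_on k S (\<lambda>z. - f z)"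
proof (induction k arbitrary: f)
  case (Suc k)
  have "C_k_on k S (pd i (\<lambda>z. - f z))" for i
    using C_k_on_cong[OF assms, of "pd i (\<lambda>z. - f z)" "\<lambda>z. - pd i f z" k] Suc
    by (auto simp: C_k_on_Suc pd_minus)
  then show ?case using Suc.prems by (auto simp: C_k_on_Suc)
qed (auto intro: continuous_intros)

text \<open>The Leibniz rule replaces one factor by its derivative, so the induction has to range
  over all pairs \<open>f\<close>, \<open>g\<close>, and each factor is also needed one order
  lower.\<close>

lemma C_k_on_mult:
  assumes "open S" shows "C_k_on k S f \<Longrightarrow> C_k_on k S g \<Longrightarrow> C_k_on k S (\<lambda>z. f z * g z)"
proof (induction k arbitrary: f g)
  case (Suc k)
  have "C_k_on k S (\<lambda>z. pd i f z * g z + f z * pd i g z)" for i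
    using Suc C_k_on_SucD[OF Suc.prems(1)] C_k_on_SucD[OF Suc.prems(2)]
    by (intro C_k_on_add assms Suc.IH) (auto simp: C_k_on_Suc)
  then have "C_k_on k S (pd i (\<lambda>z. f z * g z))" for i
    using C_k_on_cong[OF assms, of "pd i (\<lambda>z. f z * g z)" "\<lambda>z. pd i f z * g z + f z * pd i g z" k] Suc.prems
    by (auto simp: C_k_on_Suc pd_mult)
  then show ?case using Suc.prems by (auto simp: C_k_on_Suc intro!: differentiable_mult)
qed (auto intro: continuous_intros)

text \<open>The derivative is \<open>- (1/f)\<^sup>2\<close> times that of \<open>f\<close>. It
  involves only the reciprocal of the same \<open>f\<close>, one order lower, so the induction runs
  with \<open>f\<close> fixed.\<close>

lemma C_k_on_inverse:
  assumes "open S" shows "C_k_on k S f \<Longrightarrow> (\<And>z. z \<in> S \<Longrightarrow> f z \<noteq> 0) \<Longrightarrow> C_k_on k S (\<lambda>z. inverse (f z))"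
proof (induction k)
  case (Suc k)
  have 1: "C_k_on k S (\<lambda>z. inverse (f z))"
    using Suc C_k_on_SucD by blast
  have "C_k_on k S (\<lambda>z. - (inverse (f z) * inverse (f z) * pd i f z))" for i
    using Suc.prems(1) by (intro C_k_on_minus C_k_on_mult assms 1) (auto simp: C_k_on_Suc)
  then have "C_k_on k S (pd i (\<lambda>z. inverse (f z)))" for i
    using C_k_on_cong[OF assms, of "pd i (\<lambda>z. inverse (f z))" "\<lambda>z. - (inverse (f z) * inverse (f z) * pd i f z)" k] Suc.prems
    by (auto simp: C_k_on_Suc pd_inverse)
  then show ?case using Suc.prems by (auto simp: C_k_on_Suc intro!: differentiable_inverse')
qed (auto intro!: continuous_on_inverse)

lemma smooth_on_const: "smooth_on S (\<lambda>z. c)"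
  by (simp add: smooth_on_def C_k_on_const)

lemma smooth_on_add: "open S \<Longrightarrow> smooth_on S f \<Longrightarrow> smooth_on S g \<Longrightarrow> smooth_on S (\<lambda>z. f z + g z)"
  by (simp add: smooth_on_def C_k_on_add)

lemma smooth_on_minus: "open S \<Longrightarrow> smooth_on S f \<Longrightarrow> smooth_on S (\<lambda>z. - f z)"
  by (simp add: smooth_on_def C_k_on_minus)

lemma smooth_on_diff: "open S \<Longrightarrow> smooth_on S f \<Longrightarrow> smooth_on S g \<Longrightarrow> smooth_on S (\<lambda>z. f z - g z)"
  using smooth_on_add[of S f "\<lambda>z. - g z"] by (simp add: smooth_on_minus)

lemma smooth_on_mult: "open S \<Longrightarrow> smooth_on S f \<Longrightarrow> smooth_on S g \<Longrightarrow> smooth_on S (\<lambda>z. f z * g z)"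
  by (simp add: smooth_on_def C_k_on_mult)

lemma smooth_on_inverse:
  "open S \<Longrightarrow> smooth_on S f \<Longrightarrow> (\<And>z. z \<in> S \<Longrightarrow> f z \<noteq> 0) \<Longrightarrow> smooth_on S (\<lambda>z. inverse (f z))"
  by (simp add: smooth_on_def C_k_on_inverse)

lemma smooth_on_sum:
  "open S \<Longrightarrow> (\<And>j. j \<in> J \<Longrightarrow> smooth_on S (f j)) \<Longrightarrow> smooth_on S (\<lambda>z. \<Sum>j\<in>J. f j z)"
  by (induction J rule: infinite_finite_induct) (auto intro: smooth_on_const smooth_on_add)

lemma smooth_on_subset: "smooth_on S f \<Longrightarrow> T \<subseteq> S \<Longrightarrow> smooth_on T f"
  unfolding smooth_on_def using C_k_on_subset by blast

lemma smooth_on_cong: "open S \<Longrightarrow> (\<And>y. y \<in> S \<Longrightarrow> f y = g y) \<Longrightarrow> smooth_on S f \<longleftrightarrow> smooth_on S g"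
  unfolding smooth_on_def using C_k_on_cong by metis

lemma smooth_on_pd: "smooth_on S f \<Longrightarrow> smooth_on S (pd i f)"
  unfolding smooth_on_def using C_k_on_Suc by blast

lemma smooth_on_differentiable: "smooth_on S f \<Longrightarrow> z \<in> S \<Longrightarrow> f differentiable (at z)"
  unfolding smooth_on_def using C_k_on_Suc by blast

lemma smooth_on_continuous: "smooth_on S f \<Longrightarrow> continuous_on S f"
  unfolding smooth_on_def using C_k_on_imp_continuous by blast

section \<open>Chain rule and smoothness of composites\<close>

lemma differentiable_componentwise_vec:
  fixes \<tau> :: "real ^ 'n::finite \<Rightarrow> real ^ 'm::finite"
  assumes "\<And>j. (\<lambda>z. \<tau> z $ j) differentiable (at z)"
  shows "(\<tau> has_derivative (\<lambda>h. \<chi> j. \<Sum>i\<in>UNIV. h $ i * pd i (\<lambda>z. \<tau> z $ j) z)) (at z)"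
proof -
  have "(\<tau> has_derivative (\<lambda>h. \<chi> j. \<Sum>i\<in>UNIV. h $ i * pd i (\<lambda>z. \<tau> z $ j) z)) (at z within UNIV)"
    by (subst has_derivative_componentwise_within)
      (auto simp: Basis_vec_def inner_axis intro!: has_derivative_pd assms)
  then show ?thesis by simp
qed

lemma has_derivative_compose_pd:
  fixes \<tau> :: "real ^ 'n::finite \<Rightarrow> real ^ 'm::finite"
  assumes "\<And>j. (\<lambda>z. \<tau> z $ j) differentiable (at z)" "f differentiable (at (\<tau> z))"
  shows "((\<lambda>z. f (\<tau> z)) has_derivative
           (\<lambda>h. \<Sum>i\<in>UNIV. h $ i * (\<Sum>j\<in>UNIV. pd i (\<lambda>z. \<tau> z $ j) z * pd j f (\<tau> z)))) (at z)"
proof -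
  have "((\<lambda>z. f (\<tau> z)) has_derivative
     (\<lambda>h. \<Sum>j\<in>UNIV. (\<Sum>i\<in>UNIV. h $ i * pd i (\<lambda>z. \<tau> z $ j) z) * pd j f (\<tau> z))) (at z)"
    using has_derivative_compose[OF differentiable_componentwise_vec[OF assms(1)] has_derivative_pd[OF assms(2)]]
    by simp
  moreover have "(\<Sum>j\<in>UNIV. (\<Sum>i\<in>UNIV. h $ i * pd i (\<lambda>z. \<tau> z $ j) z) * pd j f (\<tau> z))
     = (\<Sum>i\<in>UNIV. h $ i * (\<Sum>j\<in>UNIV. pd i (\<lambda>z. \<tau> z $ j) z * pd j f (\<tau> z)))" for h
    unfolding sum_distrib_left sum_distrib_right by (subst sum.swap) (simp add: mult.assoc)
  ultimately show ?thesis by simp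
qed

lemma pd_compose:
  fixes \<tau> :: "real ^ 'n::finite \<Rightarrow> real ^ 'm::finite"
  assumes "\<And>j. (\<lambda>z. \<tau> z $ j) differentiable (at z)" "f differentiable (at (\<tau> z))"
  shows "pd i (\<lambda>z. f (\<tau> z)) z = (\<Sum>j\<in>UNIV. pd i (\<lambda>z. \<tau> z $ j) z * pd j f (\<tau> z))"
  by (rule pd_eq_coeff[where f = "\<lambda>z. f (\<tau> z)" and c = "\<lambda>i. \<Sum>j\<in>UNIV. pd i (\<lambda>z. \<tau> z $ j) z * pd j f (\<tau> z)",
      OF has_derivative_compose_pd[of \<tau> z f, OF assms]])

text \<open>By the chain rule the derivatives of the composite are built from the functions
  \<open>pd j f\<close> composed with the same \<tau>, so the induction generalises over
  \<open>f\<close> alone.\<close>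

lemma C_k_on_compose:
  fixes \<tau> :: "real ^ 'n::finite \<Rightarrow> real ^ 'm::finite"
  assumes S: "open S" and \<tau>: "\<And>j. smooth_on S (\<lambda>z. \<tau> z $ j)" and im: "\<tau> ` S \<subseteq> T"
  shows "C_k_on k T f \<Longrightarrow> C_k_on k S (\<lambda>z. f (\<tau> z))"
proof (induction k arbitrary: f)
  case 0
  have "continuous_on S \<tau>"
    using continuous_on_vec_lambda[of S "\<lambda>j z. \<tau> z $ j", OF smooth_on_continuous[OF \<tau>]] by simp
  with 0 im show ?case by (simp add: continuous_on_compose2)
next
  case (Suc k)
  have d: "(\<lambda>z. \<tau> z $ j) differentiable (at z)" "f differentiable (at (\<tau> z))" if "z \<in> S" for z j
    using Suc.prems smooth_on_differentiable[OF \<tau> that] im that by (auto simp: C_k_on_Suc)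
  have sm: "C_k_on k S (\<lambda>z. \<Sum>j\<in>J. g j z)" if "\<And>j. C_k_on k S (g j)" for g :: "'m \<Rightarrow> _" and J
    by (induction J rule: infinite_finite_induct) (auto intro: C_k_on_const C_k_on_add S that)
  have "C_k_on k S (pd i (\<lambda>z. \<tau> z $ j))" for i j
    using smooth_on_pd[OF \<tau>] by (simp add: smooth_on_def)
  moreover have "C_k_on k S (\<lambda>z. pd j f (\<tau> z))" for j
    using Suc.prems by (intro Suc.IH) (simp add: C_k_on_Suc)
  ultimately have s: "C_k_on k S (\<lambda>z. \<Sum>j\<in>UNIV. pd i (\<lambda>z. \<tau> z $ j) z * pd j f (\<tau> z))" for i
    by (intro sm C_k_on_mult S)
  have e: "pd i (\<lambda>z. f (\<tau> z)) z = (\<Sum>j\<in>UNIV. pd i (\<lambda>z. \<tau> z $ j) z * pd j f (\<tau> z))" if "z \<in> S" for i z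
    by (rule pd_compose[of \<tau> z f i, OF d[OF that]])
  have "C_k_on k S (pd i (\<lambda>z. f (\<tau> z)))" for i
    using s[of i] C_k_on_cong[of S "pd i (\<lambda>z. f (\<tau> z))" "\<lambda>z. \<Sum>j\<in>UNIV. pd i (\<lambda>z. \<tau> z $ j) z * pd j f (\<tau> z)" k, OF S e] by blast
  moreover have "(\<lambda>z. f (\<tau> z)) differentiable (at z)" if "z \<in> S" for z
    using has_derivative_compose_pd[of \<tau> z f, OF d[OF that]] by (auto simp: differentiable_def)
  ultimately show ?case by (simp add: C_k_on_Suc)
qed

lemma smooth_on_compose:
  fixes \<tau> :: "real ^ 'n::finite \<Rightarrow> real ^ 'm::finite"
  assumes "open S" "\<And>j. smooth_on S (\<lambda>z. \<tau> z $ j)" "\<tau> ` S \<subseteq> T" "smooth_on T f"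
  shows "smooth_on S (\<lambda>z. f (\<tau> z))"
proof -
  have "C_k_on k S (\<lambda>z. f (\<tau> z))" for k
    by (rule C_k_on_compose[OF assms(1-3)]) (use assms(4) smooth_on_def in blast)
  then show ?thesis by (simp add: smooth_on_def)
qed

section \<open>Symmetry of second partial derivatives\<close>

lemma DERIV_along_axis:
  fixes f :: "real ^ 'n::finite \<Rightarrow> real"
  assumes "f differentiable (at (p + t *\<^sub>R axis i 1))"
  shows "((\<lambda>t. f (p + t *\<^sub>R axis i 1)) has_real_derivative pd i f (p + t *\<^sub>R axis i 1)) (at t)"
proof -
  have "((\<lambda>t. p + t *\<^sub>R axis i 1) has_derivative (\<lambda>h. h *\<^sub>R axis i (1::real))) (at t)"
    by (auto intro!: derivative_eq_intros)
  from has_derivative_compose[OF this has_derivative_pd[OF assms]]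
  have "((\<lambda>t. f (p + t *\<^sub>R axis i 1)) has_derivative
     (\<lambda>h. \<Sum>j\<in>UNIV. (h *\<^sub>R axis i 1) $ j * pd j f (p + t *\<^sub>R axis i 1))) (at t)" .
  moreover have "(\<lambda>h. \<Sum>j\<in>UNIV. (h *\<^sub>R axis i 1) $ j * pd j f w) = (*) (pd i f w)" for w
  proof
    fix h
    have "(h *\<^sub>R axis i 1) $ j * pd j f w = (if j = i then h * pd i f w else 0)" for j
      by (simp add: axis_def)
    then show "(\<Sum>j\<in>UNIV. (h *\<^sub>R axis i 1) $ j * pd j f w) = pd i f w * h" by simp
  qed
  ultimately show ?thesis
    by (simp only: has_field_derivative_def)
qed

text \<open>The second difference is the increment in direction \<open>i\<close> of an increment in
  direction \<open>j\<close>. The mean value theorem in direction \<open>i\<close>, then in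
  direction \<open>j\<close>, turns it into a mixed derivative at a nearby point.\<close>

lemma second_difference_mvt:
  fixes f :: "real ^ 'n::finite \<Rightarrow> real"
  assumes f: "\<And>y. y \<in> ball z r \<Longrightarrow> f differentiable (at y)"
    and fi: "\<And>y. y \<in> ball z r \<Longrightarrow> pd i f differentiable (at y)"
    and h: "0 < h" "2 * h < r"
  shows "\<exists>y. dist z y \<le> 2 * h \<and>
     f (z + h *\<^sub>R axis i 1 + h *\<^sub>R axis j 1) - f (z + h *\<^sub>R axis i 1) - f (z + h *\<^sub>R axis j 1) + f z
       = h * h * pd j (pd i f) y"
proof -
  have nrm: "norm (s *\<^sub>R axis i 1 + t *\<^sub>R axis j (1::real)) \<le> 2 * h" if "0 \<le> s" "s \<le> h" "0 \<le> t" "t \<le> h" for s t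
    using norm_triangle_ineq[of "s *\<^sub>R axis i 1" "t *\<^sub>R axis j (1::real)"] that by (simp add: norm_axis_1)
  have inb: "z + s *\<^sub>R axis i 1 + t *\<^sub>R axis j 1 \<in> ball z r" if "0 \<le> s" "s \<le> h" "0 \<le> t" "t \<le> h" for s t
  proof -
    have "z - (z + s *\<^sub>R axis i 1 + t *\<^sub>R axis j 1) = - (s *\<^sub>R axis i 1 + t *\<^sub>R axis j 1)" by simp
    then show ?thesis using nrm[OF that] h by (simp only: mem_ball dist_norm norm_minus_cancel)
  qed
  define g where "g = (\<lambda>s. f ((z + h *\<^sub>R axis j 1) + s *\<^sub>R axis i 1) - f (z + s *\<^sub>R axis i 1))"
  define g' where "g' = (\<lambda>s. pd i f ((z + h *\<^sub>R axis j 1) + s *\<^sub>R axis i 1) - pd i f (z + s *\<^sub>R axis i 1))"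
  have "\<exists>s. 0 < s \<and> s < h \<and> g h - g 0 = (h - 0) * g' s"
  proof (rule MVT2)
    fix s assume s: "0 \<le> s" "s \<le> h"
    have "f differentiable (at ((z + h *\<^sub>R axis j 1) + s *\<^sub>R axis i 1))" "f differentiable (at (z + s *\<^sub>R axis i 1))"
      using f inb[of s h] inb[of s 0] s h by (auto simp: ac_simps)
    then show "(g has_real_derivative g' s) (at s)"
      unfolding g_def g'_def by (intro DERIV_diff DERIV_along_axis)
  qed (use h in auto)
  then obtain s where s: "0 < s" "s < h" and gs: "g h - g 0 = h * g' s" by auto
  have "\<exists>t. 0 < t \<and> t < h \<and> pd i f ((z + s *\<^sub>R axis i 1) + h *\<^sub>R axis j 1) - pd i f ((z + s *\<^sub>R axis i 1) + 0 *\<^sub>R axis j 1)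
     = (h - 0) * pd j (pd i f) ((z + s *\<^sub>R axis i 1) + t *\<^sub>R axis j 1)"
  proof (rule MVT2)
    fix t assume t: "0 \<le> t" "t \<le> h"
    show "((\<lambda>t. pd i f ((z + s *\<^sub>R axis i 1) + t *\<^sub>R axis j 1)) has_real_derivative
        pd j (pd i f) ((z + s *\<^sub>R axis i 1) + t *\<^sub>R axis j 1)) (at t)"
      by (rule DERIV_along_axis) (use fi inb[of s t] s t in auto)
  qed (use h in auto)
  then obtain t where t: "0 < t" "t < h"
    and ht: "pd i f ((z + s *\<^sub>R axis i 1) + h *\<^sub>R axis j 1) - pd i f (z + s *\<^sub>R axis i 1)
      = h * pd j (pd i f) ((z + s *\<^sub>R axis i 1) + t *\<^sub>R axis j 1)" by auto
  have "g' s = h * pd j (pd i f) ((z + s *\<^sub>R axis i 1) + t *\<^sub>R axis j 1)"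
    using ht by (simp add: g'_def ac_simps)
  then have "f (z + h *\<^sub>R axis i 1 + h *\<^sub>R axis j 1) - f (z + h *\<^sub>R axis i 1) - f (z + h *\<^sub>R axis j 1) + f z
       = h * h * pd j (pd i f) ((z + s *\<^sub>R axis i 1) + t *\<^sub>R axis j 1)"
    using gs by (simp add: g_def ac_simps)
  moreover have "dist z ((z + s *\<^sub>R axis i 1) + t *\<^sub>R axis j 1) \<le> 2 * h"
  proof -
    have "z - (z + s *\<^sub>R axis i 1 + t *\<^sub>R axis j 1) = - (s *\<^sub>R axis i 1 + t *\<^sub>R axis j 1)" by simp
    then show ?thesis using nrm[of s t] s t by (simp only: dist_norm norm_minus_cancel)
  qed
  ultimately show ?thesis by blast
qed

text \<open>The second difference is symmetric in \<open>i\<close> and \<open>j\<close>, so the two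
  mixed derivatives take a common value at points arbitrarily close to \<open>z\<close>; their
  continuity forces equality at \<open>z\<close>.\<close>

lemma pd_commute:
  fixes f :: "real ^ 'n::finite \<Rightarrow> real"
  assumes S: "open S" "z \<in> S" and f: "smooth_on S f"
  shows "pd i (pd j f) z = pd j (pd i f) z"
proof (rule ccontr)
  assume ne: "pd i (pd j f) z \<noteq> pd j (pd i f) z"
  define e where "e = \<bar>pd i (pd j f) z - pd j (pd i f) z\<bar> / 2"
  have e: "e > 0" using ne by (simp add: e_def)
  have ct: "isCont (pd i (pd j f)) z" for i j
    using smooth_on_continuous[OF smooth_on_pd[OF smooth_on_pd[OF f]]] S continuous_on_eq_continuous_at by blast
  obtain r where r: "r > 0" "ball z r \<subseteq> S" using S openE by blast
  from ct[of i j] e obtain d1 where d1: "d1 > 0" "\<And>y. dist y z < d1 \<Longrightarrow> dist (pd i (pd j f) y) (pd i (pd j f) z) < e"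
    unfolding continuous_at_eps_delta by metis
  from ct[of j i] e obtain d2 where d2: "d2 > 0" "\<And>y. dist y z < d2 \<Longrightarrow> dist (pd j (pd i f) y) (pd j (pd i f) z) < e"
    unfolding continuous_at_eps_delta by metis
  \<comment> \<open>Division by 4 keeps \<open>2 * h\<close>, the distance bound of
    \<open>second_difference_mvt\<close>, strictly below all three radii.\<close>
  define h where "h = min r (min d1 d2) / 4"
  have h: "0 < h" "2 * h < r" "2 * h < d1" "2 * h < d2"
    using r(1) d1(1) d2(1) by (auto simp: h_def)
  have df: "f differentiable (at y)" "pd i f differentiable (at y)" if "y \<in> ball z r" for y i
    using that r f smooth_on_differentiable smooth_on_pd by blast+
  obtain y1 where y1: "dist z y1 \<le> 2 * h" 
     "f (z + h *\<^sub>R axis i 1 + h *\<^sub>R axis j 1) - f (z + h *\<^sub>R axis i 1) - f (z + h *\<^sub>R axis j 1) + f z = h * h * pd j (pd i f) y1"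
    using second_difference_mvt[OF df h(1,2), where i=i and j=j] by blast
  obtain y2 where y2: "dist z y2 \<le> 2 * h" 
     "f (z + h *\<^sub>R axis j 1 + h *\<^sub>R axis i 1) - f (z + h *\<^sub>R axis j 1) - f (z + h *\<^sub>R axis i 1) + f z = h * h * pd i (pd j f) y2"
    using second_difference_mvt[OF df h(1,2), where i=j and j=i] by blast
  have "h * h * pd j (pd i f) y1 = h * h * pd i (pd j f) y2"
    using y1(2) y2(2) unfolding add.assoc add.commute[of "h *\<^sub>R axis j 1"] by linarith
  then have "pd j (pd i f) y1 = pd i (pd j f) y2" using h by simp
  moreover have "\<bar>pd i (pd j f) y2 - pd i (pd j f) z\<bar> < e" "\<bar>pd j (pd i f) y1 - pd j (pd i f) z\<bar> < e"
    using d1(2)[of y2] d2(2)[of y1] y1(1) y2(1) h by (auto simp: dist_commute dist_real_def)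
  ultimately show False unfolding e_def by (simp add: abs_if split: if_splits)
qed

subsection \<open>Flat linear first-order systems\<close>

text \<open>The weighted ray averages of the Poincare homotopy operator. The weight is there because
  every derivative in \<open>x\<close> brings out one more factor \<open>t\<close>.\<close>

definition ray_integral :: "nat \<Rightarrow> real ^ 'n::finite \<Rightarrow> (real ^ 'n \<Rightarrow> real) \<Rightarrow> real ^ 'n \<Rightarrow> real" where
  "ray_integral m z0 h x = integral (cbox 0 1) (\<lambda>t. t ^ m * h (z0 + t *\<^sub>R (x - z0)))"

lemma ray_in_ball:
  fixes x z0 :: "'a::real_normed_vector"
  assumes "x \<in> ball z0 r" "t \<in> cbox 0 (1::real)"
  shows "z0 + t *\<^sub>R (x - z0) \<in> ball z0 r"
proof -
  have "norm (t *\<^sub>R (x - z0)) \<le> norm (x - z0)"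
    using assms(2) by (simp add: mult_left_le_one_le)
  moreover have "dist z0 (z0 + t *\<^sub>R (x - z0)) = norm (t *\<^sub>R (x - z0))"
    by (simp add: dist_norm)
  ultimately show ?thesis using assms(1) by (simp add: dist_norm norm_minus_commute)
qed

lemma continuous_on_ray:
  fixes h :: "real ^ 'n::finite \<Rightarrow> real"
  assumes "continuous_on (ball z0 r) h"
  shows "continuous_on (ball z0 r \<times> cbox 0 1) (\<lambda>(x, t). h (z0 + t *\<^sub>R (x - z0)))"
  unfolding split_beta
  by (rule continuous_on_compose2[OF assms])
    (auto intro!: continuous_intros simp del: mem_ball box_real cbox_interval simp: ray_in_ball)

lemma continuous_on_ray_weight:
  fixes h :: "real ^ 'n::finite \<Rightarrow> real"
  assumes "continuous_on (ball z0 r) h"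
  shows "continuous_on (ball z0 r \<times> cbox 0 1) (\<lambda>(x, t). t ^ m * h (z0 + t *\<^sub>R (x - z0)))"
  using continuous_on_ray[OF assms] by (auto simp: split_beta intro!: continuous_intros)

lemma integrable_ray:
  fixes h :: "real ^ 'n::finite \<Rightarrow> real"
  assumes "continuous_on (ball z0 r) h" "x \<in> ball z0 r"
  shows "(\<lambda>t. t ^ m * h (z0 + t *\<^sub>R (x - z0))) integrable_on cbox 0 1"
proof (rule integrable_continuous)
  have "continuous_on (cbox 0 1) (\<lambda>t. h (z0 + t *\<^sub>R (x - z0)))"
    by (rule continuous_on_compose2[OF assms(1)])
      (use ray_in_ball[OF assms(2)] in \<open>auto intro!: continuous_intros simp del: mem_ball box_real cbox_interval\<close>)
  then show "continuous_on (cbox 0 1) (\<lambda>t. t ^ m * h (z0 + t *\<^sub>R (x - z0)))"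
    by (intro continuous_intros)
qed

lemma continuous_on_ray_integral:
  assumes "continuous_on (ball z0 r) h"
  shows "continuous_on (ball z0 r) (ray_integral m z0 h)"
  unfolding ray_integral_def[abs_def]
  by (rule integral_continuous_on_param) (rule continuous_on_ray_weight[OF assms])

lemma ray_integral_diff_le:
  assumes "continuous_on (ball z0 r) f" "continuous_on (ball z0 r) g" "x \<in> ball z0 r"
    and c: "\<And>y. y \<in> ball z0 r \<Longrightarrow> \<bar>f y - g y\<bar> \<le> c"
  shows "\<bar>ray_integral m z0 f x - ray_integral m z0 g x\<bar> \<le> c"
proof -
  have c0: "0 \<le> c" using c[OF assms(3)] by linarith
  have "ray_integral m z0 f x - ray_integral m z0 g x
      = integral (cbox 0 1) (\<lambda>t. t ^ m * f (z0 + t *\<^sub>R (x - z0)) - t ^ m * g (z0 + t *\<^sub>R (x - z0)))"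
    unfolding ray_integral_def
    by (rule integral_diff[symmetric]) (use assms integrable_ray in blast)+
  also have "norm \<dots> \<le> c * measure lborel (cbox 0 (1::real))"
  proof (rule integrable_bound[OF c0])
    show "(\<lambda>t. t ^ m * f (z0 + t *\<^sub>R (x - z0)) - t ^ m * g (z0 + t *\<^sub>R (x - z0))) integrable_on cbox 0 1"
      by (rule integrable_diff) (use assms integrable_ray in blast)+
    fix t :: real assume t: "t \<in> cbox 0 1"
    have "norm (t ^ m * f (z0 + t *\<^sub>R (x - z0)) - t ^ m * g (z0 + t *\<^sub>R (x - z0)))
      = t ^ m * \<bar>f (z0 + t *\<^sub>R (x - z0)) - g (z0 + t *\<^sub>R (x - z0))\<bar>"
      using t by (simp add: right_diff_distrib[symmetric] abs_mult)
    also have "\<dots> \<le> 1 * c"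
      by (rule mult_mono) (use t c[OF ray_in_ball[OF assms(3) t]] in \<open>auto simp: power_le_one\<close>)
    finally show "norm (t ^ m * f (z0 + t *\<^sub>R (x - z0)) - t ^ m * g (z0 + t *\<^sub>R (x - z0))) \<le> c" by simp
  qed
  finally show ?thesis by simp
qed

text \<open>Differentiation under the integral sign; the inner derivative contributes the factor
  \<open>t\<close> that raises the weight from \<open>m\<close> to \<open>Suc m\<close>.\<close>

lemma has_derivative_ray_integral:
  fixes h :: "real ^ 'n::finite \<Rightarrow> real"
  assumes h: "C_k_on (Suc 0) (ball z0 r) h" and x: "x \<in> ball z0 r"
  shows "(ray_integral m z0 h has_derivative
     (\<lambda>v. \<Sum>i\<in>UNIV. v $ i * ray_integral (Suc m) z0 (pd i h) x)) (at x)"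
proof -
  \<comment> \<open>The derivative of the integrand as a bounded linear function, the form in which
    \<open>leibniz_rule\<close> integrates it.\<close>
  define F :: "real ^ 'n \<Rightarrow> real \<Rightarrow> (real ^ 'n) \<Rightarrow>\<^sub>L real"
    where "F = (\<lambda>x t. \<Sum>i\<in>UNIV. (t ^ Suc m * pd i h (z0 + t *\<^sub>R (x - z0))) *\<^sub>R blinfun_inner_right (axis i 1))"
  have F: "blinfun_apply (F x t) v = (\<Sum>i\<in>UNIV. v $ i * (t ^ Suc m * pd i h (z0 + t *\<^sub>R (x - z0))))" for x t v
    by (simp add: F_def blinfun.sum_left blinfun.scaleR_left inner_axis' mult.commute)
  have d: "h differentiable (at y)" and c: "continuous_on (ball z0 r) (pd i h)" if "y \<in> ball z0 r" for y i
    using h that by (auto simp: C_k_on_Suc)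
  have ch: "continuous_on (ball z0 r) h" using h C_k_on_imp_continuous by blast
  have cF: "continuous_on (ball z0 r \<times> cbox 0 1) (\<lambda>(x, t). F x t)"
    using continuous_on_ray_weight[OF c[OF x], of "Suc m"]
    unfolding F_def split_beta by (intro continuous_on_sum continuous_on_scaleR continuous_on_const)
  have "((\<lambda>x. integral (cbox 0 1) (\<lambda>t. t ^ m * h (z0 + t *\<^sub>R (x - z0)))) has_derivative
      blinfun_apply (integral (cbox 0 1) (F x))) (at x within ball z0 r)"
  proof (rule leibniz_rule[OF _ _ cF x convex_ball])
    fix y and t :: real assume y: "y \<in> ball z0 r" and t: "t \<in> cbox 0 1"
    have "((\<lambda>y. z0 + t *\<^sub>R (y - z0)) has_derivative (\<lambda>v. t *\<^sub>R v)) (at y)"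
      by (auto intro!: derivative_eq_intros)
    from has_derivative_compose[OF this has_derivative_pd[OF d[OF ray_in_ball[OF y t]]]]
    have "((\<lambda>y. t ^ m * h (z0 + t *\<^sub>R (y - z0))) has_derivative
       (\<lambda>v. t ^ m * (\<Sum>i\<in>UNIV. (t *\<^sub>R v) $ i * pd i h (z0 + t *\<^sub>R (y - z0))))) (at y)"
      by (rule has_derivative_mult_right)
    moreover have "(\<lambda>v. t ^ m * (\<Sum>i\<in>UNIV. (t *\<^sub>R v) $ i * pd i h (z0 + t *\<^sub>R (y - z0)))) = blinfun_apply (F y t)"
      by (auto simp: F sum_distrib_left mult_ac)
    ultimately show "((\<lambda>y. t ^ m * h (z0 + t *\<^sub>R (y - z0))) has_derivative blinfun_apply (F y t)) (at y within ball z0 r)"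
      by (simp add: has_derivative_at_withinI)
  next
    fix y assume "y \<in> ball z0 r"
    then show "(\<lambda>t. t ^ m * h (z0 + t *\<^sub>R (y - z0))) integrable_on cbox 0 1"
      by (rule integrable_ray[OF ch])
  qed
  note D = this[unfolded at_within_open[OF x open_ball]]
  have E: "blinfun_apply (integral (cbox 0 1) (F x)) v
      = (\<Sum>i\<in>UNIV. v $ i * ray_integral (Suc m) z0 (pd i h) x)" for v
  proof -
    have cFx: "continuous_on (cbox 0 1) (F x)"
      using x by (intro continuous_on_compose2[OF cF, of "cbox 0 1" "\<lambda>t. (x, t)", simplified split_beta fst_conv snd_conv] continuous_intros) auto
    have "blinfun_apply (integral (cbox 0 1) (F x)) v = integral (cbox 0 1) (\<lambda>t. blinfun_apply (F x t) v)"
      by (rule blinfun_apply_integral) (rule integrable_continuous[OF cFx])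
    also have "\<dots> = (\<Sum>i\<in>UNIV. integral (cbox 0 1) (\<lambda>t. v $ i * (t ^ Suc m * pd i h (z0 + t *\<^sub>R (x - z0)))))"
      unfolding F by (rule integral_sum) (use integrable_ray[OF c[OF x] x] in \<open>auto simp del: power_Suc intro!: integrable_on_mult_right\<close>)
    also have "\<dots> = (\<Sum>i\<in>UNIV. v $ i * ray_integral (Suc m) z0 (pd i h) x)"
      unfolding ray_integral_def by (simp only: integral_mult_right)
    finally show ?thesis .
  qed
  show ?thesis
    by (subst (1) ray_integral_def[abs_def], rule has_derivative_eq_rhs[OF D], rule ext) (rule E)
qed

text \<open>The derivative in \<open>t\<close> of \<open>t * h (z0 + t *\<^sub>R (x - z0))\<close>,
  integrated over the unit interval. It rewrites a value of \<open>h\<close> in the same ray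
  integrals that occur in the derivative of the Picard operator.\<close>

lemma ray_integral_fundamental:
  fixes h :: "real ^ 'n::finite \<Rightarrow> real"
  assumes h: "C_k_on (Suc 0) (ball z0 r) h" and x: "x \<in> ball z0 r"
  shows "h x = ray_integral 0 z0 h x + (\<Sum>a\<in>UNIV. (x - z0) $ a * ray_integral (Suc 0) z0 (pd a h) x)"
proof -
  have d: "h differentiable (at y)" and c: "continuous_on (ball z0 r) (pd i h)" if "y \<in> ball z0 r" for y i
    using h that by (auto simp: C_k_on_Suc)
  have ch: "continuous_on (ball z0 r) h" using h C_k_on_imp_continuous by blast
  let ?\<gamma> = "\<lambda>t. z0 + t *\<^sub>R (x - z0)"
  have "((\<lambda>t. t ^ 0 * h (?\<gamma> t) + (\<Sum>a\<in>UNIV. (x - z0) $ a * (t ^ Suc 0 * pd a h (?\<gamma> t)))) has_integral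
      1 * h (?\<gamma> 1) - 0 * h (?\<gamma> 0)) {0..1}"
  proof (rule fundamental_theorem_of_calculus)
    fix t :: real assume t: "t \<in> {0..1}"
    have "(?\<gamma> has_derivative (\<lambda>s. s *\<^sub>R (x - z0))) (at t)"
      by (auto intro!: derivative_eq_intros)
    from has_derivative_compose[OF this has_derivative_pd[OF d[OF ray_in_ball[OF x]]]] t
    have "((\<lambda>t. h (?\<gamma> t)) has_derivative (\<lambda>s. \<Sum>i\<in>UNIV. (s *\<^sub>R (x - z0)) $ i * pd i h (?\<gamma> t))) (at t)"
      by simp
    then have D: "((\<lambda>t. t * h (?\<gamma> t)) has_derivative
        (\<lambda>s. t * (\<Sum>i\<in>UNIV. (s *\<^sub>R (x - z0)) $ i * pd i h (?\<gamma> t)) + s * h (?\<gamma> t))) (at t)"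
      by (rule has_derivative_mult[OF has_derivative_ident])
    have E: "t * (\<Sum>i\<in>UNIV. (s *\<^sub>R w) $ i * p i) + s * k
        = s *\<^sub>R (t ^ 0 * k + (\<Sum>a\<in>UNIV. w $ a * (t ^ Suc 0 * p a)))" for s k p and w :: "real ^ 'n"
      by (simp add: distrib_left sum_distrib_left mult_ac)
    show "((\<lambda>t. t * h (?\<gamma> t)) has_vector_derivative
       t ^ 0 * h (?\<gamma> t) + (\<Sum>a\<in>UNIV. (x - z0) $ a * (t ^ Suc 0 * pd a h (?\<gamma> t)))) (at t within {0..1})"
      unfolding has_vector_derivative_def
      by (rule has_derivative_at_withinI, rule has_derivative_eq_rhs[OF D], rule ext) (rule E)
  qed simp
  then have "h x = integral (cbox 0 1) (\<lambda>t. t ^ 0 * h (?\<gamma> t) + (\<Sum>a\<in>UNIV. (x - z0) $ a * (t ^ Suc 0 * pd a h (?\<gamma> t))))"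
    by (simp add: has_integral_iff)
  also have "\<dots> = integral (cbox 0 1) (\<lambda>t. t ^ 0 * h (?\<gamma> t))
     + integral (cbox 0 1) (\<lambda>t. \<Sum>a\<in>UNIV. (x - z0) $ a * (t ^ Suc 0 * pd a h (?\<gamma> t)))"
    by (rule integral_add[OF integrable_ray[OF ch x]])
      (intro integrable_sum finite integrable_on_mult_right integrable_ray[OF c[OF x] x])
  also have "integral (cbox 0 1) (\<lambda>t. \<Sum>a\<in>UNIV. (x - z0) $ a * (t ^ Suc 0 * pd a h (?\<gamma> t)))
     = (\<Sum>a\<in>UNIV. integral (cbox 0 1) (\<lambda>t. (x - z0) $ a * (t ^ Suc 0 * pd a h (?\<gamma> t))))"
    by (intro integral_sum finite integrable_on_mult_right integrable_ray[OF c[OF x] x])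
  finally show ?thesis
    unfolding ray_integral_def by (simp only: integral_mult_right)
qed

text \<open>The bound is the tail of the geometric series. The induction carries the exact partial
  sum, with factor \<open>1 - 1 / 2 ^ k\<close>, because the bare tail bound would not reproduce
  itself.\<close>

lemma geometric_limit:
  fixes s :: "nat \<Rightarrow> real"
  assumes "\<And>n. \<bar>s (Suc n) - s n\<bar> \<le> b / 2 ^ n"
  shows "\<exists>l. \<forall>n. \<bar>s n - l\<bar> \<le> 2 * b / 2 ^ n"
proof -
  have le: "\<bar>s (n + k) - s n\<bar> \<le> 2 * b / 2 ^ n * (1 - 1 / 2 ^ k)" for n k
  proof (induction k)
    case (Suc k)
    have "\<bar>s (n + Suc k) - s n\<bar> \<le> \<bar>s (Suc (n + k)) - s (n + k)\<bar> + \<bar>s (n + k) - s n\<bar>" by simp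
    also have "\<dots> \<le> b / 2 ^ (n + k) + 2 * b / 2 ^ n * (1 - 1 / 2 ^ k)" using Suc assms by (intro add_mono)
    also have "\<dots> = 2 * b / 2 ^ n * (1 - 1 / 2 ^ Suc k)" by (simp add: field_simps power_add)
    finally show ?case .
  qed simp
  have b: "0 \<le> b" using assms[of 0] by simp
  have le': "\<bar>s (n + k) - s n\<bar> \<le> 2 * b / 2 ^ n" for n k
    by (rule order_trans[OF le]) (use b in \<open>auto simp: field_simps mult_left_le\<close>)
  have z: "(\<lambda>n. 2 * (2 * b / 2 ^ n)) \<longlonglongrightarrow> 0"
    using tendsto_mult_right[OF LIMSEQ_inverse_realpow_zero[of 2], of "4 * b"] by (simp add: field_simps)
  have "Cauchy s"
  proof (rule metric_CauchyI)
    fix e :: real assume "0 < e"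
    with z obtain N where N: "2 * (2 * b / 2 ^ N) < e"
      unfolding LIMSEQ_def dist_real_def by (metis abs_less_iff diff_zero order_refl)
    have "dist (s m) (s n) < e" if "m \<ge> N" "n \<ge> N" for m n
      using le'[of N "m - N"] le'[of N "n - N"] that N by (simp add: dist_real_def)
    then show "\<exists>M. \<forall>m\<ge>M. \<forall>n\<ge>M. dist (s m) (s n) < e" by blast
  qed
  then obtain l where l: "s \<longlonglongrightarrow> l" using Cauchy_convergent convergent_def by blast
  have "\<bar>s n - l\<bar> \<le> 2 * b / 2 ^ n" for n
  proof -
    have "(\<lambda>k. \<bar>s (k + n) - s n\<bar>) \<longlonglongrightarrow> \<bar>l - s n\<bar>"
      by (intro tendsto_intros LIMSEQ_ignore_initial_segment[OF l])
    then have "\<bar>l - s n\<bar> \<le> 2 * b / 2 ^ n"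
      by (rule LIMSEQ_le_const2) (use le'[of n] in \<open>auto simp: add.commute\<close>)
    then show ?thesis by simp
  qed
  then show ?thesis by blast
qed

lemma real_le_inverse_powers_imp_zero:
  fixes x c :: real
  assumes "\<And>n. \<bar>x\<bar> \<le> c / 2 ^ n"
  shows "x = 0"
proof -
  have "(\<lambda>n. c / 2 ^ n) \<longlonglongrightarrow> 0"
    using tendsto_mult_right[OF LIMSEQ_inverse_realpow_zero[of 2], of c] by (simp add: field_simps)
  then have "\<bar>x\<bar> \<le> 0" by (rule LIMSEQ_le_const) (use assms in blast)
  then show ?thesis by simp
qed

lemma finite_family_bounded:
  fixes f :: "'i::finite \<Rightarrow> 'a::topological_space \<Rightarrow> real"
  assumes "compact C" "\<And>i. continuous_on C (f i)"
  shows "\<exists>M\<ge>0. \<forall>i. \<forall>z\<in>C. \<bar>f i z\<bar> \<le> M"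
proof -
  have "\<exists>b. \<forall>z\<in>C. \<bar>f i z\<bar> \<le> b" for i
    using compact_imp_bounded[OF compact_continuous_image[OF assms(2,1)], of i]
    by (auto simp: bounded_iff)
  then obtain b where b: "\<And>i z. z \<in> C \<Longrightarrow> \<bar>f i z\<bar> \<le> b i" by metis
  have "\<bar>f i z\<bar> \<le> (\<Sum>i\<in>UNIV. \<bar>b i\<bar>)" if "z \<in> C" for i z
  proof -
    have "\<bar>f i z\<bar> \<le> \<bar>b i\<bar>" using b[OF that, of i] by linarith
    also have "\<dots> \<le> (\<Sum>i\<in>UNIV. \<bar>b i\<bar>)" by (rule member_le_sum) auto
    finally show ?thesis .
  qed
  then show ?thesis by (intro exI[of _ "\<Sum>i\<in>UNIV. \<bar>b i\<bar>"]) (auto intro: sum_nonneg)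
qed

lemma abs_sum_le_card:
  fixes f :: "'i::finite \<Rightarrow> real"
  assumes "\<And>i. \<bar>f i\<bar> \<le> c"
  shows "\<bar>\<Sum>i\<in>UNIV. f i\<bar> \<le> real CARD('i) * c"
  using order_trans[OF sum_abs sum_mono[of UNIV "\<lambda>i. \<bar>f i\<bar>" "\<lambda>_. c"]] assms by simp

text \<open>The system \<open>\<partial>\<^sub>a u\<^sub>p = A\<^sub>a\<^sub>p\<^sup>q u\<^sub>q\<close> is solved along the rays issuing from \<open>z0\<close> by Picard iteration;
  on a small ball the iteration contracts in the \<open>C\<^sup>1\<close> norm. Flatness makes the defect
  \<open>\<partial>\<^sub>b u\<^sub>p - A\<^sub>b\<^sub>p\<^sup>q u\<^sub>q\<close> of the radial solution satisfy a homogeneous contracting integral equation.\<close>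

locale flat_system =
  fixes A :: "'n::finite \<Rightarrow> 'k::finite \<Rightarrow> 'k \<Rightarrow> real ^ 'n \<Rightarrow> real"
    and z0 :: "real ^ 'n" and r M :: real and ini :: "'k \<Rightarrow> real"
  assumes r: "r > 0" and M: "M \<ge> 0"
    and smooth: "\<And>a p q. smooth_on (ball z0 r) (A a p q)"
    and A_le: "\<And>a p q z. z \<in> ball z0 r \<Longrightarrow> \<bar>A a p q z\<bar> \<le> M"
    and dA_le: "\<And>a b p q z. z \<in> ball z0 r \<Longrightarrow> \<bar>pd b (A a p q) z\<bar> \<le> M"
    and small: "real CARD('n) * r * (real CARD('k) * M) \<le> 1 / 4" "real CARD('n) * r \<le> 1"
    and flat: "\<And>a b p q z. z \<in> ball z0 r \<Longrightarrow>
       pd b (A a p q) z + (\<Sum>s\<in>UNIV. A a p s z * A b s q z)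
         = pd a (A b p q) z + (\<Sum>s\<in>UNIV. A b p s z * A a s q z)"
begin

definition F :: "'n \<Rightarrow> ('k \<Rightarrow> real ^ 'n \<Rightarrow> real) \<Rightarrow> 'k \<Rightarrow> real ^ 'n \<Rightarrow> real" where
  "F a u p = (\<lambda>y. \<Sum>q\<in>UNIV. A a p q y * u q y)"

text \<open>Integrating the system along the segment from \<open>z0\<close> to \<open>x\<close>
  gives \<open>u = T u\<close>. Conversely, a fixed point satisfies at first only the radial
  component of the system.\<close>

definition T :: "('k \<Rightarrow> real ^ 'n \<Rightarrow> real) \<Rightarrow> 'k \<Rightarrow> real ^ 'n \<Rightarrow> real" where
  "T u p = (\<lambda>x. ini p + (\<Sum>a\<in>UNIV. (x - z0) $ a * ray_integral 0 z0 (F a u p) x))"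

lemma C1_F:
  assumes "\<And>q. C_k_on (Suc 0) (ball z0 r) (u q)"
  shows "C_k_on (Suc 0) (ball z0 r) (F a u p)"
proof -
  have "C_k_on (Suc 0) (ball z0 r) (\<lambda>y. \<Sum>q\<in>J. A a p q y * u q y)" for J
    by (induction J rule: infinite_finite_induct)
      (use assms smooth[unfolded smooth_on_def] in \<open>auto intro!: C_k_on_const C_k_on_add C_k_on_mult\<close>)
  then show ?thesis by (simp add: F_def)
qed

lemma cont_F:
  assumes "\<And>q. continuous_on (ball z0 r) (u q)"
  shows "continuous_on (ball z0 r) (F a u p)"
  unfolding F_def using smooth_on_continuous[OF smooth] assms by (intro continuous_intros)

lemma pd_F:
  assumes "\<And>q. C_k_on (Suc 0) (ball z0 r) (u q)" "y \<in> ball z0 r"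
  shows "pd b (F a u p) y = (\<Sum>q\<in>UNIV. pd b (A a p q) y * u q y + A a p q y * pd b (u q) y)"
proof -
  have d: "A a p q differentiable (at y)" "u q differentiable (at y)" for q
    using smooth_on_differentiable[OF smooth assms(2)] assms by (auto simp: C_k_on_Suc)
  show ?thesis unfolding F_def by (subst pd_sum) (auto simp: d pd_mult)
qed

lemma F_diff_le:
  assumes "\<And>q. \<bar>u q y - v q y\<bar> \<le> \<alpha>" "y \<in> ball z0 r"
  shows "\<bar>F a u p y - F a v p y\<bar> \<le> real CARD('k) * (M * \<alpha>)"
proof -
  have "\<bar>\<Sum>q\<in>UNIV. A a p q y * (u q y - v q y)\<bar> \<le> real CARD('k) * (M * \<alpha>)"
    by (rule abs_sum_le_card) (use A_le[OF assms(2)] assms(1) M in \<open>auto simp: abs_mult intro!: mult_mono\<close>)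
  then show ?thesis by (simp add: F_def sum_subtractf right_diff_distrib)
qed

lemma pd_F_diff_le:
  assumes "\<And>q. C_k_on (Suc 0) (ball z0 r) (u q)" "\<And>q. C_k_on (Suc 0) (ball z0 r) (v q)"
    and "\<And>q. \<bar>u q y - v q y\<bar> \<le> \<alpha>" "\<And>q. \<bar>pd b (u q) y - pd b (v q) y\<bar> \<le> \<beta>" "y \<in> ball z0 r"
  shows "\<bar>pd b (F a u p) y - pd b (F a v p) y\<bar> \<le> real CARD('k) * (M * \<alpha> + M * \<beta>)"
proof -
  have "\<bar>\<Sum>q\<in>UNIV. pd b (A a p q) y * (u q y - v q y) + A a p q y * (pd b (u q) y - pd b (v q) y)\<bar>
      \<le> real CARD('k) * (M * \<alpha> + M * \<beta>)"
  proof (rule abs_sum_le_card)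
    fix q
    have "\<bar>pd b (A a p q) y * (u q y - v q y)\<bar> \<le> M * \<alpha>"
      using dA_le[OF assms(5)] assms(3) M by (auto simp: abs_mult intro!: mult_mono)
    moreover have "\<bar>A a p q y * (pd b (u q) y - pd b (v q) y)\<bar> \<le> M * \<beta>"
      using A_le[OF assms(5)] assms(4) M by (auto simp: abs_mult intro!: mult_mono)
    ultimately show "\<bar>pd b (A a p q) y * (u q y - v q y) + A a p q y * (pd b (u q) y - pd b (v q) y)\<bar> \<le> M * \<alpha> + M * \<beta>"
      by linarith
  qed
  then show ?thesis
    by (simp add: pd_F[of u, OF assms(1,5)] pd_F[of v, OF assms(2,5)] sum_subtractf[symmetric] algebra_simps)
qed

lemma coord_sum_le:
  assumes "x \<in> ball z0 r" "\<And>a. \<bar>f a\<bar> \<le> c"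
  shows "\<bar>\<Sum>a\<in>UNIV. (x - z0) $ a * f a\<bar> \<le> real CARD('n) * r * c"
proof -
  have "\<bar>(x - z0) $ a * f a\<bar> \<le> r * c" for a
    using component_le_norm_cart[of "x - z0" a] assms(1) r
    by (auto simp: abs_mult dist_norm norm_minus_commute intro!: mult_mono assms(2))
  then show ?thesis using abs_sum_le_card[of "\<lambda>a. (x - z0) $ a * f a" "r * c"] by (simp add: mult.assoc)
qed

lemma T_diff_le:
  assumes "\<And>q. continuous_on (ball z0 r) (u q)" "\<And>q. continuous_on (ball z0 r) (v q)"
    and le: "\<And>q y. y \<in> ball z0 r \<Longrightarrow> \<bar>u q y - v q y\<bar> \<le> \<alpha>" and x: "x \<in> ball z0 r"
  shows "\<bar>T u p x - T v p x\<bar> \<le> \<alpha> / 4"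
proof -
  have \<alpha>: "0 \<le> \<alpha>" using le[OF x] by (meson abs_ge_zero order_trans)
  have "\<bar>T u p x - T v p x\<bar> = \<bar>\<Sum>a\<in>UNIV. (x - z0) $ a * (ray_integral 0 z0 (F a u p) x - ray_integral 0 z0 (F a v p) x)\<bar>"
    by (simp add: T_def sum_subtractf right_diff_distrib)
  also have "\<dots> \<le> real CARD('n) * r * (real CARD('k) * (M * \<alpha>))"
    by (intro coord_sum_le x ray_integral_diff_le[OF cont_F cont_F] assms F_diff_le)
  also have "\<dots> = (real CARD('n) * r * (real CARD('k) * M)) * \<alpha>" by simp
  also have "\<dots> \<le> 1 / 4 * \<alpha>" using small \<alpha> by (intro mult_right_mono)
  finally show ?thesis by simp
qed

lemma has_derivative_T:
  assumes "\<And>q. C_k_on (Suc 0) (ball z0 r) (u q)" "x \<in> ball z0 r"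
  shows "(T u p has_derivative (\<lambda>h. \<Sum>b\<in>UNIV. h $ b * (ray_integral 0 z0 (F b u p) x
     + (\<Sum>a\<in>UNIV. (x - z0) $ a * ray_integral (Suc 0) z0 (pd b (F a u p)) x)))) (at x)"
proof -
  have "(T u p has_derivative (\<lambda>h. \<Sum>a\<in>UNIV.
      (x - z0) $ a * (\<Sum>b\<in>UNIV. h $ b * ray_integral (Suc 0) z0 (pd b (F a u p)) x)
        + h $ a * ray_integral 0 z0 (F a u p) x)) (at x)"
    unfolding T_def
  proof (rule has_derivative_add_const[where c = "ini p", simplified add.commute[of _ "ini p"]], rule has_derivative_sum, rule has_derivative_mult)
    fix a
    have "((\<lambda>x. x - z0) has_derivative (\<lambda>h. h)) (at x)" by (auto intro!: derivative_eq_intros)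
    from bounded_linear.has_derivative[OF bounded_linear_vec_nth this]
    show "((\<lambda>x. (x - z0) $ a) has_derivative (\<lambda>h. h $ a)) (at x)" .
    show "(ray_integral 0 z0 (F a u p) has_derivative (\<lambda>h. \<Sum>b\<in>UNIV. h $ b * ray_integral (Suc 0) z0 (pd b (F a u p)) x)) (at x)"
      by (rule has_derivative_ray_integral[OF C1_F[of u, OF assms(1)] assms(2)])
  qed
  moreover have "(\<Sum>a\<in>UNIV. w $ a * (\<Sum>b\<in>UNIV. h $ b * R a b) + h $ a * S a)
      = (\<Sum>b\<in>UNIV. h $ b * (S b + (\<Sum>a\<in>UNIV. w $ a * R a b)))" for h w :: "real ^ 'n" and R S
  proof -
    have "(\<Sum>a\<in>UNIV. w $ a * (\<Sum>b\<in>UNIV. h $ b * R a b)) = (\<Sum>b\<in>UNIV. h $ b * (\<Sum>a\<in>UNIV. w $ a * R a b))"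
      unfolding sum_distrib_left by (subst sum.swap) (simp add: mult.left_commute)
    then show ?thesis by (simp add: sum.distrib distrib_left)
  qed
  ultimately show ?thesis by (simp only:)
qed

lemma pd_T:
  assumes "\<And>q. C_k_on (Suc 0) (ball z0 r) (u q)" "x \<in> ball z0 r"
  shows "pd b (T u p) x = ray_integral 0 z0 (F b u p) x
     + (\<Sum>a\<in>UNIV. (x - z0) $ a * ray_integral (Suc 0) z0 (pd b (F a u p)) x)"
  by (rule pd_eq_coeff[OF has_derivative_T[of u x p, OF assms]])

lemma C1_T:
  assumes u: "\<And>q. C_k_on (Suc 0) (ball z0 r) (u q)"
  shows "C_k_on (Suc 0) (ball z0 r) (T u p)"
proof -
  have c: "continuous_on (ball z0 r) (pd b (F a u p))" "continuous_on (ball z0 r) (F a u p)" for a b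
    using C1_F[of u, OF u] C_k_on_imp_continuous[OF C1_F[of u, OF u]] by (auto simp: C_k_on_Suc)
  have "continuous_on (ball z0 r) (\<lambda>x. ray_integral 0 z0 (F b u p) x
     + (\<Sum>a\<in>UNIV. (x - z0) $ a * ray_integral (Suc 0) z0 (pd b (F a u p)) x))" for b
    by (intro continuous_intros continuous_on_ray_integral c)
  then have "continuous_on (ball z0 r) (pd b (T u p))" for b
    by (rule continuous_on_eq) (simp add: pd_T[of u, OF u])
  moreover have "T u p differentiable (at x)" if "x \<in> ball z0 r" for x
    using has_derivative_T[of u, OF u that] by (auto simp: differentiable_def)
  ultimately show ?thesis by (auto simp: C_k_on_Suc)
qed

text \<open>Differentiating the coordinate factor leaves a ray integral without a small factor, so
  the coefficient of \<alpha> need not be small. Only \<beta> is multiplied by 1/4; this suffices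
  because \<alpha> already decays by \<open>T_diff_le\<close>.\<close>

lemma pd_T_diff_le:
  assumes u: "\<And>q. C_k_on (Suc 0) (ball z0 r) (u q)" and v: "\<And>q. C_k_on (Suc 0) (ball z0 r) (v q)"
    and le: "\<And>q y. y \<in> ball z0 r \<Longrightarrow> \<bar>u q y - v q y\<bar> \<le> \<alpha>"
      "\<And>b q y. y \<in> ball z0 r \<Longrightarrow> \<bar>pd b (u q) y - pd b (v q) y\<bar> \<le> \<beta>"
    and x: "x \<in> ball z0 r"
  shows "\<bar>pd b (T u p) x - pd b (T v p) x\<bar> \<le> (real CARD('k) * M + 1 / 4) * \<alpha> + \<beta> / 4"
proof -
  have ab: "0 \<le> \<alpha>" "0 \<le> \<beta>" using le[OF x] by (meson abs_ge_zero order_trans)+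
  have cu: "continuous_on (ball z0 r) (pd b (F a u p))" "continuous_on (ball z0 r) (F a u p)"
    and cv: "continuous_on (ball z0 r) (pd b (F a v p))" "continuous_on (ball z0 r) (F a v p)" for a b
    using C1_F[of u, OF u] C1_F[of v, OF v] C_k_on_imp_continuous[OF C1_F[of u, OF u]] C_k_on_imp_continuous[OF C1_F[of v, OF v]]
    by (auto simp: C_k_on_Suc)
  have 1: "\<bar>ray_integral 0 z0 (F b u p) x - ray_integral 0 z0 (F b v p) x\<bar> \<le> real CARD('k) * (M * \<alpha>)"
    by (intro ray_integral_diff_le[OF cu(2) cv(2) x] F_diff_le le)
  have "\<bar>\<Sum>a\<in>UNIV. (x - z0) $ a * (ray_integral (Suc 0) z0 (pd b (F a u p)) x - ray_integral (Suc 0) z0 (pd b (F a v p)) x)\<bar>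
      \<le> real CARD('n) * r * (real CARD('k) * (M * \<alpha> + M * \<beta>))"
    by (intro coord_sum_le x ray_integral_diff_le[OF cu(1) cv(1) x] pd_F_diff_le u v le)
  also have "\<dots> = (real CARD('n) * r * (real CARD('k) * M)) * (\<alpha> + \<beta>)" by (simp add: algebra_simps)
  also have "\<dots> \<le> 1 / 4 * (\<alpha> + \<beta>)" using small ab by (intro mult_right_mono) auto
  finally have 2: "\<bar>\<Sum>a\<in>UNIV. (x - z0) $ a * (ray_integral (Suc 0) z0 (pd b (F a u p)) x - ray_integral (Suc 0) z0 (pd b (F a v p)) x)\<bar>
    \<le> 1 / 4 * (\<alpha> + \<beta>)" .
  have "pd b (T u p) x - pd b (T v p) x = (ray_integral 0 z0 (F b u p) x - ray_integral 0 z0 (F b v p) x)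
     + (\<Sum>a\<in>UNIV. (x - z0) $ a * (ray_integral (Suc 0) z0 (pd b (F a u p)) x - ray_integral (Suc 0) z0 (pd b (F a v p)) x))"
    unfolding pd_T[of u, OF u x] pd_T[of v, OF v x] right_diff_distrib sum_subtractf by simp
  with 1 2 have "\<bar>pd b (T u p) x - pd b (T v p) x\<bar> \<le> real CARD('k) * (M * \<alpha>) + 1 / 4 * (\<alpha> + \<beta>)" by linarith
  then show ?thesis by (simp add: algebra_simps add_divide_distrib)
qed

primrec U :: "nat \<Rightarrow> 'k \<Rightarrow> real ^ 'n \<Rightarrow> real" where
  "U 0 = (\<lambda>p x. 0)"
| "U (Suc n) = T (U n)"

lemma C1_U: "C_k_on (Suc 0) (ball z0 r) (U n p)"
  by (induction n arbitrary: p) (auto intro: C_k_on_const C1_T simp del: C_k_on.simps)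

text \<open>The constant \<open>b\<close> is chosen so that
  \<open>(real CARD('k) * M + 1) * a\<close> is \<open>b / 4\<close>: the two terms of
  \<open>pd_T_diff_le\<close> then add up to \<open>b / 2\<close>, and derivatives decay at the same
  rate as values.\<close>

lemma U_diff_le:
  defines "a \<equiv> \<Sum>p\<in>UNIV. \<bar>ini p\<bar>"
  defines "b \<equiv> 4 * (real CARD('k) * M + 1) * a"
  shows "x \<in> ball z0 r \<Longrightarrow> \<bar>U (Suc n) p x - U n p x\<bar> \<le> a / 2 ^ n
     \<and> \<bar>pd i (U (Suc n) p) x - pd i (U n p) x\<bar> \<le> b / 2 ^ n"
proof (induction n arbitrary: p i x)
  case 0
  \<comment> \<open>The start value 0 makes \<open>F\<close> vanish, so the first iterate is the
    constant \<open>ini\<close> and its derivatives are zero.\<close>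
  have F0: "F c (\<lambda>p x. 0) p = (\<lambda>x. 0)" for c p by (simp add: F_def)
  have T0: "T (\<lambda>p x. 0) p = (\<lambda>x. ini p)" by (simp add: T_def F0 ray_integral_def)
  have "a \<ge> 0" by (simp add: a_def sum_nonneg)
  moreover have "\<bar>ini p\<bar> \<le> a" unfolding a_def by (rule member_le_sum) auto
  ultimately show ?case using M by (simp add: T0 b_def)
next
  case (Suc n)
  have a: "a \<ge> 0" by (simp add: a_def sum_nonneg)
  have b: "b \<ge> 0" using a M by (simp add: b_def)
  have "\<bar>T (U (Suc n)) p x - T (U n) p x\<bar> \<le> a / 2 ^ n / 4"
    using C1_U C_k_on_imp_continuous Suc by (intro T_diff_le) blast+
  also have "\<dots> \<le> a / 2 ^ Suc n" using a by (simp add: field_simps)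
  finally have 1: "\<bar>U (Suc (Suc n)) p x - U (Suc n) p x\<bar> \<le> a / 2 ^ Suc n" by simp
  have "\<bar>pd i (T (U (Suc n)) p) x - pd i (T (U n) p) x\<bar> \<le> (real CARD('k) * M + 1 / 4) * (a / 2 ^ n) + b / 2 ^ n / 4"
    using C1_U Suc by (intro pd_T_diff_le) blast+
  also have "\<dots> \<le> (real CARD('k) * M + 1) * (a / 2 ^ n) + b / 2 ^ n / 4"
    using a by (intro add_right_mono mult_right_mono) auto
  also have "\<dots> = b / 2 ^ Suc n" by (simp add: b_def field_simps)
  finally show ?case using 1 by simp
qed

text \<open>The iterates and their first derivatives converge uniformly at a geometric rate, so the
  limit is continuously differentiable with the limiting derivatives. The bound \<open>C\<close>
  later starts the estimate of the defect.\<close>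

lemma radial_solution:
  obtains u C where "\<And>p. C_k_on (Suc 0) (ball z0 r) (u p)"
    "\<And>p x. x \<in> ball z0 r \<Longrightarrow> T u p x = u p x"
    "\<And>p x. x \<in> ball z0 r \<Longrightarrow> \<bar>u p x\<bar> \<le> C"
    "\<And>i p x. x \<in> ball z0 r \<Longrightarrow> \<bar>pd i (u p) x\<bar> \<le> C"
proof -
  define a where "a = (\<Sum>p\<in>UNIV. \<bar>ini p\<bar>)"
  define b where "b = 4 * (real CARD('k) * M + 1) * a"
  note Ud = U_diff_le[folded a_def, folded b_def]
  have a0: "a \<ge> 0" by (simp add: a_def sum_nonneg)
  have b0: "b \<ge> 0" using a0 M by (simp add: b_def)
  have "\<exists>u. \<forall>p x. x \<in> ball z0 r \<longrightarrow> (\<forall>n. \<bar>U n p x - u p x\<bar> \<le> 2 * a / 2 ^ n)"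
    by (intro choice allI) (use geometric_limit[of "\<lambda>n. U n _ _" a] Ud in blast)
  then obtain u where u: "\<And>x p n. x \<in> ball z0 r \<Longrightarrow> \<bar>U n p x - u p x\<bar> \<le> 2 * a / 2 ^ n" by blast
  have "\<exists>v. \<forall>i p x. x \<in> ball z0 r \<longrightarrow> (\<forall>n. \<bar>pd i (U n p) x - v i p x\<bar> \<le> 2 * b / 2 ^ n)"
    by (intro choice allI) (use geometric_limit[of "\<lambda>n. pd _ (U n _) _" b] Ud in blast)
  then obtain v where v: "\<And>x i p n. x \<in> ball z0 r \<Longrightarrow> \<bar>pd i (U n p) x - v i p x\<bar> \<le> 2 * b / 2 ^ n" by blast
  have z: "(\<lambda>n. c / 2 ^ n) \<longlonglongrightarrow> 0" for c :: real
    using tendsto_mult_right[OF LIMSEQ_inverse_realpow_zero[of 2], of c] by (simp add: field_simps)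
  have ev: "\<forall>\<^sub>F n in sequentially. c / 2 ^ n < e" if "0 < e" for c e :: real
    using order_tendstoD(2)[OF z that] .
  have lim: "(\<lambda>n. U n p x) \<longlonglongrightarrow> u p x" if "x \<in> ball z0 r" for p x
    by (rule LIM_zero_cancel, rule tendsto_rabs_zero_cancel, rule tendsto_sandwich[OF _ _ tendsto_const z[of "2 * a"]])
      (use u[OF that] in auto)
  have du: "(u p has_derivative (\<lambda>h. \<Sum>i\<in>UNIV. h $ i * v i p x)) (at x)" if x: "x \<in> ball z0 r" for p x
  proof -
    have "\<exists>g. \<forall>x\<in>ball z0 r. (\<lambda>n. U n p x) \<longlonglongrightarrow> g x \<and>
        (g has_derivative (\<lambda>h. \<Sum>i\<in>UNIV. h $ i * v i p x)) (at x within ball z0 r)"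
    proof (rule has_derivative_sequence)
      show "(U n p has_derivative (\<lambda>h. \<Sum>i\<in>UNIV. h $ i * pd i (U n p) x)) (at x within ball z0 r)"
        if "x \<in> ball z0 r" for n x
        using C1_U[of n p] that by (auto simp: C_k_on_Suc intro!: has_derivative_at_withinI has_derivative_pd)
      show "\<forall>\<^sub>F n in sequentially. \<forall>x\<in>ball z0 r. \<forall>h. norm ((\<Sum>i\<in>UNIV. h $ i * pd i (U n p) x) - (\<Sum>i\<in>UNIV. h $ i * v i p x)) \<le> e * norm h"
        if "0 < e" for e
        using ev[OF that, of "real CARD('n) * (2 * b)"]
      proof eventually_elim
        case (elim n)
        show ?case
        proof (intro ballI allI)
          fix x and h :: "real ^ 'n" assume x: "x \<in> ball z0 r"
          have "\<bar>\<Sum>i\<in>UNIV. h $ i * (pd i (U n p) x - v i p x)\<bar> \<le> real CARD('n) * (norm h * (2 * b / 2 ^ n))"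
            by (rule abs_sum_le_card, unfold abs_mult) (intro mult_mono component_le_norm_cart v[OF x], auto)
          also have "\<dots> = (real CARD('n) * (2 * b) / 2 ^ n) * norm h" by simp
          also have "\<dots> \<le> e * norm h" using elim by (intro mult_right_mono) auto
          finally show "norm ((\<Sum>i\<in>UNIV. h $ i * pd i (U n p) x) - (\<Sum>i\<in>UNIV. h $ i * v i p x)) \<le> e * norm h"
            by (simp add: right_diff_distrib sum_subtractf)
        qed
      qed
      show "z0 \<in> ball z0 r" "(\<lambda>n. U n p z0) \<longlonglongrightarrow> u p z0" using r lim by auto
    qed simp
    then obtain g where g: "\<And>x. x \<in> ball z0 r \<Longrightarrow> (\<lambda>n. U n p x) \<longlonglongrightarrow> g x"
       "\<And>x. x \<in> ball z0 r \<Longrightarrow> (g has_derivative (\<lambda>h. \<Sum>i\<in>UNIV. h $ i * v i p x)) (at x within ball z0 r)"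
      by blast
    have "g y = u p y" if "y \<in> ball z0 r" for y using g(1)[OF that] lim[OF that] LIMSEQ_unique by blast
    with g(2)[OF x] show ?thesis
      using has_derivative_cong_open[OF open_ball x, where f = g and g = "u p"] x by (simp add: at_within_open[OF x open_ball])
  qed
  have pdu: "pd i (u p) x = v i p x" if "x \<in> ball z0 r" for i p x
    by (rule pd_eq_coeff[OF du[OF that]])
  have "continuous_on (ball z0 r) (v i p)" for i p
  proof (rule uniform_limit_theorem[of _ "\<lambda>n. pd i (U n p)" sequentially])
    show "\<forall>\<^sub>F n in sequentially. continuous_on (ball z0 r) (pd i (U n p))"
      using C1_U by (simp add: C_k_on_Suc)
    show "uniform_limit (ball z0 r) (\<lambda>n. pd i (U n p)) (v i p) sequentially"
      unfolding uniform_limit_iff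
    proof (intro allI impI)
      fix e :: real assume "0 < e"
      from ev[OF this, of "2 * b"]
      show "\<forall>\<^sub>F n in sequentially. \<forall>x\<in>ball z0 r. dist (pd i (U n p) x) (v i p x) < e"
      proof eventually_elim
        case (elim n)
        show ?case using order_le_less_trans[OF v elim] by (simp add: dist_real_def)
      qed
    qed
  qed simp
  then have "continuous_on (ball z0 r) (pd i (u p))" for i p
    by (rule continuous_on_eq) (simp add: pdu)
  then have C1u: "C_k_on (Suc 0) (ball z0 r) (u p)" for p
    using differentiableI[OF du] by (auto simp: C_k_on_Suc)
  have "T u p x = u p x" if x: "x \<in> ball z0 r" for p x
  proof -
    have "\<bar>T u p x - u p x\<bar> \<le> 4 * a / 2 ^ n" for n
    proof -
      have "\<bar>T (U n) p x - T u p x\<bar> \<le> 2 * a / 2 ^ n / 4"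
        by (rule T_diff_le[OF _ _ u x]) (rule C_k_on_imp_continuous[OF C1_U] C_k_on_imp_continuous[OF C1u])+
      moreover have "\<bar>T (U n) p x - u p x\<bar> \<le> 2 * a / 2 ^ Suc n"
        using u[OF x, of "Suc n" p] by simp
      moreover have "2 * a / 2 ^ n / 4 + 2 * a / 2 ^ Suc n \<le> 4 * a / 2 ^ n" using a0 by (simp add: field_simps)
      moreover have "\<bar>X - Z\<bar> \<le> c" if "\<bar>Y - X\<bar> \<le> \<alpha>" "\<bar>Y - Z\<bar> \<le> \<beta>" "\<alpha> + \<beta> \<le> c" for X Y Z \<alpha> \<beta> c :: real
        using that by linarith
      ultimately show ?thesis by blast
    qed
    then have "T u p x - u p x = 0" by (rule real_le_inverse_powers_imp_zero)
    then show ?thesis by simp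
  qed
  \<comment> \<open>The case \<open>n = 0\<close> of the convergence estimates, where the iterate is
    identically zero.\<close>
  moreover have "\<bar>u p x\<bar> \<le> 2 * a + 2 * b" "\<bar>pd i (u p) x\<bar> \<le> 2 * a + 2 * b" if "x \<in> ball z0 r" for i p x
    using u[OF that, of 0 p] v[OF that, of i 0 p] pdu[OF that, of i p] a0 b0 by simp_all
  ultimately show ?thesis using that[of u "2 * a + 2 * b"] C1u by blast
qed

lemma solution:
  obtains u where "\<And>p. smooth_on (ball z0 r) (u p)" "\<And>p. u p z0 = ini p"
    "\<And>a p x. x \<in> ball z0 r \<Longrightarrow> pd a (u p) x = (\<Sum>q\<in>UNIV. A a p q x * u q x)"
proof -
  obtain u C where C1: "\<And>p. C_k_on (Suc 0) (ball z0 r) (u p)"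
    and fp: "\<And>p x. x \<in> ball z0 r \<Longrightarrow> T u p x = u p x"
    and uC: "\<And>p x. x \<in> ball z0 r \<Longrightarrow> \<bar>u p x\<bar> \<le> C"
    and duC: "\<And>i p x. x \<in> ball z0 r \<Longrightarrow> \<bar>pd i (u p) x\<bar> \<le> C"
    by (rule radial_solution) blast
  define E where "E = (\<lambda>b p x. pd b (u p) x - F b u p x)"
  have c: "continuous_on (ball z0 r) (pd b (F a u p))" for a b p
    using C1_F[of u, OF C1] by (auto simp: C_k_on_Suc)
  \<comment> \<open>By \<open>ray_integral_fundamental\<close> for \<open>F b u p\<close> the terms
    without coordinate factor cancel. What remains is the ray integral of the curl of
    \<open>F\<close>.\<close>
  have E1: "E b p x = (\<Sum>a\<in>UNIV. (x - z0) $ a * (ray_integral (Suc 0) z0 (pd b (F a u p)) x - ray_integral (Suc 0) z0 (pd a (F b u p)) x))"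
    if x: "x \<in> ball z0 r" for b p x
  proof -
    have "pd b (u p) x = pd b (T u p) x" by (rule pd_cong_open[OF open_ball x]) (simp add: fp)
    then show ?thesis
      unfolding E_def pd_T[of u, OF C1 x] by (simp add: ray_integral_fundamental[OF C1_F[of u, OF C1] x, of b p] right_diff_distrib sum_subtractf)
  qed
  \<comment> \<open>Flatness removes from the curl all terms in \<open>u\<close> itself and leaves
    an expression linear in the defect.\<close>
  have E2: "pd b (F a u p) y - pd a (F b u p) y = (\<Sum>q\<in>UNIV. A a p q y * E b q y - A b p q y * E a q y)"
    if y: "y \<in> ball z0 r" for a b p y
  proof -
    have fl: "(\<Sum>q\<in>UNIV. (pd b (A a p q) y + (\<Sum>s\<in>UNIV. A a p s y * A b s q y)) * u q y)
        = (\<Sum>q\<in>UNIV. (pd a (A b p q) y + (\<Sum>s\<in>UNIV. A b p s y * A a s q y)) * u q y)"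
      by (simp add: flat[OF y])
    have sw: "(\<Sum>q\<in>UNIV. (\<Sum>s\<in>UNIV. A a p s y * A b s q y) * u q y) = (\<Sum>q\<in>UNIV. A a p q y * F b u q y)" for a b
      unfolding F_def sum_distrib_left sum_distrib_right by (subst sum.swap) (simp add: mult.assoc)
    show ?thesis
      using fl unfolding distrib_right sum.distrib sw pd_F[of u, OF C1 y] E_def right_diff_distrib sum_subtractf by linarith
  qed
  \<comment> \<open>A bound \<open>e\<close> on the whole ball improves to \<open>e / 2\<close>: the
    two products in \<open>E2\<close> contribute twice \<open>M * e\<close>, and the smallness
    condition supplies the factor 1/4. Iteration forces the defect to vanish.\<close>
  have step: "\<bar>E b p x\<bar> \<le> e / 2" if e: "\<And>b p x. x \<in> ball z0 r \<Longrightarrow> \<bar>E b p x\<bar> \<le> e" and x: "x \<in> ball z0 r" for e b p x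
  proof -
    have e0: "0 \<le> e" using e[OF x] by (meson abs_ge_zero order_trans)
    have "\<bar>pd b (F a u p) y - pd a (F b u p) y\<bar> \<le> real CARD('k) * (2 * (M * e))" if y: "y \<in> ball z0 r" for a y
      unfolding E2[OF y]
    proof (rule abs_sum_le_card)
      fix q
      have "\<bar>A a p q y * E b q y\<bar> \<le> M * e" "\<bar>A b p q y * E a q y\<bar> \<le> M * e"
        using A_le[OF y] e[OF y] M by (auto simp: abs_mult intro!: mult_mono)
      then show "\<bar>A a p q y * E b q y - A b p q y * E a q y\<bar> \<le> 2 * (M * e)" by linarith
    qed
    then have "\<bar>E b p x\<bar> \<le> real CARD('n) * r * (real CARD('k) * (2 * (M * e)))"
      unfolding E1[OF x] by (intro coord_sum_le[OF x] ray_integral_diff_le[OF c c x])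
    also have "\<dots> = (real CARD('n) * r * (real CARD('k) * M)) * (2 * e)" by simp
    also have "\<dots> \<le> 1 / 4 * (2 * e)" using small e0 by (intro mult_right_mono) auto
    finally show ?thesis by simp
  qed
  have bound: "\<bar>E b p x\<bar> \<le> (C + real CARD('k) * (M * C)) / 2 ^ n" if "x \<in> ball z0 r" for n b p x
    using that
  proof (induction n arbitrary: b p x)
    case 0
    have "\<bar>F b u p x\<bar> \<le> real CARD('k) * (M * C)"
      using F_diff_le[of u x "\<lambda>p x. 0" C b p] uC 0 by (simp add: F_def)
    then show ?case using duC[OF 0, of b p] by (simp add: E_def)
  next
    case (Suc n)
    show ?case using step[OF Suc.IH Suc.prems] by (simp add: mult.commute)
  qed
  have pde: "pd a (u p) x = F a u p x" if "x \<in> ball z0 r" for a p x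
    using real_le_inverse_powers_imp_zero[OF bound[OF that]] by (simp add: E_def)
  \<comment> \<open>Bootstrap: the equation expresses the first derivatives of \<open>u\<close> by
    \<open>u\<close> and smooth coefficients, so each order of differentiability yields the
    next.\<close>
  have "C_k_on k (ball z0 r) (u p)" for k p
  proof (induction k arbitrary: p)
    case 0
    show ?case using C1 C_k_on_SucD by blast
  next
    case (Suc k)
    have "C_k_on k (ball z0 r) (\<lambda>y. \<Sum>q\<in>J. A a p q y * u q y)" for J a
      by (induction J rule: infinite_finite_induct)
        (use Suc smooth[unfolded smooth_on_def] in \<open>auto intro!: C_k_on_const C_k_on_add C_k_on_mult\<close>)
    then have "C_k_on k (ball z0 r) (F a u p)" for a by (simp add: F_def)
    then have "C_k_on k (ball z0 r) (pd a (u p))" for a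
      using C_k_on_cong[of "ball z0 r" "pd a (u p)" "F a u p" k] pde by simp
    then show ?case using C1[of p] by (simp add: C_k_on_Suc)
  qed
  moreover have "u p z0 = ini p" for p
    using fp[of z0 p] r by (simp add: T_def)
  ultimately show ?thesis using that[of u] pde by (simp add: smooth_on_def F_def)
qed

end

text \<open>The radius is fixed by bounds on the coefficients and their first derivatives over a
  compact ball, before the initial values are chosen; solutions with different initial values can
  therefore be combined on one ball.\<close>

lemma flat_linear_system:
  fixes A :: "'n::finite \<Rightarrow> 'k::finite \<Rightarrow> 'k \<Rightarrow> real ^ 'n \<Rightarrow> real" 
  assumes S: "open S" "z0 \<in> S" and sm: "\<And>a p q. smooth_on S (A a p q)"
    and flat: "\<And>a b p q z. z \<in> S \<Longrightarrow>
       pd b (A a p q) z + (\<Sum>s\<in>UNIV. A a p s z * A b s q z)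
         = pd a (A b p q) z + (\<Sum>s\<in>UNIV. A b p s z * A a s q z)"
  obtains r where "r > 0" "ball z0 r \<subseteq> S"
    "\<And>ini. \<exists>u. (\<forall>p. smooth_on (ball z0 r) (u p)) \<and> (\<forall>p. u p z0 = ini p) \<and>
      (\<forall>a p. \<forall>x\<in>ball z0 r. pd a (u p) x = (\<Sum>q\<in>UNIV. A a p q x * u q x))"
proof -
  obtain r0 where r0: "r0 > 0" "cball z0 r0 \<subseteq> S" using S open_contains_cball by blast
  have "\<exists>M\<ge>0. \<forall>i. \<forall>z\<in>cball z0 r0. \<bar>(case i of (a, p, q) \<Rightarrow> A a p q) z\<bar> \<le> M"
    by (rule finite_family_bounded)
      (auto split: prod.splits intro!: continuous_on_subset[OF smooth_on_continuous[OF sm] r0(2)])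
  then obtain M1 where "M1 \<ge> 0" "\<forall>i. \<forall>z\<in>cball z0 r0. \<bar>(case i of (a, p, q) \<Rightarrow> A a p q) z\<bar> \<le> M1" by blast
  then have M1: "M1 \<ge> 0" "\<And>a p q z. z \<in> cball z0 r0 \<Longrightarrow> \<bar>A a p q z\<bar> \<le> M1" by auto
  have "\<exists>M\<ge>0. \<forall>i. \<forall>z\<in>cball z0 r0. \<bar>(case i of (a, b, p, q) \<Rightarrow> pd b (A a p q)) z\<bar> \<le> M"
    by (rule finite_family_bounded)
      (auto split: prod.splits intro!: continuous_on_subset[OF smooth_on_continuous[OF smooth_on_pd[OF sm]] r0(2)])
  then obtain M2 where "M2 \<ge> 0" "\<forall>i. \<forall>z\<in>cball z0 r0. \<bar>(case i of (a, b, p, q) \<Rightarrow> pd b (A a p q)) z\<bar> \<le> M2" by blast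
  then have M2: "M2 \<ge> 0" "\<And>a b p q z. z \<in> cball z0 r0 \<Longrightarrow> \<bar>pd b (A a p q) z\<bar> \<le> M2" by auto
  define M where "M = M1 + M2"
  \<comment> \<open>The single inequality
    \<open>real CARD('n) * r * (real CARD('k) * M + 1) \<le> 1 / 4\<close> contains both smallness
    conditions of \<open>flat_system\<close>.\<close>
  define r where "r = min r0 (1 / (4 * real CARD('n) * (real CARD('k) * M + 1)))"
  have M: "M \<ge> 0" using M1 M2 by (simp add: M_def)
  have kM: "real CARD('k) * M + 1 > 0" "real CARD('k) * M \<ge> 0" using M by (auto simp: add_nonneg_pos)
  have n: "real CARD('n) > 0" by simp
  have r: "r > 0" using r0 kM n unfolding r_def by simp
  have "r \<le> 1 / (4 * real CARD('n) * (real CARD('k) * M + 1))" by (simp add: r_def)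
  then have rr: "real CARD('n) * r * (real CARD('k) * M + 1) \<le> 1 / 4"
    using kM(1) n by (subst (asm) pos_le_divide_eq) (auto simp: mult_ac)
  have 1: "real CARD('n) * r * (real CARD('k) * M) \<le> 1 / 4"
    and 2: "real CARD('n) * r \<le> 1"
  proof -
    have "real CARD('n) * r \<ge> 0" using r n by (intro mult_nonneg_nonneg) auto
    moreover from this have "real CARD('n) * r * (real CARD('k) * M) \<ge> 0" using kM(2) by (rule mult_nonneg_nonneg)
    ultimately show "real CARD('n) * r * (real CARD('k) * M) \<le> 1 / 4" "real CARD('n) * r \<le> 1"
      using rr unfolding distrib_left by linarith+
  qed
  have sub: "ball z0 r \<subseteq> cball z0 r0" by (auto simp: r_def)
  have "\<exists>u. (\<forall>p. smooth_on (ball z0 r) (u p)) \<and> (\<forall>p. u p z0 = ini p) \<and>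
      (\<forall>a p. \<forall>x\<in>ball z0 r. pd a (u p) x = (\<Sum>q\<in>UNIV. A a p q x * u q x))" for ini
  proof -
    interpret flat_system A z0 r M ini
    proof
      show "smooth_on (ball z0 r) (A a p q)" for a p q
        using sm sub r0 smooth_on_subset by blast
      show "\<bar>A a p q z\<bar> \<le> M" "\<bar>pd b (A a p q) z\<bar> \<le> M" if "z \<in> ball z0 r" for a b p q z
        using M1(1) M2(1) M1(2)[of z a p q] M2(2)[of z b a p q] sub that unfolding M_def by auto
      show "pd b (A a p q) z + (\<Sum>s\<in>UNIV. A a p s z * A b s q z)
          = pd a (A b p q) z + (\<Sum>s\<in>UNIV. A b p s z * A a s q z)" if "z \<in> ball z0 r" for a b p q z
        by (rule flat) (use that sub r0 in blast)
    qed (fact r M 1 2)+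
    show ?thesis by (rule solution) blast
  qed
  then show ?thesis using that[of r] r sub r0 by blast
qed

subsection \<open>Connections in coordinates\<close>

lemma kron_sum [simp]:
  fixes f :: "'n::finite \<Rightarrow> real"
  shows "(\<Sum>i\<in>UNIV. kron a i * f i) = f a" "(\<Sum>i\<in>UNIV. kron i a * f i) = f a"
    "(\<Sum>i\<in>UNIV. f i * kron a i) = f a" "(\<Sum>i\<in>UNIV. f i * kron i a) = f a"
  by (simp_all add: kron_def if_distrib [of "\<lambda>t. t * _"] if_distrib [of "\<lambda>t. _ * t"] cong: if_cong)

lemma kron_trace: "(\<Sum>c\<in>UNIV. kron c (c :: 3)) = 3"
  by (simp add: kron_def)

lemma kron_commute: "kron a b = kron b a"
  by (simp add: kron_def)

text \<open>Christoffel symbols are written \<open>G a d i\<close> for \<open>\<Gamma>\<^sub>a\<^sub>d\<^sup>i\<close>, that is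
  \<open>\<nabla>\<^sub>a Y\<^sup>i = \<partial>\<^sub>a Y\<^sup>i + \<Gamma>\<^sub>a\<^sub>d\<^sup>i Y\<^sup>d\<close>.\<close>

definition curv :: "('n::finite \<Rightarrow> 'n \<Rightarrow> 'n \<Rightarrow> real ^ 'n \<Rightarrow> real) \<Rightarrow> 'n \<Rightarrow> 'n \<Rightarrow> 'n \<Rightarrow> 'n \<Rightarrow> real ^ 'n \<Rightarrow> real" where
  "curv G a b i d z = pd a (G b d i) z - pd b (G a d i) z
     + (\<Sum>e\<in>UNIV. G a e i z * G b d e z - G b e i z * G a d e z)"

definition proj_shift :: "('n::finite \<Rightarrow> 'n \<Rightarrow> 'n \<Rightarrow> real ^ 'n \<Rightarrow> real) \<Rightarrow> ('n \<Rightarrow> real ^ 'n \<Rightarrow> real) \<Rightarrow>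
    'n \<Rightarrow> 'n \<Rightarrow> 'n \<Rightarrow> real ^ 'n \<Rightarrow> real" where
  "proj_shift G \<Upsilon> a d i = (\<lambda>z. G a d i z + \<Upsilon> a z * kron d i + \<Upsilon> d z * kron a i)"

text \<open>This is \<open>\<Upsilon>\<^sub>a \<Upsilon>\<^sub>b - \<nabla>\<^sub>a
  \<Upsilon>\<^sub>b\<close>, the change of the Schouten tensor under the projective change by
  \<Upsilon>.\<close>

definition schouten_shift :: "('n::finite \<Rightarrow> 'n \<Rightarrow> 'n \<Rightarrow> real ^ 'n \<Rightarrow> real) \<Rightarrow> ('n \<Rightarrow> real ^ 'n \<Rightarrow> real) \<Rightarrow>
    'n \<Rightarrow> 'n \<Rightarrow> real ^ 'n \<Rightarrow> real" where
  "schouten_shift G \<Upsilon> a b z = \<Upsilon> a z * \<Upsilon> b z - pd a (\<Upsilon> b) z + (\<Sum>e\<in>UNIV. G a b e z * \<Upsilon> e z)"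

lemma curv_cong:
  assumes "open S" "z \<in> S" "\<And>a d i y. y \<in> S \<Longrightarrow> G a d i y = G' a d i y"
  shows "curv G a b i d z = curv G' a b i d z"
  unfolding curv_def using assms pd_cong_open[OF assms(1,2), of "G _ _ _" "G' _ _ _"] by simp

text \<open>Everything that a projective change adds to the curvature has the shape of a Schouten
  term, so it is absorbed by \<open>P\<close>. This is the projective invariance of the Weyl
  curvature in coordinates.\<close>

lemma curv_proj_shift:
  fixes G :: "'n::finite \<Rightarrow> 'n \<Rightarrow> 'n \<Rightarrow> real ^ 'n \<Rightarrow> real"
  assumes G: "\<And>a d i. G a d i differentiable (at z)" and \<Upsilon>: "\<And>a. \<Upsilon> a differentiable (at z)"
    and sym: "\<And>a d i. G a d i z = G d a i z"
  shows "curv (proj_shift G \<Upsilon>) a b i d z = curv G a b i d z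
     + (kron a i * schouten_shift G \<Upsilon> b d z - kron b i * schouten_shift G \<Upsilon> a d z)
     + (schouten_shift G \<Upsilon> b a z - schouten_shift G \<Upsilon> a b z) * kron i d"
proof -
  have p: "pd a (proj_shift G \<Upsilon> b d i) z = pd a (G b d i) z + pd a (\<Upsilon> b) z * kron d i + pd a (\<Upsilon> d) z * kron b i" for a b d
    unfolding proj_shift_def by (simp add: pd_add pd_mult G \<Upsilon> differentiable_add differentiable_mult)
  have q: "(\<Sum>e\<in>UNIV. proj_shift G \<Upsilon> a e i z * proj_shift G \<Upsilon> b d e z)
     = (\<Sum>e\<in>UNIV. G a e i z * G b d e z) + G a d i z * \<Upsilon> b z + G a b i z * \<Upsilon> d z
       + \<Upsilon> a z * G b d i z + kron a i * (\<Sum>e\<in>UNIV. G b d e z * \<Upsilon> e z)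
       + \<Upsilon> a z * \<Upsilon> b z * kron d i + \<Upsilon> a z * \<Upsilon> d z * kron b i + 2 * (kron a i * \<Upsilon> b z * \<Upsilon> d z)" for a b
  proof -
    have "proj_shift G \<Upsilon> a e i z * proj_shift G \<Upsilon> b d e z = G a e i z * G b d e z
       + \<Upsilon> b z * (G a e i z * kron d e) + \<Upsilon> d z * (G a e i z * kron b e)
       + \<Upsilon> a z * (G b d e z * kron e i) + kron a i * (G b d e z * \<Upsilon> e z)
       + \<Upsilon> a z * \<Upsilon> b z * (kron d e * kron e i) + \<Upsilon> a z * \<Upsilon> d z * (kron b e * kron e i)
       + kron a i * \<Upsilon> b z * (\<Upsilon> e z * kron d e) + kron a i * \<Upsilon> d z * (\<Upsilon> e z * kron b e)" for e
      by (simp add: proj_shift_def algebra_simps)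
    then show ?thesis
      by (simp add: sum.distrib sum_distrib_left[symmetric] algebra_simps)
  qed
  have s: "(\<Sum>e\<in>UNIV. G a b e z * \<Upsilon> e z) = (\<Sum>e\<in>UNIV. G b a e z * \<Upsilon> e z)" for a b
    by (simp add: sym[of a b])
  show ?thesis
    unfolding curv_def schouten_shift_def sum_subtractf p q
    by (simp add: s[of b a] sym[of b a] kron_commute[of d i] algebra_simps)
qed

text \<open>The second Bianchi identity \<open>\<nabla>\<^sub>[\<^sub>e R\<^sub>a\<^sub>b\<^sub>]\<^sup>i\<^sub>d = 0\<close>; the terms with Christoffel symbols contracted into
  the indices \<open>a\<close> and \<open>b\<close> cancel for a torsion-free connection and are left out.\<close>

lemma bianchi_curv:
  fixes G :: "3 \<Rightarrow> 3 \<Rightarrow> 3 \<Rightarrow> real ^ 3 \<Rightarrow> real"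
  assumes S: "open S" "z \<in> S" and G: "\<And>a d i. smooth_on S (G a d i)"
  defines "N \<equiv> \<lambda>e a b i d. pd e (curv G a b i d) z
      + (\<Sum>c\<in>UNIV. G e c i z * curv G a b c d z - curv G a b i c z * G e d c z)"
  shows "N e a b i d + N a b e i d + N b e a i d = 0"
proof -
  have d: "G a d i differentiable (at z)" "pd e (G a d i) differentiable (at z)" for a d i e
    using smooth_on_differentiable[OF G S(2)] smooth_on_differentiable[OF smooth_on_pd[OF G] S(2)] by auto
  have c: "pd e (curv G a b i d) z = pd e (pd a (G b d i)) z - pd e (pd b (G a d i)) z
     + (\<Sum>c\<in>UNIV. (pd e (G a c i) z * G b d c z + G a c i z * pd e (G b d c) z)
        - (pd e (G b c i) z * G a d c z + G b c i z * pd e (G a d c) z))" for e a b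
    unfolding curv_def[abs_def]
    by (simp add: pd_add pd_diff pd_sum pd_mult d differentiable_add differentiable_diff differentiable_mult differentiable_sum)
  have C: "pd e (pd a (G b d i)) z = pd a (pd e (G b d i)) z" for e a b
    by (rule pd_commute[OF S G])
  show ?thesis
    unfolding N_def c C[of e a] C[of a b] C[of b e] unfolding curv_def sum_3
    by (simp add: algebra_simps)
qed

lemma sum_UNIV_option:
  "(\<Sum>p\<in>(UNIV :: 'a::finite option set). f p) = f None + (\<Sum>a\<in>UNIV. f (Some a))"
  by (simp add: UNIV_option_conv sum.reindex)

lemma continuous_on_det:
  fixes f :: "'a::topological_space \<Rightarrow> real ^ 'n ^ 'n::finite"
  assumes "\<And>i j. continuous_on S (\<lambda>x. f x $ i $ j)"
  shows "continuous_on S (\<lambda>x. det (f x))"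
  unfolding det_def by (intro continuous_intros assms)

lemma det_kron: "det (\<chi> k a. kron k a) = 1"
proof -
  have "(\<chi> k a. kron k a) = (mat 1 :: real ^ 'a ^ 'a)" by (simp add: mat_def kron_def vec_eq_iff)
  then show ?thesis by simp
qed

lemma smooth_on_proj_shift:
  assumes "open S" "\<And>a d i. smooth_on S (G a d i)" "\<And>a. smooth_on S (\<Upsilon> a)"
  shows "smooth_on S (proj_shift G \<Upsilon> a d i)"
  unfolding proj_shift_def by (intro smooth_on_add smooth_on_mult smooth_on_const assms)

lemma smooth_on_curv:
  assumes "open S" "\<And>a d i. smooth_on S (G a d i)"
  shows "smooth_on S (curv G a b i d)"
  unfolding curv_def[abs_def]
  by (intro smooth_on_add smooth_on_diff smooth_on_sum smooth_on_mult smooth_on_pd assms)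

text \<open>If the trace of \<open>\<Gamma>\<close> vanishes then \<open>\<beta> = 0\<close>, and vanishing projective Weyl curvature makes the tractor
  system \<open>\<nabla>\<^sub>a \<nabla>\<^sub>b t + P\<^sub>a\<^sub>b t = 0\<close> flat. The Cotton tensor vanishes by the Bianchi identity with three distinct
  indices.\<close>

lemma tracefree_flat_tractors:
  fixes G :: "3 \<Rightarrow> 3 \<Rightarrow> 3 \<Rightarrow> real ^ 3 \<Rightarrow> real"
  assumes S: "open S" "z0 \<in> S" and G: "\<And>a d i. smooth_on S (G a d i)"
    and sym: "\<And>a d i z. z \<in> S \<Longrightarrow> G a d i z = G d a i z"
    and tr: "\<And>a z. z \<in> S \<Longrightarrow> (\<Sum>c\<in>UNIV. G a c c z) = 0"
    and W: "\<And>z. z \<in> S \<Longrightarrow> \<exists>P. \<forall>a b i d. curv G a b i d z = kron a i * P b d - kron b i * P a d + (P b a - P a b) * kron i d"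
  obtains P r where "r > 0" "ball z0 r \<subseteq> S"
    "\<And>ini1 ini2. \<exists>t. smooth_on (ball z0 r) t \<and> t z0 = ini1 \<and> (\<forall>a. pd a t z0 = ini2 a) \<and>
       (\<forall>a b. \<forall>z\<in>ball z0 r. pd a (pd b t) z = (\<Sum>c\<in>UNIV. G a b c z * pd c t z) - P a b z * t z)"
proof -
  \<comment> \<open>For symmetric \<open>Q\<close> the contraction of \<open>a\<close> with
    \<open>i\<close> gives \<open>3 * Q - Q\<close>, hence the division by 2.\<close>
  define P where "P = (\<lambda>b d z. (\<Sum>a\<in>UNIV. curv G a b a d z) / 2)"
  have R: "curv G a b i d z = kron a i * P b d z - kron b i * P a d z" (is ?R)
    and Psym: "P a b z = P b a z" (is ?P) if z: "z \<in> S" for a b i d z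
  proof -
    obtain Q where Q: "\<And>a b i d. curv G a b i d z = kron a i * Q b d - kron b i * Q a d + (Q b a - Q a b) * kron i d"
      using W[OF z] by blast
    \<comment> \<open>Contracting over \<open>c\<close> cancels the quadratic terms and leaves
      derivatives of the vanishing trace of \<Gamma>. The same contraction of the decomposition is
      \<open>4 * (Q b a - Q a b)\<close>, so \<open>Q\<close> is symmetric.\<close>
    have "(\<Sum>c\<in>UNIV. curv G a b c c z) = 0" for a b
    proof -
      have "(\<Sum>c\<in>UNIV. pd a (G b c c) z) = 0" for a b
      proof -
        have "(\<Sum>c\<in>UNIV. pd a (G b c c) z) = pd a (\<lambda>z. \<Sum>c\<in>UNIV. G b c c z) z"
          by (rule pd_sum[symmetric]) (use smooth_on_differentiable[OF G z] in auto)
        also have "\<dots> = pd a (\<lambda>z. 0) z" by (rule pd_cong_open[OF S(1) z]) (simp add: tr)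
        finally show ?thesis by simp
      qed
      then show ?thesis
        unfolding curv_def sum.distrib sum_subtractf by (simp add: sum_3 algebra_simps)
    qed
    then have "(\<Sum>c\<in>UNIV. kron a c * Q b c) - (\<Sum>c\<in>UNIV. kron b c * Q a c) + (Q b a - Q a b) * (\<Sum>c\<in>UNIV. kron c (c :: 3)) = 0" for a b
      unfolding Q sum.distrib sum_subtractf sum_distrib_left .
    then have Qs: "Q b a = Q a b" for a b
      unfolding kron_sum by (simp add: kron_trace)
    have "P b d z = Q b d" for b d
      unfolding P_def Q sum.distrib sum_subtractf kron_sum sum_distrib_right[symmetric] by (simp add: kron_trace Qs)
    then show ?R ?P using Q Qs by simp_all
  qed
  have smP: "smooth_on S (P a b)" for a b
    unfolding P_def divide_inverse by (intro smooth_on_mult smooth_on_sum smooth_on_const smooth_on_curv S G)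
  have dP: "P a b differentiable (at z)" if "z \<in> S" for a b z
    using smooth_on_differentiable[OF smP that] .
  have pdR: "pd e (curv G a b i d) z = kron a i * pd e (P b d) z - kron b i * pd e (P a d) z" if z: "z \<in> S" for e a b i d z
  proof -
    have "pd e (curv G a b i d) z = pd e (\<lambda>z. kron a i * P b d z - kron b i * P a d z) z"
      by (rule pd_cong_open[OF S(1) z]) (rule R)
    then show ?thesis by (simp add: pd_diff pd_cmult dP[OF z] differentiable_mult)
  qed
  have cotton: "pd a (P b d) z + (\<Sum>c\<in>UNIV. G b d c z * P a c z) = pd b (P a d) z + (\<Sum>c\<in>UNIV. G a d c z * P b c z)"
    if z: "z \<in> S" for a b d z
  proof (cases "a = b")
    case False
    \<comment> \<open>Two values cannot exhaust three, so a third index \<open>e\<close> exists.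
      With the upper index of the Bianchi identity equal to \<open>e\<close>, the Kronecker factors
      kill the curvature derivative along \<open>e\<close> and leave the skew derivative of
      \<open>P\<close> in \<open>a\<close> and \<open>b\<close>.\<close>
    have "card {a, b} \<noteq> CARD(3)" by (simp add: card_insert_if)
    then have "{a, b} \<noteq> UNIV" by metis
    then obtain e where e: "e \<noteq> a" "e \<noteq> b" by blast
    have "(\<Sum>c\<in>UNIV. G x c i z * curv G y w c d z) = G x y i z * P w d z - G x w i z * P y d z" for x y w i
      by (simp add: R[OF z] right_diff_distrib sum_subtractf mult.assoc[symmetric] sum_distrib_right[symmetric])
    moreover have "(\<Sum>c\<in>UNIV. curv G y w i c z * G x d c z) = kron y i * (\<Sum>c\<in>UNIV. G x d c z * P w c z) - kron w i * (\<Sum>c\<in>UNIV. G x d c z * P y c z)" for x y w i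
      unfolding R[OF z] left_diff_distrib sum_subtractf sum_distrib_left by (simp add: mult_ac)
    ultimately show ?thesis
      using bianchi_curv[of S z G a e b e d, OF S(1) z G] e False
      unfolding sum_subtractf pdR[OF z]
      by (simp add: kron_def sym[OF z, of e a] sym[OF z, of b a] sym[OF z, of b e])
  qed simp
  \<comment> \<open>The tractor equation as a first-order system: the unknown holds \<open>t\<close>
    at \<open>None\<close> and its partial derivatives at \<open>Some b\<close>.\<close>
  define A :: "3 \<Rightarrow> 3 option \<Rightarrow> 3 option \<Rightarrow> real ^ 3 \<Rightarrow> real" where
    "A = (\<lambda>a p q. case p of None \<Rightarrow> (case q of None \<Rightarrow> (\<lambda>z. 0) | Some c \<Rightarrow> (\<lambda>z. kron a c))
       | Some b \<Rightarrow> (case q of None \<Rightarrow> (\<lambda>z. - P a b z) | Some c \<Rightarrow> G a b c))"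
  have A: "A a None None = (\<lambda>z. 0)" "A a None (Some c) = (\<lambda>z. kron a c)"
     "A a (Some b) None = (\<lambda>z. - P a b z)" "A a (Some b) (Some c) = G a b c" for a b c
    by (auto simp: A_def)
  have smA: "smooth_on S (A a p q)" for a p q
    by (cases p; cases q) (auto simp: A intro: smooth_on_const smooth_on_minus S smP G)
  \<comment> \<open>Row \<open>None\<close> expresses the symmetry of \<open>P\<close> and of
    \<Gamma>. In row \<open>Some d\<close>, column \<open>None\<close> is the vanishing of the
    Cotton tensor and column \<open>Some c\<close> is the curvature formula
    \<open>R\<close>.\<close>
  have flat: "pd b (A a p q) z + (\<Sum>s\<in>UNIV. A a p s z * A b s q z)
         = pd a (A b p q) z + (\<Sum>s\<in>UNIV. A b p s z * A a s q z)" if z: "z \<in> S" for a b p q z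
  proof (cases p)
    case None
    then show ?thesis
      by (cases q) (simp_all add: A sum_UNIV_option sum_negf Psym[OF z, of a b] sym[OF z, of a b])
  next
    case (Some d)
    show ?thesis
    proof (cases q)
      case None
      then show ?thesis using Some cotton[OF z, of a d b] cotton[OF z, of a b d]
        by (simp add: A sum_UNIV_option pd_minus dP[OF z] sum_negf)
    next
      case (Some c)
      have "curv G a b c d z = kron a c * P b d z - kron b c * P a d z" by (rule R[OF z])
      then show ?thesis using \<open>p = Some d\<close> Some
        by (simp add: A sum_UNIV_option curv_def sum_subtractf algebra_simps)
    qed
  qed
  obtain r where r: "r > 0" "ball z0 r \<subseteq> S"
    and sol: "\<And>ini. \<exists>u. (\<forall>p. smooth_on (ball z0 r) (u p)) \<and> (\<forall>p. u p z0 = ini p) \<and>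
      (\<forall>a p. \<forall>x\<in>ball z0 r. pd a (u p) x = (\<Sum>q\<in>UNIV. A a p q x * u q x))"
    by (rule flat_linear_system[of S z0 A, OF S smA flat]) blast+
  have "\<exists>t. smooth_on (ball z0 r) t \<and> t z0 = ini1 \<and> (\<forall>a. pd a t z0 = ini2 a) \<and>
       (\<forall>a b. \<forall>z\<in>ball z0 r. pd a (pd b t) z = (\<Sum>c\<in>UNIV. G a b c z * pd c t z) - P a b z * t z)" for ini1 ini2
  proof -
    obtain u where u: "\<And>p. smooth_on (ball z0 r) (u p)" "\<And>p. u p z0 = (case p of None \<Rightarrow> ini1 | Some a \<Rightarrow> ini2 a)"
      "\<And>a p x. x \<in> ball z0 r \<Longrightarrow> pd a (u p) x = (\<Sum>q\<in>UNIV. A a p q x * u q x)"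
      using sol[of "\<lambda>p. case p of None \<Rightarrow> ini1 | Some a \<Rightarrow> ini2 a"] by blast
    have 1: "pd a (u None) z = u (Some a) z" if "z \<in> ball z0 r" for a z
      by (simp add: u(3)[OF that] sum_UNIV_option A)
    have "pd a (pd b (u None)) z = (\<Sum>c\<in>UNIV. G a b c z * pd c (u None) z) - P a b z * u None z" if "z \<in> ball z0 r" for a b z
    proof -
      have "pd a (pd b (u None)) z = pd a (u (Some b)) z" by (rule pd_cong_open[OF open_ball that]) (rule 1)
      then show ?thesis by (simp add: u(3)[OF that] sum_UNIV_option A 1[OF that])
    qed
    then show ?thesis using u(1,2) 1 r by (intro exI[of _ "u None"]) auto
  qed
  then show ?thesis using that r by blast
qed

text \<open>Affine coordinates are quotients of solutions \<open>t\<close> of the tractor system, and their differentials are parallel for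
  the connection obtained with \<open>\<Upsilon> = - d t\<^sub>0 / t\<^sub>0\<close>.\<close>

lemma projectively_flat_coordinates:
  fixes G :: "3 \<Rightarrow> 3 \<Rightarrow> 3 \<Rightarrow> real ^ 3 \<Rightarrow> real"
  assumes S: "open S" "z0 \<in> S" and G: "\<And>a d i. smooth_on S (G a d i)"
    and sym: "\<And>a d i z. z \<in> S \<Longrightarrow> G a d i z = G d a i z"
    and W: "\<And>z. z \<in> S \<Longrightarrow> \<exists>P. \<forall>a b i d. curv G a b i d z = kron a i * P b d - kron b i * P a d + (P b a - P a b) * kron i d"
  obtains T f \<Upsilon> where "open T" "z0 \<in> T" "T \<subseteq> S" "\<And>k. smooth_on T (f k)" "\<And>a. smooth_on T (\<Upsilon> a)"
    "\<And>z. z \<in> T \<Longrightarrow> det (\<chi> k a. pd a (f k) z :: real ^ 3 ^ 3) \<noteq> 0"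
    "\<And>a b k z. z \<in> T \<Longrightarrow> pd a (pd b (f k)) z = (\<Sum>i\<in>UNIV. proj_shift G \<Upsilon> a b i z * pd i (f k) z)"
proof -
  \<comment> \<open>A projective change adds \<open>3 * \<Upsilon> + \<Upsilon>\<close> to the trace
    of \<Gamma>, which explains the factor 1/4.\<close>
  define \<Upsilon>1 where "\<Upsilon>1 = (\<lambda>a z. - 1 / 4 * (\<Sum>c\<in>UNIV. G a c c z))"
  have sm1: "smooth_on S (\<Upsilon>1 a)" for a
    unfolding \<Upsilon>1_def by (intro smooth_on_mult smooth_on_sum smooth_on_const S G)
  define H where "H = proj_shift G \<Upsilon>1"
  have smH: "smooth_on S (H a d i)" for a d i
    unfolding H_def by (intro smooth_on_proj_shift S G sm1)
  have symH: "H a d i z = H d a i z" if "z \<in> S" for a d i z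
    by (simp add: H_def proj_shift_def sym[OF that, of a d])
  have trH: "(\<Sum>c\<in>UNIV. H a c c z) = 0" if "z \<in> S" for a z
  proof -
    have "(\<Sum>c\<in>UNIV. H a c c z) = (\<Sum>c\<in>UNIV. G a c c z) + \<Upsilon>1 a z * (\<Sum>c\<in>UNIV. kron c (c :: 3)) + \<Upsilon>1 a z"
      by (simp add: H_def proj_shift_def sum.distrib sum_distrib_left)
    then show ?thesis by (simp add: kron_trace \<Upsilon>1_def)
  qed
  have WH: "\<exists>P. \<forall>a b i d. curv H a b i d z = kron a i * P b d - kron b i * P a d + (P b a - P a b) * kron i d" if z: "z \<in> S" for z
  proof -
    obtain P where P: "\<And>a b i d. curv G a b i d z = kron a i * P b d - kron b i * P a d + (P b a - P a b) * kron i d"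
      using W[OF z] by blast
    have "curv H a b i d z = curv G a b i d z
     + (kron a i * schouten_shift G \<Upsilon>1 b d z - kron b i * schouten_shift G \<Upsilon>1 a d z)
     + (schouten_shift G \<Upsilon>1 b a z - schouten_shift G \<Upsilon>1 a b z) * kron i d" for a b i d
      unfolding H_def
      by (intro curv_proj_shift smooth_on_differentiable[OF G z] smooth_on_differentiable[OF sm1 z] sym[OF z])
    then show ?thesis
      unfolding P by (intro exI[of _ "\<lambda>a b. P a b + schouten_shift G \<Upsilon>1 a b z"]) (simp add: algebra_simps)
  qed
  obtain P r where r: "r > 0" "ball z0 r \<subseteq> S" and
    sol: "\<And>ini1 ini2. \<exists>t. smooth_on (ball z0 r) t \<and> t z0 = ini1 \<and> (\<forall>a. pd a t z0 = ini2 a) \<and>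
       (\<forall>a b. \<forall>z\<in>ball z0 r. pd a (pd b t) z = (\<Sum>c\<in>UNIV. H a b c z * pd c t z) - P a b z * t z)"
    by (rule tracefree_flat_tractors[of S z0 H, OF S smH symH trH WH]) blast+
  let ?B = "ball z0 r"
  \<comment> \<open>The initial values of \<open>s\<close> and of the \<open>t k\<close> below are
    chosen so that at \<open>z0\<close> the quotients \<open>t k / s\<close> have the identity
    matrix as Jacobian.\<close>
  obtain s where s: "smooth_on ?B s" "s z0 = 1" "\<And>a. pd a s z0 = 0"
    and sd: "\<And>a b z. z \<in> ?B \<Longrightarrow> pd a (pd b s) z = (\<Sum>c\<in>UNIV. H a b c z * pd c s z) - P a b z * s z"
    using sol[of 1 "\<lambda>a. 0"] by blast
  have "\<exists>t. \<forall>k. smooth_on ?B (t k) \<and> t k z0 = 0 \<and> (\<forall>a. pd a (t k) z0 = kron k a) \<and>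
       (\<forall>a b. \<forall>z\<in>ball z0 r. pd a (pd b (t k)) z = (\<Sum>c\<in>UNIV. H a b c z * pd c (t k) z) - P a b z * t k z)"
    by (intro choice allI) (rule sol)
  then obtain t where t: "\<And>k. smooth_on ?B (t k)" "\<And>k. t k z0 = 0" "\<And>k a. pd a (t k) z0 = kron k a"
    and td: "\<And>a b k z. z \<in> ?B \<Longrightarrow> pd a (pd b (t k)) z = (\<Sum>c\<in>UNIV. H a b c z * pd c (t k) z) - P a b z * t k z"
    by blast
  define B1 where "B1 = {z \<in> ?B. s z \<in> - {0}}"
  have B1: "open B1" "z0 \<in> B1" "B1 \<subseteq> ?B" "\<And>z. z \<in> B1 \<Longrightarrow> s z \<noteq> 0"
    unfolding B1_def using continuous_open_preimage[OF smooth_on_continuous[OF s(1)] open_ball, of "- {0}"] s r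
    by (auto simp: vimage_def Int_def)
  have sm: "smooth_on B1 s" "\<And>k. smooth_on B1 (t k)" "smooth_on B1 (\<lambda>z. inverse (s z))"
    using s t B1 by (auto intro: smooth_on_subset smooth_on_inverse)
  define f where "f = (\<lambda>k z. t k z * inverse (s z))"
  define \<Upsilon>2 where "\<Upsilon>2 = (\<lambda>a z. - (pd a s z * inverse (s z)))"
  define \<Upsilon> where "\<Upsilon> = (\<lambda>a z. \<Upsilon>1 a z + \<Upsilon>2 a z)"
  have smf: "smooth_on B1 (f k)" for k
    unfolding f_def by (intro smooth_on_mult B1 sm)
  have sm\<Upsilon>: "smooth_on B1 (\<Upsilon> a)" for a
    unfolding \<Upsilon>_def \<Upsilon>2_def
    by (intro smooth_on_add smooth_on_minus smooth_on_mult smooth_on_pd B1 sm smooth_on_subset[OF sm1]) (use B1 r in blast)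
  have D: "s differentiable (at z)" "t k differentiable (at z)" "(\<lambda>z. inverse (s z)) differentiable (at z)"
     "pd a s differentiable (at z)" "pd a (t k) differentiable (at z)" if "z \<in> B1" for z k a
    using that smooth_on_differentiable sm smooth_on_pd by blast+
  have pf: "pd b (f k) z = pd b (t k) z * inverse (s z) - t k z * (inverse (s z) * inverse (s z) * pd b s z)" if z: "z \<in> B1" for b k z
    unfolding f_def by (simp add: pd_mult pd_inverse D[OF z] B1(4)[OF z])
  have ppf: "pd a (pd b (f k)) z = (\<Sum>i\<in>UNIV. proj_shift G \<Upsilon> a b i z * pd i (f k) z)" if z: "z \<in> B1" for a b k z
  proof -
    define v where "v = inverse (s z)"
    have v: "s z * v = 1" using B1(4)[OF z] by (simp add: v_def)
    have zB: "z \<in> ?B" using z B1 by blast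
    have "pd a (pd b (f k)) z = pd a (\<lambda>z. pd b (t k) z * inverse (s z) - t k z * (inverse (s z) * inverse (s z) * pd b s z)) z"
      by (rule pd_cong_open[OF B1(1) z]) (rule pf)
    also have "\<dots> = pd a (pd b (t k)) z * v - pd b (t k) z * (v * v * pd a s z)
        - (pd a (t k) z * (v * v * pd b s z) + t k z * ((- (2 * (v * v * pd a s z) * v)) * pd b s z + v * v * pd a (pd b s) z))"
      by (simp add: pd_mult pd_diff pd_inverse D[OF z] B1(4)[OF z] differentiable_mult v_def[symmetric] algebra_simps)
    \<comment> \<open>The tractor equations for \<open>t k\<close> and for \<open>s\<close> both
      contribute a multiple of \<open>P a b z * t k z * v\<close>; the two combine with factor
      \<open>1 - s z * v\<close>, which is zero. The remaining first-order terms in \<open>s\<close>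
      are exactly a projective change by \<open>\<Upsilon>2\<close>.\<close>
    also have "\<dots> = (\<Sum>i\<in>UNIV. H a b i z * pd i (f k) z) - (pd a s z * v) * pd b (f k) z - (pd b s z * v) * pd a (f k) z
        - P a b z * t k z * v * (1 - s z * v)"
      unfolding td[OF zB] sd[OF zB] pf[OF z] v_def[symmetric] right_diff_distrib sum_subtractf
      by (simp add: sum_distrib_left sum_distrib_right algebra_simps)
    also have "\<dots> = (\<Sum>i\<in>UNIV. H a b i z * pd i (f k) z) + \<Upsilon>2 a z * pd b (f k) z + \<Upsilon>2 b z * pd a (f k) z"
      unfolding v \<Upsilon>2_def v_def[symmetric] by simp
    also have "\<dots> = (\<Sum>i\<in>UNIV. proj_shift G \<Upsilon> a b i z * pd i (f k) z)"
      unfolding H_def proj_shift_def \<Upsilon>_def by (simp add: distrib_right sum.distrib mult.assoc sum_distrib_left[symmetric])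
    finally show ?thesis .
  qed
  \<comment> \<open>The Jacobian determinant is 1 at \<open>z0\<close>, so by continuity the
    quotients remain coordinates on a smaller open set.\<close>
  define d where "d = (\<lambda>z. det (\<chi> k a. pd a (f k) z :: real ^ 3 ^ 3))"
  have "continuous_on B1 d"
    unfolding d_def by (rule continuous_on_det) (simp add: smooth_on_continuous[OF smooth_on_pd[OF smf]])
  then have op: "open {z \<in> B1. d z \<in> - {0}}"
    using continuous_open_preimage[OF _ B1(1), of d "- {0}"] by (simp add: vimage_def Int_def open_Compl)
  have d0: "d z0 = 1"
    unfolding d_def pf[OF B1(2)] by (simp add: s t det_kron)
  show ?thesis
  proof (rule that[of "{z \<in> B1. d z \<in> - {0}}" f \<Upsilon>])
    show "smooth_on {z \<in> B1. d z \<in> - {0}} (f k)" "smooth_on {z \<in> B1. d z \<in> - {0}} (\<Upsilon> a)" for k a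
      by (rule smooth_on_subset[OF smf] smooth_on_subset[OF sm\<Upsilon>], blast)+
    show "{z \<in> B1. d z \<in> - {0}} \<subseteq> S" using B1 r by blast
    show "det (\<chi> k a. pd a (f k) z :: real ^ 3 ^ 3) \<noteq> 0" if "z \<in> {z \<in> B1. d z \<in> - {0}}" for z
      using that by (simp add: d_def)
  qed (use B1(2) ppf op d0 in auto)
qed

section \<open>Curvature symmetries and integrability conditions\<close>

lemma curv_antisym: "curv G a b i d z = - curv G b a i d z"
  by (simp add: curv_def sum_subtractf)

lemma first_bianchi_curv:
  assumes S: "open S" "z \<in> S" and sym: "\<And>a d i z. z \<in> S \<Longrightarrow> G a d i z = G d a i z"
  shows "curv G a b i d z + curv G b d i a z + curv G d a i b z = 0"
proof -
  have "pd e (G a d i) z = pd e (G d a i) z" for e a d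
    by (rule pd_cong_open[OF S]) (rule sym)
  then show ?thesis
    unfolding curv_def sum_subtractf
    by (simp add: sym[OF S(2), of b d] sym[OF S(2), of a d] sym[OF S(2), of a b])
qed

definition nabla :: "('n::finite \<Rightarrow> 'n \<Rightarrow> 'n \<Rightarrow> real ^ 'n \<Rightarrow> real) \<Rightarrow> ('n \<Rightarrow> real ^ 'n \<Rightarrow> real) \<Rightarrow>
    'n \<Rightarrow> 'n \<Rightarrow> real ^ 'n \<Rightarrow> real" where
  "nabla G v a i z = pd a (v i) z + (\<Sum>d\<in>UNIV. G a d i z * v d z)"

lemma smooth_on_nabla:
  assumes "open S" "\<And>a d i. smooth_on S (G a d i)" "\<And>i. smooth_on S (v i)"
  shows "smooth_on S (nabla G v a i)"
  unfolding nabla_def[abs_def] by (intro smooth_on_add smooth_on_sum smooth_on_mult smooth_on_pd assms)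

text \<open>In \<open>nabla G (nabla G v b) a i\<close> the index \<open>b\<close> is only a label; its Christoffel term would drop out
  of the commutator of a torsion-free connection.\<close>

lemma nabla_commutator:
  assumes S: "open S" "z \<in> S" and G: "\<And>a d i. smooth_on S (G a d i)" and v: "\<And>i. smooth_on S (v i)"
  shows "nabla G (nabla G v b) a i z - nabla G (nabla G v a) b i z = (\<Sum>d\<in>UNIV. curv G a b i d z * v d z)"
proof -
  have d: "G a d i differentiable (at z)" "v i differentiable (at z)" "pd e (v i) differentiable (at z)" for a d i e
    using smooth_on_differentiable[OF G S(2)] smooth_on_differentiable[OF v S(2)] smooth_on_differentiable[OF smooth_on_pd[OF v] S(2)] by auto
  have n: "nabla G (nabla G v b) a i z = pd a (pd b (v i)) z
      + (\<Sum>d\<in>UNIV. pd a (G b d i) z * v d z) + (\<Sum>d\<in>UNIV. G b d i z * pd a (v d) z)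
      + (\<Sum>e\<in>UNIV. G a e i z * pd b (v e) z) + (\<Sum>d\<in>UNIV. (\<Sum>e\<in>UNIV. G a e i z * G b d e z) * v d z)" for a b
  proof -
    have "(\<Sum>e\<in>UNIV. G a e i z * (\<Sum>d\<in>UNIV. G b d e z * v d z)) = (\<Sum>d\<in>UNIV. (\<Sum>e\<in>UNIV. G a e i z * G b d e z) * v d z)"
      unfolding sum_distrib_left sum_distrib_right by (subst sum.swap) (simp add: mult.assoc)
    moreover have "pd a (nabla G v b i) z = pd a (pd b (v i)) z + (\<Sum>d\<in>UNIV. pd a (G b d i) z * v d z + G b d i z * pd a (v d) z)"
      unfolding nabla_def[abs_def] by (simp add: pd_add pd_sum pd_mult d differentiable_mult differentiable_sum)
    ultimately show ?thesis
      by (simp add: nabla_def[of G "nabla G v b"] nabla_def[of G v] distrib_left sum.distrib)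
  qed
  show ?thesis
    unfolding n curv_def sum_subtractf left_diff_distrib distrib_right sum.distrib
    by (simp add: pd_commute[OF S v, of b a])
qed

text \<open>The left-hand side is \<open>\<nabla>\<^sub>Y \<nabla>\<^sub>Z V - \<nabla>\<^sub>Z \<nabla>\<^sub>Y V - \<nabla>\<^bsub>[Y, Z]\<^esub> V\<close>.\<close>

lemma curvature_in_coordinates:
  assumes S: "open S" "p \<in> S" and G: "\<And>a d i. smooth_on S (G a d i)"
    and v: "\<And>i. smooth_on S (v i)" and y: "\<And>i. smooth_on S (y i)" and z: "\<And>i. smooth_on S (z i)"
  shows "(\<Sum>a\<in>UNIV. y a p * nabla G (\<lambda>i p. \<Sum>b\<in>UNIV. z b p * nabla G v b i p) a i p)
     - (\<Sum>a\<in>UNIV. z a p * nabla G (\<lambda>i p. \<Sum>b\<in>UNIV. y b p * nabla G v b i p) a i p)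
     - (\<Sum>a\<in>UNIV. (\<Sum>e\<in>UNIV. y e p * pd e (z a) p - z e p * pd e (y a) p) * nabla G v a i p)
     = (\<Sum>a\<in>UNIV. \<Sum>b\<in>UNIV. \<Sum>d\<in>UNIV. y a p * z b p * curv G a b i d p * v d p)"
proof -
  have leib: "nabla G (\<lambda>i p. \<Sum>b\<in>UNIV. z b p * nabla G v b i p) a i p
      = (\<Sum>b\<in>UNIV. pd a (z b) p * nabla G v b i p) + (\<Sum>b\<in>UNIV. z b p * nabla G (nabla G v b) a i p)"
    if z: "\<And>i. smooth_on S (z i)" for z a
  proof -
    have d: "z b differentiable (at p)" "nabla G v b i differentiable (at p)" for b i
      using smooth_on_differentiable[OF z S(2)] smooth_on_differentiable[OF smooth_on_nabla[OF S(1) G v] S(2)] by auto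
    have "(\<Sum>d\<in>UNIV. G a d i p * (\<Sum>b\<in>UNIV. z b p * nabla G v b d p))
       = (\<Sum>b\<in>UNIV. z b p * (\<Sum>d\<in>UNIV. G a d i p * nabla G v b d p))"
      unfolding sum_distrib_left by (subst sum.swap) (simp add: mult.left_commute)
    moreover have "pd a (\<lambda>p. \<Sum>b\<in>UNIV. z b p * nabla G v b i p) p
       = (\<Sum>b\<in>UNIV. pd a (z b) p * nabla G v b i p + z b p * pd a (nabla G v b i) p)"
      by (simp add: pd_sum pd_mult d differentiable_mult)
    ultimately show ?thesis
      by (simp add: nabla_def[of G "nabla G v _"] nabla_def[of G "\<lambda>i p. \<Sum>b\<in>UNIV. z b p * nabla G v b i p"] distrib_left sum.distrib)
  qed
  have sw: "(\<Sum>a\<in>UNIV. y a p * (\<Sum>b\<in>UNIV. pd a (z b) p * nabla G v b i p))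
     = (\<Sum>a\<in>UNIV. (\<Sum>e\<in>UNIV. y e p * pd e (z a) p) * nabla G v a i p)" for y z
    unfolding sum_distrib_left sum_distrib_right by (subst sum.swap) (simp add: mult.assoc)
  have sw2: "(\<Sum>a\<in>UNIV. z a p * (\<Sum>b\<in>UNIV. y b p * nabla G (nabla G v b) a i p))
      = (\<Sum>a\<in>UNIV. \<Sum>b\<in>UNIV. y a p * z b p * nabla G (nabla G v a) b i p)"
    unfolding sum_distrib_left by (subst sum.swap) (simp add: mult_ac)
  have "(\<Sum>a\<in>UNIV. \<Sum>b\<in>UNIV. \<Sum>d\<in>UNIV. y a p * z b p * curv G a b i d p * v d p)
     = (\<Sum>a\<in>UNIV. \<Sum>b\<in>UNIV. y a p * z b p * (nabla G (nabla G v b) a i p - nabla G (nabla G v a) b i p))"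
    unfolding nabla_commutator[of S p G v, OF S G v] by (simp add: sum_distrib_left mult.assoc)
  then show ?thesis
    unfolding leib[of y, OF y] leib[of z, OF z] distrib_left sum.distrib sw sw2
    by (simp add: left_diff_distrib right_diff_distrib sum_subtractf sum_distrib_left mult.assoc)
qed

text \<open>Integrability condition of a parallel covector field: both orders of the second partial
  derivatives of a component are computed from the equation, and their difference is a curvature
  contraction.\<close>

lemma parallel_coframe_flat:
  assumes S: "open S" "z \<in> S" and G: "\<And>a d i. smooth_on S (G a d i)" and th: "\<And>i. smooth_on S (th i)"
    and par: "\<And>a b z. z \<in> S \<Longrightarrow> pd a (th b) z = (\<Sum>i\<in>UNIV. G a b i z * th i z)"
  shows "(\<Sum>i\<in>UNIV. curv G a b i d z * th i z) = 0"
proof -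
  have df: "G a d i differentiable (at z)" "th i differentiable (at z)" for a d i
    using smooth_on_differentiable[OF G S(2)] smooth_on_differentiable[OF th S(2)] by auto
  have p: "pd a (pd b (th d)) z = (\<Sum>i\<in>UNIV. pd a (G b d i) z * th i z) + (\<Sum>i\<in>UNIV. (\<Sum>e\<in>UNIV. G a e i z * G b d e z) * th i z)" for a b
  proof -
    have "pd a (pd b (th d)) z = pd a (\<lambda>z. \<Sum>i\<in>UNIV. G b d i z * th i z) z"
      by (rule pd_cong_open[OF S]) (rule par)
    also have "\<dots> = (\<Sum>i\<in>UNIV. pd a (G b d i) z * th i z) + (\<Sum>e\<in>UNIV. G b d e z * (\<Sum>i\<in>UNIV. G a e i z * th i z))"
      by (simp add: pd_sum pd_mult df differentiable_mult sum.distrib par[OF S(2)])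
    also have "(\<Sum>e\<in>UNIV. G b d e z * (\<Sum>i\<in>UNIV. G a e i z * th i z)) = (\<Sum>i\<in>UNIV. (\<Sum>e\<in>UNIV. G a e i z * G b d e z) * th i z)"
      unfolding sum_distrib_left sum_distrib_right by (subst sum.swap) (simp add: mult_ac)
    finally show ?thesis .
  qed
  show ?thesis
    using pd_commute[OF S th, of a b d] unfolding p curv_def sum_subtractf left_diff_distrib distrib_right sum.distrib
    by simp
qed

text \<open>The same integrability argument for a parallel metric: the commutator of partial
  derivatives of \<open>g c d\<close> lets the curvature act on both indices.\<close>

lemma metric_curv_antisym:
  assumes S: "open S" "z \<in> S" and G: "\<And>a d i. smooth_on S (G a d i)" and g: "\<And>a b. smooth_on S (g a b)"
    and par: "\<And>e a b z. z \<in> S \<Longrightarrow> pd e (g a b) z = (\<Sum>i\<in>UNIV. G e a i z * g i b z) + (\<Sum>i\<in>UNIV. G e b i z * g a i z)"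
  shows "(\<Sum>i\<in>UNIV. curv G a b i c z * g i d z) + (\<Sum>i\<in>UNIV. curv G a b i d z * g c i z) = 0"
proof -
  have df: "G a d i differentiable (at z)" "g a d differentiable (at z)" for a d i
    using smooth_on_differentiable[OF G S(2)] smooth_on_differentiable[OF g S(2)] by auto
  \<comment> \<open>The cross terms with one Christoffel symbol on each index of \<open>g\<close>.
    They enter as \<open>X a b + X b a\<close> and drop out of the commutator.\<close>
  define X where "X = (\<lambda>a b. (\<Sum>i\<in>UNIV. G b c i z * (\<Sum>e\<in>UNIV. G a d e z * g i e z)))"
  have X: "(\<Sum>i\<in>UNIV. G b d i z * (\<Sum>e\<in>UNIV. G a c e z * g e i z)) = X b a" for a b
    unfolding X_def sum_distrib_left by (subst sum.swap) (simp add: mult_ac)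
  have p: "pd a (pd b (g c d)) z = (\<Sum>i\<in>UNIV. pd a (G b c i) z * g i d z) + (\<Sum>i\<in>UNIV. pd a (G b d i) z * g c i z)
     + (\<Sum>i\<in>UNIV. (\<Sum>e\<in>UNIV. G a e i z * G b c e z) * g i d z) + (\<Sum>i\<in>UNIV. (\<Sum>e\<in>UNIV. G a e i z * G b d e z) * g c i z)
     + X a b + X b a" for a b
  proof -
    have "pd a (pd b (g c d)) z = pd a (\<lambda>z. (\<Sum>i\<in>UNIV. G b c i z * g i d z) + (\<Sum>i\<in>UNIV. G b d i z * g c i z)) z"
      by (rule pd_cong_open[OF S]) (rule par)
    also have "\<dots> = (\<Sum>i\<in>UNIV. pd a (G b c i) z * g i d z) + (\<Sum>i\<in>UNIV. pd a (G b d i) z * g c i z)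
       + (\<Sum>i\<in>UNIV. G b c i z * (\<Sum>e\<in>UNIV. G a i e z * g e d z)) + X a b
       + (\<Sum>i\<in>UNIV. G b d i z * (\<Sum>e\<in>UNIV. G a c e z * g e i z)) + (\<Sum>i\<in>UNIV. G b d i z * (\<Sum>e\<in>UNIV. G a i e z * g c e z))"
      unfolding X_def
      by (simp add: pd_sum pd_add pd_mult df differentiable_mult differentiable_sum sum.distrib par[OF S(2)] distrib_left)
    also have "(\<Sum>i\<in>UNIV. G b c i z * (\<Sum>e\<in>UNIV. G a i e z * g e d z)) = (\<Sum>i\<in>UNIV. (\<Sum>e\<in>UNIV. G a e i z * G b c e z) * g i d z)"
      unfolding sum_distrib_left sum_distrib_right by (subst sum.swap) (simp add: mult_ac)
    also have "(\<Sum>i\<in>UNIV. G b d i z * (\<Sum>e\<in>UNIV. G a i e z * g c e z)) = (\<Sum>i\<in>UNIV. (\<Sum>e\<in>UNIV. G a e i z * G b d e z) * g c i z)"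
      unfolding sum_distrib_left sum_distrib_right by (subst sum.swap) (simp add: mult_ac)
    finally show ?thesis unfolding X by simp
  qed
  show ?thesis
    using pd_commute[OF S g, of a b c d] unfolding p curv_def sum_subtractf left_diff_distrib distrib_right sum.distrib
    by simp
qed

text \<open>Applying the two symmetries alternately, three times each, returns to the same entry
  with an odd number of sign changes.\<close>

lemma symmetric_skew_zero:
  fixes S :: "'n \<Rightarrow> 'n \<Rightarrow> 'n \<Rightarrow> real"
  assumes "\<And>a b c. S a b c = S b a c" "\<And>a b c. S a b c = - S a c b"
  shows "S a b c = 0"
proof -
  have "S a b c = - S a c b" by (rule assms(2))
  also have "\<dots> = - S c a b" using assms(1) by simp
  also have "\<dots> = S c b a" using assms(2)[of c a b] by simp
  also have "\<dots> = S b c a" by (rule assms(1))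
  also have "\<dots> = - S b a c" by (rule assms(2))
  also have "\<dots> = - S a b c" using assms(1) by simp
  finally show ?thesis by simp
qed

lemma det_nonzero_vector_zero:
  fixes g :: "'n::finite \<Rightarrow> 'n \<Rightarrow> real"
  assumes "det (\<chi> a b. g a b) \<noteq> 0" "\<And>b. (\<Sum>a\<in>UNIV. g b a * v a) = 0"
  shows "v a = 0"
proof -
  have "(\<chi> a b. g a b) *v (\<chi> a. v a) = 0"
    using assms(2) by (simp add: matrix_vector_mult_def vec_eq_iff)
  moreover have "invertible (\<chi> a b. g a b)" using assms(1) by (simp add: invertible_det_nz)
  ultimately have "(\<chi> a. v a) = 0"
    using inj_matrix_vector_mult[of "\<chi> a b. g a b"] by (metis injD matrix_vector_mult_0_right)
  then show ?thesis by (simp add: vec_eq_iff)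
qed

text \<open>The lowered difference of the two families is symmetric in its first two and skew in its
  last two indices. The result is needed because \<open>einstein_metric\<close> asserts the Ricci
  equation for some Levi-Civita connection, which has to be identified with the one in the
  projective class.\<close>

lemma levi_civita_symbols_unique:
  fixes g :: "'n::finite \<Rightarrow> 'n \<Rightarrow> real"
  assumes sym: "\<And>a b. g a b = g b a" and det: "det (\<chi> a b. g a b) \<noteq> 0"
    and G: "\<And>a b i. G a b i = G b a i" "\<And>e a b. dg e a b = (\<Sum>i\<in>UNIV. G e a i * g i b) + (\<Sum>i\<in>UNIV. G e b i * g a i)"
    and H: "\<And>a b i. H a b i = H b a i" "\<And>e a b. dg e a b = (\<Sum>i\<in>UNIV. H e a i * g i b) + (\<Sum>i\<in>UNIV. H e b i * g a i)"
  shows "G a b i = (H a b i :: real)"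
proof -
  define S where "S = (\<lambda>a b c. \<Sum>i\<in>UNIV. g c i * (G a b i - H a b i))"
  have S0: "S a b c = 0" for a b c
  proof (rule symmetric_skew_zero[of S])
    show "S a b c = S b a c" for a b c by (simp add: S_def G(1)[of a b] H(1)[of a b])
    have "S a b c = (\<Sum>i\<in>UNIV. G a b i * g c i) - (\<Sum>i\<in>UNIV. H a b i * g c i)" for a b c
      by (simp add: S_def right_diff_distrib sum_subtractf mult.commute)
    moreover have "(\<Sum>i\<in>UNIV. F i * g c i) = (\<Sum>i\<in>UNIV. F i * g i c)" for F c
      by (intro sum.cong refl arg_cong2[where f = "(*)"] sym)
    ultimately show "S a b c = - S a c b" for a b c
      using G(2)[of a b c] H(2)[of a b c] by simp
  qed
  have "(\<lambda>i. G a b i - H a b i) i = 0"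
    by (rule det_nonzero_vector_zero[OF det]) (use S0 in \<open>simp add: S_def\<close>)
  then show ?thesis by simp
qed

subsection \<open>Algebraic curvature tensors in dimension three\<close>

text \<open>The defining decomposition with \<beta> eliminated, as a predicate on arrays of numbers,
  so that its existence and uniqueness become linear algebra at one point.\<close>

definition weyl_form :: "(3 \<Rightarrow> 3 \<Rightarrow> 3 \<Rightarrow> 3 \<Rightarrow> real) \<Rightarrow> (3 \<Rightarrow> 3 \<Rightarrow> 3 \<Rightarrow> 3 \<Rightarrow> real) \<Rightarrow> bool" where
  "weyl_form R w \<longleftrightarrow> completely_trace_free w \<and>
     (\<exists>P. \<forall>a b i d. R a b i d = w a b i d + (kron a i * P b d - kron b i * P a d) + (P b a - P a b) * kron i d)"

lemma proj_weyl_eq: "proj_weyl M A N D c x = (THE w. weyl_form (riemann M A N D c x) w)"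
proof -
  have "(\<exists>P \<beta>. (\<forall>a b. \<beta> a b = P b a - P a b) \<and>
        (\<forall>a b i d. R a b i d = w a b i d + (kron a i * P b d - kron b i * P a d) + \<beta> a b * kron i d))
     \<longleftrightarrow> (\<exists>P. \<forall>a b i d. R a b i d = w a b i d + (kron a i * P b d - kron b i * P a d) + (P b a - P a b) * kron i d)"
    for R w :: "3 \<Rightarrow> 3 \<Rightarrow> 3 \<Rightarrow> 3 \<Rightarrow> real"
  proof
    assume "\<exists>P. \<forall>a b i d. R a b i d = w a b i d + (kron a i * P b d - kron b i * P a d) + (P b a - P a b) * kron i d"
    then obtain P where "\<forall>a b i d. R a b i d = w a b i d + (kron a i * P b d - kron b i * P a d) + (P b a - P a b) * kron i d" ..
    then show "\<exists>P \<beta>. (\<forall>a b. \<beta> a b = P b a - P a b) \<and>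
        (\<forall>a b i d. R a b i d = w a b i d + (kron a i * P b d - kron b i * P a d) + \<beta> a b * kron i d)"
      by (intro exI[of _ P] exI[of _ "\<lambda>a b. P b a - P a b"]) simp
  qed auto
  then show ?thesis unfolding proj_weyl_def weyl_form_def by simp
qed

lemma schouten_traces:
  fixes P :: "3 \<Rightarrow> 3 \<Rightarrow> real"
  shows "(\<Sum>a\<in>UNIV. (kron a a * P b d - kron b a * P a d) + (P b a - P a b) * kron a d) = 3 * P b d - P d b"
    "(\<Sum>c\<in>UNIV. (kron a c * P b c - kron b c * P a c) + (P b a - P a b) * kron c c) = 4 * (P b a - P a b)"
proof -
  have "(\<Sum>a\<in>UNIV. (kron a a * P b d - kron b a * P a d) + (P b a - P a b) * kron a d)
    = (\<Sum>c\<in>UNIV. kron c (c :: 3)) * P b d - P b d + (P b d - P d b)"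
    by (simp add: sum.distrib sum_subtractf sum_distrib_right)
  then show "(\<Sum>a\<in>UNIV. (kron a a * P b d - kron b a * P a d) + (P b a - P a b) * kron a d) = 3 * P b d - P d b"
    by (simp add: kron_trace)
  have "(\<Sum>c\<in>UNIV. (kron a c * P b c - kron b c * P a c) + (P b a - P a b) * kron c c)
    = P b a - P a b + (P b a - P a b) * (\<Sum>c\<in>UNIV. kron c (c :: 3))"
    by (simp add: sum.distrib sum_subtractf sum_distrib_left)
  then show "(\<Sum>c\<in>UNIV. (kron a c * P b c - kron b c * P a c) + (P b a - P a b) * kron c c) = 4 * (P b a - P a b)"
    by (simp add: kron_trace)
qed

text \<open>Tracing \<open>a\<close> with \<open>i\<close> removes \<open>w\<close> and gives
  \<open>3 * P b d - P d b\<close>. Solving this together with its transpose determines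
  \<open>P\<close>, with denominator 8, and hence \<open>w\<close>.\<close>

lemma weyl_form_unique:
  assumes "weyl_form R w" "weyl_form R w'"
  shows "w = w'"
proof -
  have P: "P b d = (3 * (\<Sum>a\<in>UNIV. R a b a d) + (\<Sum>a\<in>UNIV. R a d a b)) / 8"
    if "completely_trace_free w" "\<And>a b i d. R a b i d = w a b i d + (kron a i * P b d - kron b i * P a d) + (P b a - P a b) * kron i d"
    for w P b d
  proof -
    have "(\<Sum>a\<in>UNIV. R a b a d) = 3 * P b d - P d b" for b d
    proof -
      have "(\<Sum>a\<in>UNIV. R a b a d) = (\<Sum>a\<in>UNIV. w a b a d) + (\<Sum>a\<in>UNIV. (kron a a * P b d - kron b a * P a d) + (P b a - P a b) * kron a d)"
        unfolding that(2) sum.distrib[symmetric] by (simp add: add.assoc)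
      then show ?thesis using that(1) unfolding schouten_traces completely_trace_free_def by simp
    qed
    then show ?thesis by simp
  qed
  from assms(1) obtain P where w: "completely_trace_free w" "\<And>a b i d. R a b i d = w a b i d + (kron a i * P b d - kron b i * P a d) + (P b a - P a b) * kron i d"
    unfolding weyl_form_def by blast
  from assms(2) obtain P' where w': "completely_trace_free w'" "\<And>a b i d. R a b i d = w' a b i d + (kron a i * P' b d - kron b i * P' a d) + (P' b a - P' a b) * kron i d"
    unfolding weyl_form_def by blast
  have "P b d = P' b d" for b d using P[OF w, of b d] P[OF w', of b d] by simp
  then have "w a b i d = w' a b i d" for a b i d using w(2)[of a b i d] w'(2)[of a b i d] by simp
  then show ?thesis by (intro ext)
qed

text \<open>\<open>P\<close> is prescribed by the trace over \<open>a\<close> and \<open>i\<close>.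
  The second trace of \<open>w\<close> follows by skewness; the third one vanishes because the first
  Bianchi identity expresses it by the skew part of the Ricci tensor.\<close>

lemma weyl_form_exists:
  fixes R :: "3 \<Rightarrow> 3 \<Rightarrow> 3 \<Rightarrow> 3 \<Rightarrow> real"
  assumes as: "\<And>a b i d. R a b i d = - R b a i d"
    and bi: "\<And>a b i d. R a b i d + R b d i a + R d a i b = 0"
  shows "\<exists>w. weyl_form R w"
proof -
  define Ric where "Ric = (\<lambda>b d. \<Sum>a\<in>UNIV. R a b a d)"
  define P where "P = (\<lambda>b d. (3 * Ric b d + Ric d b) / 8)"
  define w where "w = (\<lambda>a b i d. R a b i d - ((kron a i * P b d - kron b i * P a d) + (P b a - P a b) * kron i d))"
  have was: "w a b i d = - w b a i d" for a b i d
    using as[of a b i d] by (simp add: w_def algebra_simps)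
  have 1: "(\<Sum>a\<in>UNIV. w a b a d) = 0" for b d
  proof -
    have "(\<Sum>a\<in>UNIV. w a b a d) = Ric b d - (3 * P b d - P d b)"
      unfolding w_def Ric_def sum_subtractf schouten_traces[symmetric] by (simp add: sum_subtractf sum.distrib)
    then show ?thesis by (simp add: P_def field_simps)
  qed
  have 2: "(\<Sum>b\<in>UNIV. w a b b d) = 0" for a d
    using 1[of a d] by (simp add: was[of a] sum_negf)
  have 3: "(\<Sum>c\<in>UNIV. w a b c c) = 0" for a b
  proof -
    have "(\<Sum>c\<in>UNIV. R a b c c + R b c c a + R c a c b) = 0" by (simp add: bi)
    then have "(\<Sum>c\<in>UNIV. R a b c c) = Ric b a - Ric a b"
      by (simp add: Ric_def sum.distrib sum_subtractf as[of b] sum_negf)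
    moreover have "(\<Sum>c\<in>UNIV. w a b c c) = (\<Sum>c\<in>UNIV. R a b c c) - 4 * (P b a - P a b)"
      unfolding w_def sum_subtractf schouten_traces[symmetric] by (simp add: sum_subtractf sum.distrib)
    ultimately show ?thesis by (simp add: P_def field_simps)
  qed
  have "weyl_form R w"
    unfolding weyl_form_def completely_trace_free_def using 1 2 3
    by (auto intro!: exI[of _ P] simp: w_def)
  then show ?thesis by blast
qed

text \<open>Both hypotheses serve existence of the decomposition; the description then denotes it,
  and by uniqueness it is zero exactly if zero is an admissible Weyl part.\<close>

lemma weyl_zero_iff:
  assumes "\<And>a b i d. R a b i d = - R b a i d" "\<And>a b i d. R a b i d + R b d i a + R d a i b = 0"
  shows "(\<forall>a b i d. (THE w. weyl_form R w) a b i d = 0) \<longleftrightarrow>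
     (\<exists>P. \<forall>a b i d. R a b i d = kron a i * P b d - kron b i * P a d + (P b a - P a b) * kron i d)"
proof -
  obtain w where w: "weyl_form R w" using weyl_form_exists[of R] assms by blast
  have T: "(THE w. weyl_form R w) = w" using w weyl_form_unique by (intro the_equality) auto
  have z: "weyl_form R (\<lambda>a b i d. 0) \<longleftrightarrow> (\<exists>P. \<forall>a b i d. R a b i d = kron a i * P b d - kron b i * P a d + (P b a - P a b) * kron i d)"
    by (simp add: weyl_form_def completely_trace_free_def)
  have "(\<forall>a b i d. w a b i d = 0) \<longleftrightarrow> w = (\<lambda>a b i d. 0)" by (auto simp: fun_eq_iff)
  then show ?thesis unfolding T z[symmetric] using w weyl_form_unique by blast
qed

text \<open>Adding \<open>Q\<close> to the Schouten part turns each decomposition of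
  \<open>R\<close> into one of \<open>R'\<close> with the same Weyl part.\<close>

lemma weyl_form_shift:
  assumes "\<And>a b i d. R' a b i d = R a b i d + (kron a i * Q b d - kron b i * Q a d) + (Q b a - Q a b) * kron i d"
  shows "weyl_form R' w \<longleftrightarrow> weyl_form R w"
proof -
  have "(\<exists>P. \<forall>a b i d. R' a b i d = w a b i d + (kron a i * P b d - kron b i * P a d) + (P b a - P a b) * kron i d) \<longleftrightarrow>
     (\<exists>P. \<forall>a b i d. R a b i d = w a b i d + (kron a i * P b d - kron b i * P a d) + (P b a - P a b) * kron i d)" (is "?L \<longleftrightarrow> ?R")
  proof
    assume ?L
    then obtain P where P: "\<And>a b i d. R' a b i d = w a b i d + (kron a i * P b d - kron b i * P a d) + (P b a - P a b) * kron i d" by blast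
    have "R a b i d = w a b i d + (kron a i * (P b d - Q b d) - kron b i * (P a d - Q a d)) + ((P b a - Q b a) - (P a b - Q a b)) * kron i d" for a b i d
      using assms[of a b i d] P[of a b i d] by (simp add: algebra_simps)
    then show ?R by (intro exI[of _ "\<lambda>a b. P a b - Q a b"]) simp
  next
    assume ?R
    then obtain P where P: "\<And>a b i d. R a b i d = w a b i d + (kron a i * P b d - kron b i * P a d) + (P b a - P a b) * kron i d" by blast
    have "R' a b i d = w a b i d + (kron a i * (P b d + Q b d) - kron b i * (P a d + Q a d)) + ((P b a + Q b a) - (P a b + Q a b)) * kron i d" for a b i d
      using assms[of a b i d] P[of a b i d] by (simp add: algebra_simps)
    then show ?L by (intro exI[of _ "\<lambda>a b. P a b + Q a b"]) simp
  qed
  then show ?thesis by (simp add: weyl_form_def)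
qed

text \<open>With \<open>L\<^sub>a\<^sub>b\<^sub>c\<^sub>d = \<epsilon>\<^sub>a\<^sub>b\<^sub>e \<epsilon>\<^sub>c\<^sub>d\<^sub>f G\<^sup>e\<^sup>f\<close> and \<open>E\<^sub>b\<^sub>d = h\<^sup>a\<^sup>c L\<^sub>a\<^sub>b\<^sub>c\<^sub>d\<close> one has
  \<open>det h G\<^sup>e\<^sup>f = h\<^sup>e\<^sup>f (h\<^sup>b\<^sup>m E\<^sub>b\<^sub>m) / 2 - h\<^sup>e\<^sup>d h\<^sup>b\<^sup>f E\<^sub>b\<^sub>d\<close>, the cofactor form of the identity \<open>h adj(h) = det h\<close>.\<close>

lemma double_skew_tracefree_zero:
  fixes h :: "3 \<Rightarrow> 3 \<Rightarrow> real" and L :: "3 \<Rightarrow> 3 \<Rightarrow> 3 \<Rightarrow> 3 \<Rightarrow> real"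
  assumes a1: "\<And>a b c d. L a b c d = - L b a c d" and a2: "\<And>a b c d. L a b c d = - L a b d c"
    and tr: "\<And>b d. (\<Sum>a\<in>UNIV. \<Sum>c\<in>UNIV. h a c * L a b c d) = 0"
    and det: "det (\<chi> a c. h a c) \<noteq> 0"
  shows "L a b c d = 0"
proof -
  have z: "L a a c d = 0" "L a b c c = 0" for a b c d
    using a1[of a a c d] a2[of a b c c] by auto
  have sw: "L 2 1 c d = - L 1 2 c d" "L 3 2 c d = - L 2 3 c d" "L 1 3 c d = - L 3 1 c d"
    "L c d 2 1 = - L c d 1 2" "L c d 3 2 = - L c d 2 3" "L c d 1 3 = - L c d 3 1" for c d
    using a1[of 2 1 c d] a1[of 3 2 c d] a1[of 1 3 c d] a2[of c d 2 1] a2[of c d 3 2] a2[of c d 1 3] by auto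
  define E where "E = (\<lambda>b d. \<Sum>a\<in>UNIV. \<Sum>c\<in>UNIV. h a c * L a b c d)"
  have E0: "E b d = 0" for b d by (simp add: E_def tr)
  define S where "S = (\<lambda>e f. h e f * (\<Sum>b\<in>UNIV. \<Sum>m\<in>UNIV. h b m * E b m) - 2 * (\<Sum>d\<in>UNIV. \<Sum>b\<in>UNIV. h e d * h b f * E b d))"
  have S0: "S e f = 0" for e f by (simp add: S_def E0)
  \<comment> \<open>The pairs \<open>2 3\<close>, \<open>3 1\<close>, \<open>1 2\<close> stand for
    the values 1, 2, 3 of the index dual to a skew pair, so these entries of \<open>L\<close> form
    the full 3 by 3 matrix. \<open>S\<close> is doubled to avoid the fraction.\<close>
  have id: "2 * (det (\<chi> a c. h a c) * L 2 3 2 3) = S 1 1" "2 * (det (\<chi> a c. h a c) * L 2 3 3 1) = S 1 2"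
    "2 * (det (\<chi> a c. h a c) * L 2 3 1 2) = S 1 3" "2 * (det (\<chi> a c. h a c) * L 3 1 2 3) = S 2 1"
    "2 * (det (\<chi> a c. h a c) * L 3 1 3 1) = S 2 2" "2 * (det (\<chi> a c. h a c) * L 3 1 1 2) = S 2 3"
    "2 * (det (\<chi> a c. h a c) * L 1 2 2 3) = S 3 1" "2 * (det (\<chi> a c. h a c) * L 1 2 3 1) = S 3 2"
    "2 * (det (\<chi> a c. h a c) * L 1 2 1 2) = S 3 3"
    unfolding S_def E_def sum_3 det_3 by (simp_all add: z sw algebra_simps)
  have "L 2 3 2 3 = 0" "L 2 3 3 1 = 0" "L 2 3 1 2 = 0" "L 3 1 2 3 = 0" "L 3 1 3 1 = 0" "L 3 1 1 2 = 0"
    "L 1 2 2 3 = 0" "L 1 2 3 1 = 0" "L 1 2 1 2 = 0"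
    using id det by (simp_all add: S0)
  then have "\<forall>a b c d. L a b c d = 0" unfolding forall_3 by (simp add: z sw)
  then show ?thesis by blast
qed

lemma einstein_imp_weyl_zero:
  fixes R :: "3 \<Rightarrow> 3 \<Rightarrow> 3 \<Rightarrow> 3 \<Rightarrow> real" and g :: "3 \<Rightarrow> 3 \<Rightarrow> real"
  assumes as: "\<And>a b i d. R a b i d = - R b a i d"
    and skew: "\<And>a b c d. (\<Sum>i\<in>UNIV. R a b i c * g i d) + (\<Sum>i\<in>UNIV. R a b i d * g c i) = 0"
    and sym: "\<And>a b. g a b = g b a" and det: "det (\<chi> a b. g a b) \<noteq> 0"
    and ric: "\<And>b d. (\<Sum>a\<in>UNIV. R a b a d) = K * g b d"
  shows "\<exists>P. \<forall>a b i d. R a b i d = kron a i * P b d - kron b i * P a d + (P b a - P a b) * kron i d"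
proof -
  \<comment> \<open>The constant curvature part built from a symmetric \<open>P\<close> has Ricci
    tensor \<open>2 * P\<close>, hence the factor \<open>K / 2\<close>.\<close>
  define P where "P = (\<lambda>a b. K / 2 * g a b)"
  define T where "T = (\<lambda>a b i d. R a b i d - (kron a i * P b d - kron b i * P a d))"
  have Psym: "P a b = P b a" for a b by (simp add: P_def sym[of a b])
  define gm where "gm = (\<chi> a b. g a b)"
  obtain hm where hm: "gm ** hm = mat 1" "hm ** gm = mat 1"
    using det unfolding gm_def invertible_det_nz[symmetric] invertible_def by blast
  define h where "h = (\<lambda>a b. hm $ a $ b)"
  have hg: "(\<Sum>c\<in>UNIV. h i c * g c j) = kron i j" for i j
    using hm(2) unfolding vec_eq_iff matrix_matrix_mult_def mat_def gm_def h_def kron_def by simp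
  have deth: "det (\<chi> a b. h a b) \<noteq> 0"
    using det_mul[of hm gm] hm(2) by (auto simp: h_def)
  \<comment> \<open>Lowering the upper index into the third slot turns metric skewness into skewness
    in \<open>c\<close> and \<open>d\<close>, and the Ricci contraction into the
    \<open>h\<close>-trace over \<open>a\<close> and \<open>c\<close>. \<open>TL\<close> raises the
    index again.\<close>
  define L where "L = (\<lambda>a b c d. \<Sum>i\<in>UNIV. T a b i d * g i c)"
  have TL: "T a b i d = (\<Sum>c\<in>UNIV. h i c * L a b c d)" for a b i d
  proof -
    have "(\<Sum>c\<in>UNIV. h i c * L a b c d) = (\<Sum>j\<in>UNIV. (\<Sum>c\<in>UNIV. h i c * g c j) * T a b j d)"
      unfolding L_def sum_distrib_left sum_distrib_right
      by (subst sum.swap) (simp add: mult_ac sym)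
    then show ?thesis by (simp add: hg)
  qed
  have LR: "L a b c d = (\<Sum>i\<in>UNIV. R a b i d * g i c) - (g a c * P b d - g b c * P a d)" for a b c d
    unfolding L_def T_def left_diff_distrib sum_subtractf mult.assoc
    by (simp add: mult.assoc kron_sum(1)[of a "\<lambda>i. P b d * g i c"] kron_sum(1)[of b "\<lambda>i. P a d * g i c"] mult.commute)
  have "L a b c d = 0" for a b c d
  proof (rule double_skew_tracefree_zero[OF _ _ _ deth])
    show "L a b c d = - L b a c d" for a b c d
      unfolding LR as[of a] by (simp add: sum_negf)
    show "L a b c d = - L a b d c" for a b c d
    proof -
      have "(\<Sum>i\<in>UNIV. R a b i c * g d i) = (\<Sum>i\<in>UNIV. R a b i c * g i d)"
        by (intro sum.cong refl arg_cong2[where f = "(*)"] sym)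
      then show ?thesis
        using skew[of a b d c] unfolding LR P_def by (simp add: algebra_simps)
    qed
    show "(\<Sum>a\<in>UNIV. \<Sum>c\<in>UNIV. h a c * L a b c d) = 0" for b d
    proof -
      have "(\<Sum>a\<in>UNIV. T a b a d) = (\<Sum>a\<in>UNIV. R a b a d) - ((\<Sum>a\<in>UNIV. kron a (a::3)) * P b d - P b d)"
        unfolding T_def sum_subtractf by (simp add: sum_distrib_right)
      then show ?thesis by (simp add: TL[symmetric] ric kron_trace P_def)
    qed
  qed
  then have "T a b i d = 0" for a b i d by (simp add: TL)
  then show ?thesis by (intro exI[of _ P]) (simp add: T_def Psym)
qed

subsection \<open>Calculus on manifolds\<close>

definition pull :: "('m, 'n::finite) chart \<Rightarrow> ('m \<Rightarrow> 'b) \<Rightarrow> real ^ 'n \<Rightarrow> 'b" where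
  "pull c f = (\<lambda>z. f (inv_into (fst c) (snd c) z))"

definition img :: "('m, 'n::finite) chart \<Rightarrow> 'm set \<Rightarrow> (real ^ 'n) set" where
  "img c U = snd c ` (U \<inter> fst c)"

definition smooth_in :: "('m, 'n::finite) chart \<Rightarrow> 'm set \<Rightarrow> ('m \<Rightarrow> real) \<Rightarrow> bool" where
  "smooth_in c U f \<longleftrightarrow> smooth_on (img c U) (pull c f)"

lemma pderiv_in_eq: "pderiv_in c i f x = pd i (pull c f) (snd c x)"
  by (simp add: pderiv_in_def pd_def pull_def o_def)

lemma smooth_components_iff: "smooth_components A U F \<longleftrightarrow> (\<forall>c\<in>A. smooth_in c U (F c))"
  by (simp add: smooth_components_def smooth_in_def img_def pull_def o_def)

lemma smooth_fun_iff: "smooth_fun A U f \<longleftrightarrow> (\<forall>c\<in>A. smooth_in c U f)"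
  by (simp add: smooth_fun_def smooth_in_def img_def pull_def o_def)

lemma img_memI:
  fixes c :: "('m, 'n::finite) chart"
  shows "x \<in> U \<Longrightarrow> x \<in> fst c \<Longrightarrow> snd c x \<in> img c U"
  by (auto simp: img_def)

lemma img_mono: "U \<subseteq> V \<Longrightarrow> img c U \<subseteq> img c V"
  by (auto simp: img_def)

lemma smooth_in_subset: "smooth_in c V f \<Longrightarrow> U \<inter> fst c \<subseteq> V \<Longrightarrow> smooth_in c U f"
  unfolding smooth_in_def by (erule smooth_on_subset) (auto simp: img_def)

text \<open>Chart independence of the pairing of a vector with a covector: \<open>p\<close> and
  \<open>q\<close> are the mutually inverse Jacobian matrices of a change of chart.\<close>

lemma contract_dual:
  fixes p q :: "'n::finite \<Rightarrow> 'n \<Rightarrow> real"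
  assumes "\<And>i j. (\<Sum>a\<in>UNIV. p i a * q a j) = kron i j"
  shows "(\<Sum>a\<in>UNIV. (\<Sum>j\<in>UNIV. q a j * y j) * (\<Sum>i\<in>UNIV. p i a * t i)) = (\<Sum>i\<in>UNIV. y i * t i)"
proof -
  have "(\<Sum>a\<in>UNIV. p i a * (\<Sum>j\<in>UNIV. q a j * y j)) = y i" for i
  proof -
    have "(\<Sum>a\<in>UNIV. p i a * (\<Sum>j\<in>UNIV. q a j * y j)) = (\<Sum>j\<in>UNIV. (\<Sum>a\<in>UNIV. p i a * q a j) * y j)"
      unfolding sum_distrib_left sum_distrib_right by (subst sum.swap) (simp add: mult.assoc)
    then show ?thesis by (simp add: assms)
  qed
  moreover have "(\<Sum>a\<in>UNIV. X a * (\<Sum>i\<in>UNIV. p i a * t i)) = (\<Sum>i\<in>UNIV. (\<Sum>a\<in>UNIV. p i a * X a) * t i)" for X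
    unfolding sum_distrib_left sum_distrib_right by (subst sum.swap) (simp add: mult_ac)
  ultimately show ?thesis by simp
qed

locale smooth_mfd =
  fixes M :: "'m topology" and A :: "('m, 'n::finite) chart set"
  assumes smooth_manifold: "smooth_manifold M A"
begin

lemma chart_open: "c \<in> A \<Longrightarrow> openin M (fst c)"
  using smooth_manifold by (force simp: smooth_manifold_def)

lemma chart_homeo: "c \<in> A \<Longrightarrow> homeomorphic_map (subtopology M (fst c)) (top_of_set (snd c ` fst c)) (snd c)"
  using smooth_manifold by (force simp: smooth_manifold_def)

lemma chart_image_open: "c \<in> A \<Longrightarrow> open (snd c ` fst c)"
  using smooth_manifold by (force simp: smooth_manifold_def)

lemma chart_subset: "c \<in> A \<Longrightarrow> fst c \<subseteq> topspace M"
  using chart_open openin_subset by blast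

lemma chart_inj: "c \<in> A \<Longrightarrow> inj_on (snd c) (fst c)"
  using homeomorphic_imp_injective_map[OF chart_homeo, of c] chart_subset[of c]
  by (simp add: Int_absorb1)

lemma inv_chart [simp]: "c \<in> A \<Longrightarrow> x \<in> fst c \<Longrightarrow> inv_into (fst c) (snd c) (snd c x) = x"
  using chart_inj by (rule inv_into_f_f)

lemma pull_at [simp]: "c \<in> A \<Longrightarrow> x \<in> fst c \<Longrightarrow> pull c f (snd c x) = f x"
  by (simp add: pull_def)

lemma open_img:
  assumes "c \<in> A" "openin M U"
  shows "open (img c U)"
proof -
  have "open_map (subtopology M (fst c)) (top_of_set (snd c ` fst c)) (snd c)"
    using chart_homeo[OF assms(1)] homeomorphic_imp_open_map by blast
  moreover have "openin (subtopology M (fst c)) (U \<inter> fst c)"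
    using assms(2) by (auto simp: openin_subtopology)
  ultimately have "openin (top_of_set (snd c ` fst c)) (img c U)"
    unfolding open_map_def img_def by blast
  then show ?thesis using chart_image_open[OF assms(1)] openin_open_eq by blast
qed

lemma openin_chart_preimage:
  assumes "c \<in> A" "open W"
  shows "openin M {x \<in> fst c. snd c x \<in> W}"
proof -
  have "continuous_map (subtopology M (fst c)) (top_of_set (snd c ` fst c)) (snd c)"
    using chart_homeo[OF assms(1)] homeomorphic_imp_continuous_map by blast
  moreover have "openin (top_of_set (snd c ` fst c)) (snd c ` fst c \<inter> W)"
    using assms(2) by (auto simp: openin_open)
  ultimately have "openin (subtopology M (fst c)) {x \<in> topspace (subtopology M (fst c)). snd c x \<in> snd c ` fst c \<inter> W}"
    unfolding continuous_map_def by blast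
  moreover have "{x \<in> topspace (subtopology M (fst c)). snd c x \<in> snd c ` fst c \<inter> W} = {x \<in> fst c. snd c x \<in> W}"
    using chart_subset[OF assms(1)] by auto
  ultimately show ?thesis using chart_open[OF assms(1)] openin_trans_full by metis
qed

lemma pderiv_cong:
  assumes "c \<in> A" "openin M U" "x \<in> U" "x \<in> fst c" "\<And>y. y \<in> U \<Longrightarrow> y \<in> fst c \<Longrightarrow> f y = g y"
  shows "pderiv_in c i f x = pderiv_in c i g x"
  unfolding pderiv_in_eq
  by (rule pd_cong_open[OF open_img[OF assms(1,2)] img_memI[OF assms(3,4)]]) (use assms in \<open>auto simp: img_def\<close>)

lemma smooth_in_differentiable: "smooth_in c U f \<Longrightarrow> x \<in> U \<Longrightarrow> x \<in> fst c \<Longrightarrow> pull c f differentiable (at (snd c x))"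
  unfolding smooth_in_def by (erule smooth_on_differentiable) (rule img_memI)

lemma smooth_in_const: "smooth_in c U (\<lambda>x. k)"
  by (simp add: smooth_in_def pull_def smooth_on_const)

lemma smooth_in_add: "c \<in> A \<Longrightarrow> openin M U \<Longrightarrow> smooth_in c U f \<Longrightarrow> smooth_in c U g \<Longrightarrow> smooth_in c U (\<lambda>x. f x + g x)"
  unfolding smooth_in_def pull_def by (intro smooth_on_add open_img)

lemma smooth_in_mult: "c \<in> A \<Longrightarrow> openin M U \<Longrightarrow> smooth_in c U f \<Longrightarrow> smooth_in c U g \<Longrightarrow> smooth_in c U (\<lambda>x. f x * g x)"
  unfolding smooth_in_def pull_def by (intro smooth_on_mult open_img)

lemma smooth_in_sum: "c \<in> A \<Longrightarrow> openin M U \<Longrightarrow> (\<And>j. j \<in> J \<Longrightarrow> smooth_in c U (f j)) \<Longrightarrow> smooth_in c U (\<lambda>x. \<Sum>j\<in>J. f j x)"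
  unfolding smooth_in_def pull_def by (intro smooth_on_sum open_img)

lemma pderiv_const [simp]: "pderiv_in c i (\<lambda>x. k) x = 0"
  by (simp add: pderiv_in_eq pull_def)

lemma pderiv_mult:
  assumes "smooth_in c U f" "smooth_in c U g" "x \<in> U" "x \<in> fst c" "c \<in> A"
  shows "pderiv_in c i (\<lambda>x. f x * g x) x = pderiv_in c i f x * g x + f x * pderiv_in c i g x"
  using pd_mult[OF smooth_in_differentiable[OF assms(1,3,4)] smooth_in_differentiable[OF assms(2,3,4)], of i]
    pull_at[OF assms(5,4), of f] pull_at[OF assms(5,4), of g]
  by (simp add: pderiv_in_eq pull_def)

lemma pderiv_sum:
  assumes "\<And>j. j \<in> J \<Longrightarrow> smooth_in c U (f j)" "x \<in> U" "x \<in> fst c"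
  shows "pderiv_in c i (\<lambda>x. \<Sum>j\<in>J. f j x) x = (\<Sum>j\<in>J. pderiv_in c i (f j) x)"
  using pd_sum[of J "\<lambda>j. pull c (f j)" "snd c x" i] smooth_in_differentiable[OF assms(1-3)]
  by (simp add: pderiv_in_eq pull_def)

lemma smooth_in_pderiv:
  assumes "c \<in> A" "openin M U" "smooth_in c U f"
  shows "smooth_in c U (pderiv_in c i f)"
proof -
  have "pull c (pderiv_in c i f) z = pd i (pull c f) z" if "z \<in> img c U" for z
    using that assms(1) by (auto simp: img_def pderiv_in_eq)
  then show ?thesis
    using smooth_on_cong[OF open_img[OF assms(1,2)], of "pull c (pderiv_in c i f)" "pd i (pull c f)"]
      smooth_on_pd[OF assms(3)[unfolded smooth_in_def]] unfolding smooth_in_def by blast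
qed

lemma transition_smooth:
  assumes "c \<in> A" "d \<in> A"
  shows "smooth_on (img c (fst d)) (\<lambda>z. snd d (inv_into (fst c) (snd c) z) $ i)"
proof -
  have "\<forall>c\<in>A. \<forall>d\<in>A. \<forall>i. smooth_on (snd c ` (fst c \<inter> fst d)) (\<lambda>z. snd d (inv_into (fst c) (snd c) z) $ i)"
    using smooth_manifold unfolding smooth_manifold_def case_prod_beta by (elim conjE)
  then show ?thesis using assms unfolding img_def Int_commute[of "fst d"] by blast
qed

lemma smooth_in_coord: "c \<in> A \<Longrightarrow> d \<in> A \<Longrightarrow> smooth_in c (fst d) (\<lambda>y. snd d y $ i)"
  unfolding smooth_in_def pull_def by (rule transition_smooth)

lemma pull_change:
  assumes "c \<in> A" "d \<in> A" "z \<in> img c (fst d)"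
  shows "pull c f z = pull d f (snd d (inv_into (fst c) (snd c) z))"
  using assms by (auto simp: img_def pull_def)

lemma smooth_in_change:
  assumes c: "c \<in> A" and d: "d \<in> A" and U: "openin M U" and f: "smooth_in d U f"
  shows "smooth_in c (U \<inter> fst d) f"
proof -
  let ?\<tau> = "\<lambda>z. snd d (inv_into (fst c) (snd c) z)"
  have o: "open (img c (U \<inter> fst d))" using open_img[OF c openin_Int[OF U chart_open[OF d]]] .
  have "smooth_on (img c (U \<inter> fst d)) (\<lambda>z. pull d f (?\<tau> z))"
  proof (rule smooth_on_compose[OF o])
    show "smooth_on (img c (U \<inter> fst d)) (\<lambda>z. ?\<tau> z $ j)" for j
      by (rule smooth_on_subset[OF transition_smooth[OF c d]]) (auto simp: img_def)
    show "?\<tau> ` img c (U \<inter> fst d) \<subseteq> img d U" using c by (auto simp: img_def)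
    show "smooth_on (img d U) (pull d f)" using f by (simp add: smooth_in_def)
  qed
  moreover have "pull c f z = pull d f (?\<tau> z)" if "z \<in> img c (U \<inter> fst d)" for z
    by (rule pull_change[OF c d]) (use that in \<open>auto simp: img_def\<close>)
  ultimately show ?thesis
    unfolding smooth_in_def using smooth_on_cong[OF o, of "pull c f" "\<lambda>z. pull d f (?\<tau> z)"] by simp
qed

lemma smooth_fun_from_chart:
  assumes "d \<in> A" "openin M U" "U \<subseteq> fst d" "smooth_in d U f"
  shows "smooth_fun A U f"
  unfolding smooth_fun_iff using smooth_in_change[OF _ assms(1,2,4)] assms(3) by (simp add: Int_absorb2)

lemma pderiv_chain:
  assumes c: "c \<in> A" and d: "d \<in> A" and x: "x \<in> fst c" "x \<in> fst d" "x \<in> U" and f: "smooth_in d U f"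
  shows "pderiv_in c a f x = (\<Sum>i\<in>UNIV. jac c d i a x * pderiv_in d i f x)"
proof -
  let ?\<tau> = "\<lambda>z. snd d (inv_into (fst c) (snd c) z)"
  have o: "open (img c (fst d))" using open_img[OF c chart_open[OF d]] .
  have xi: "snd c x \<in> img c (fst d)" using x by (simp add: img_memI)
  have \<tau>x: "?\<tau> (snd c x) = snd d x" using c x by simp
  have "pd a (pull c f) (snd c x) = pd a (\<lambda>z. pull d f (?\<tau> z)) (snd c x)"
    by (rule pd_cong_open[OF o xi]) (rule pull_change[OF c d])
  also have "\<dots> = (\<Sum>j\<in>UNIV. pd a (\<lambda>z. ?\<tau> z $ j) (snd c x) * pd j (pull d f) (?\<tau> (snd c x)))"
  proof (rule pd_compose)
    show "(\<lambda>z. ?\<tau> z $ j) differentiable (at (snd c x))" for j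
      by (rule smooth_on_differentiable[OF transition_smooth[OF c d] xi])
    show "pull d f differentiable (at (?\<tau> (snd c x)))"
      unfolding \<tau>x by (rule smooth_in_differentiable[OF f x(3,2)])
  qed
  finally show ?thesis unfolding \<tau>x by (simp add: jac_def pderiv_in_eq pull_def)
qed

lemma jac_refl:
  assumes c: "c \<in> A" "x \<in> fst c"
  shows "jac c c i j x = kron i j"
proof -
  have "pd j (pull c (\<lambda>y. snd c y $ i)) (snd c x) = pd j (\<lambda>z. z $ i) (snd c x)"
    by (rule pd_cong_open[OF open_img[OF c(1) chart_open[OF c(1)]] img_memI[OF c(2,2)]])
      (use c(1) in \<open>auto simp: img_def\<close>)
  then show ?thesis by (simp add: jac_def pderiv_in_eq pd_coord kron_commute)
qed

lemma jac_trans: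
  assumes "c \<in> A" "d \<in> A" "e \<in> A" "x \<in> fst c" "x \<in> fst d" "x \<in> fst e"
  shows "jac c e i a x = (\<Sum>j\<in>UNIV. jac c d j a x * jac d e i j x)"
  unfolding jac_def[of c e] jac_def[of d e]
  by (rule pderiv_chain[OF assms(1,2,4,5,6) smooth_in_coord[OF assms(2,3)]])

lemma jac_inverse:
  assumes "c \<in> A" "d \<in> A" "x \<in> fst c" "x \<in> fst d"
  shows "(\<Sum>a\<in>UNIV. jac d c i a x * jac c d a j x) = kron i j"
  using jac_trans[OF assms(1,2,1,3,4,3), of i j] jac_refl[OF assms(1,3), of i j] by (simp add: mult.commute)

lemma smooth_in_jac:
  assumes "c \<in> A" "d \<in> A"
  shows "smooth_in c (fst d) (jac c d i j)" "smooth_in c (fst d) (jac d c i j)"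
proof -
  have *: "smooth_in c (fst d) (jac c d i j)" if "c \<in> A" "d \<in> A" for c d
    unfolding jac_def[abs_def] by (rule smooth_in_pderiv[OF that(1) chart_open[OF that(2)] smooth_in_coord[OF that]])
  show "smooth_in c (fst d) (jac c d i j)" by (rule *[OF assms])
  have "smooth_in c (fst c \<inter> fst d) (jac d c i j)"
    by (rule smooth_in_change[OF assms chart_open[OF assms(1)] *[OF assms(2,1)]])
  then show "smooth_in c (fst d) (jac d c i j)" by (rule smooth_in_subset) auto
qed

lemma vector_field_iff:
  "vector_field A U Y \<longleftrightarrow> (\<forall>c\<in>A. \<forall>b. smooth_in c U (Y c b)) \<and>
     (\<forall>c\<in>A. \<forall>d\<in>A. \<forall>x\<in>U \<inter> fst c \<inter> fst d. \<forall>b. Y d b x = (\<Sum>j\<in>UNIV. jac c d b j x * Y c j x))"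
  unfolding vector_field_def smooth_components_iff by blast

lemma vf_smooth: "vector_field A U Y \<Longrightarrow> c \<in> A \<Longrightarrow> smooth_in c U (Y c b)"
  by (simp add: vector_field_iff)

lemma vf_trans: "vector_field A U Y \<Longrightarrow> c \<in> A \<Longrightarrow> d \<in> A \<Longrightarrow> x \<in> U \<Longrightarrow> x \<in> fst c \<Longrightarrow> x \<in> fst d \<Longrightarrow>
   Y d b x = (\<Sum>j\<in>UNIV. jac c d b j x * Y c j x)"
  by (simp add: vector_field_iff)

lemma vf_zero: "vector_field A U (\<lambda>c b x. 0)"
  by (simp add: vector_field_iff smooth_in_const)

lemma vf_add: "openin M U \<Longrightarrow> vector_field A U Y \<Longrightarrow> vector_field A U Z \<Longrightarrow> vector_field A U (\<lambda>c b x. Y c b x + Z c b x)"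
  unfolding vector_field_iff[of U "\<lambda>c b x. Y c b x + Z c b x"]
proof (intro conjI ballI allI)
  fix c d x b assume U: "openin M U" and Y: "vector_field A U Y" and Z: "vector_field A U Z"
    and c: "c \<in> A" and d: "d \<in> A" and x: "x \<in> U \<inter> fst c \<inter> fst d"
  show "Y d b x + Z d b x = (\<Sum>j\<in>UNIV. jac c d b j x * (Y c j x + Z c j x))"
    using vf_trans[OF Y c d, of x b] vf_trans[OF Z c d, of x b] x by (simp only: Int_iff sum.distrib distrib_left)
qed (intro smooth_in_add vf_smooth)

lemma vf_scale: "openin M U \<Longrightarrow> smooth_fun A U f \<Longrightarrow> vector_field A U Y \<Longrightarrow> vector_field A U (\<lambda>c b x. f x * Y c b x)"
  unfolding vector_field_iff[of U "\<lambda>c b x. f x * Y c b x"]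
proof (intro conjI ballI allI)
  fix c d x b assume U: "openin M U" and Y: "vector_field A U Y"
    and c: "c \<in> A" and d: "d \<in> A" and x: "x \<in> U \<inter> fst c \<inter> fst d"
  show "f x * Y d b x = (\<Sum>j\<in>UNIV. jac c d b j x * (f x * Y c j x))"
    using vf_trans[OF Y c d, of x b] x by (simp only: Int_iff sum_distrib_left mult.left_commute)
next
  fix c b assume "openin M U" "smooth_fun A U f" "vector_field A U Y" "c \<in> A"
  then show "smooth_in c U (\<lambda>x. f x * Y c b x)"
    by (simp add: smooth_in_mult smooth_fun_iff vf_smooth)
qed

lemma vf_sum:
  assumes "openin M U" "\<And>d. d \<in> F \<Longrightarrow> smooth_fun A U (f d)" "\<And>d. d \<in> F \<Longrightarrow> vector_field A U (E d)"
  shows "vector_field A U (\<lambda>c b x. \<Sum>d\<in>F. f d x * E d c b x)"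
  using assms(2,3)
  by (induction F rule: infinite_finite_induct) (auto intro!: vf_zero vf_add vf_scale assms(1))

text \<open>The coordinate field \<open>\<partial>\<^sub>b\<close> of \<open>c\<close>, written in
  every chart as a column of the Jacobian matrix, so that it can be inserted into connections, which
  act on fields known in all charts.\<close>

definition coord_field :: "('m, 'n) chart \<Rightarrow> 'n \<Rightarrow> ('m, 'n) field1" where
  "coord_field c b = (\<lambda>d i x. jac c d i b x)"

lemma coord_field_self: "c \<in> A \<Longrightarrow> x \<in> fst c \<Longrightarrow> coord_field c b c i x = kron i b"
  by (simp add: coord_field_def jac_refl)

lemma vf_coord_field:
  assumes c: "c \<in> A" and U: "U \<subseteq> fst c"
  shows "vector_field A U (coord_field c b)"
  unfolding vector_field_iff coord_field_def
proof (intro conjI ballI allI)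
  fix d i assume "d \<in> A"
  then show "smooth_in d U (jac c d i b)"
    using smooth_in_jac(2)[of d c] c U by (blast intro: smooth_in_subset)
next
  fix d e x i assume "d \<in> A" "e \<in> A" "x \<in> U \<inter> fst d \<inter> fst e"
  then show "jac c e i b x = (\<Sum>j\<in>UNIV. jac d e i j x * jac c d j b x)"
    using jac_trans[of c d e x i b] c U by (auto simp: mult.commute)
qed

text \<open>In the chart \<open>c\<close>, the Christoffel symbol \<open>\<Gamma>\<^sub>a\<^sub>d\<^sup>i\<close> is the component of \<open>\<nabla>\<^sub>a \<partial>\<^sub>d\<close>.\<close>

definition christ :: "('m, 'n) connection \<Rightarrow> 'm set \<Rightarrow> ('m, 'n) chart \<Rightarrow> 'n \<Rightarrow> 'n \<Rightarrow> 'n \<Rightarrow> 'm \<Rightarrow> real" where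
  "christ D N c a d i = D (N \<inter> fst c) (coord_field c d) c a i"

lemma conn_tensor: "affine_connection M A N D \<Longrightarrow> openin M U \<Longrightarrow> U \<subseteq> N \<Longrightarrow> vector_field A U Y \<Longrightarrow> tensor_field_11 A U (D U Y)"
  unfolding affine_connection_def by blast

lemma conn_smooth: "affine_connection M A N D \<Longrightarrow> openin M U \<Longrightarrow> U \<subseteq> N \<Longrightarrow> vector_field A U Y \<Longrightarrow> c \<in> A \<Longrightarrow> smooth_in c U (D U Y c a b)"
  using conn_tensor unfolding tensor_field_11_def smooth_components_iff by blast

lemma conn_trans:
  assumes "affine_connection M A N D" "openin M U" "U \<subseteq> N" "vector_field A U Y"
    and "c \<in> A" "d \<in> A" and x: "x \<in> U" "x \<in> fst c" "x \<in> fst d"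
  shows "D U Y d a b x = (\<Sum>i\<in>UNIV. \<Sum>j\<in>UNIV. jac d c i a x * jac c d b j x * D U Y c i j x)"
proof -
  have "x \<in> U \<inter> fst c \<inter> fst d" using x by simp
  from conn_tensor[OF assms(1-4), unfolded tensor_field_11_def, THEN conjunct2, rule_format, OF assms(5,6) this]
  show ?thesis .
qed

lemma conn_add:
  assumes "affine_connection M A N D" "openin M U" "U \<subseteq> N" "vector_field A U Y" "vector_field A U Z"
    and "c \<in> A" and x: "x \<in> U" "x \<in> fst c"
  shows "D U (\<lambda>c b x. Y c b x + Z c b x) c a b x = D U Y c a b x + D U Z c a b x"
proof -
  have "x \<in> U \<inter> fst c" using x by simp
  from assms(1)[unfolded affine_connection_def, rule_format, OF assms(2-4), THEN conjunct2, THEN conjunct1,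
      rule_format, OF assms(5,6) this]
  show ?thesis .
qed

lemma conn_leibniz:
  assumes "affine_connection M A N D" "openin M U" "U \<subseteq> N" "vector_field A U Y" "smooth_fun A U f"
    and "c \<in> A" and x: "x \<in> U" "x \<in> fst c"
  shows "D U (\<lambda>c b x. f x * Y c b x) c a b x = pderiv_in c a f x * Y c b x + f x * D U Y c a b x"
proof -
  have "x \<in> U \<inter> fst c" using x by simp
  from assms(1)[unfolded affine_connection_def, rule_format, OF assms(2-4), THEN conjunct2, THEN conjunct2, THEN conjunct1,
      rule_format, OF assms(5,6) this]
  show ?thesis .
qed

lemma conn_restrict:
  assumes "affine_connection M A N D" "openin M U" "U \<subseteq> N" "vector_field A U Y"
    and "openin M V" "V \<subseteq> U" "vector_field A V Z"
    and eq: "\<And>c x b. c \<in> A \<Longrightarrow> x \<in> V \<Longrightarrow> x \<in> fst c \<Longrightarrow> Z c b x = Y c b x"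
    and "c \<in> A" and x: "x \<in> V" "x \<in> fst c"
  shows "D V Z c a b x = D U Y c a b x"
proof -
  have *: "Z c b x = Y c b x" if "c \<in> A" "x \<in> V \<inter> fst c" for c x b using eq that by blast
  have "x \<in> V \<inter> fst c" using x by simp
  from assms(1)[unfolded affine_connection_def, rule_format, OF assms(2-4), THEN conjunct2, THEN conjunct2, THEN conjunct2,
      rule_format, OF assms(5-7) * assms(9) this]
  show ?thesis by simp
qed

lemma affine_connection_subset: "affine_connection M A N D \<Longrightarrow> N' \<subseteq> N \<Longrightarrow> affine_connection M A N' D"
  unfolding affine_connection_def by (meson order_trans)

lemma torsion_free_subset: "torsion_free M A N D \<Longrightarrow> N' \<subseteq> N \<Longrightarrow> torsion_free M A N' D"
  unfolding torsion_free_def by (meson order_trans)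

lemma conn_sum:
  assumes D: "affine_connection M A N D" and U: "openin M U" "U \<subseteq> N" and c: "c \<in> A" "x \<in> U" "x \<in> fst c"
    and f: "\<And>d. smooth_fun A U (f d)" and E: "\<And>d. vector_field A U (E d)" and F: "finite F"
  shows "D U (\<lambda>c b x. \<Sum>d\<in>F. f d x * E d c b x) c a b x
    = (\<Sum>d\<in>F. pderiv_in c a (f d) x * E d c b x + f d x * D U (E d) c a b x)"
  using F
proof (induction F rule: finite_induct)
  case empty
  have "smooth_fun A U (\<lambda>x. 0)" by (simp add: smooth_fun_iff smooth_in_const)
  from conn_leibniz[where f = "\<lambda>x. 0" and Y = "\<lambda>c b x. 0", OF D U vf_zero this c] show ?case by simp
next
  case (insert e F)
  have "D U (\<lambda>c b x. f e x * E e c b x + (\<Sum>d\<in>F. f d x * E d c b x)) c a b x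
     = D U (\<lambda>c b x. f e x * E e c b x) c a b x + D U (\<lambda>c b x. \<Sum>d\<in>F. f d x * E d c b x) c a b x"
    by (rule conn_add[where Y = "\<lambda>c b x. f e x * E e c b x" and Z = "\<lambda>c b x. \<Sum>d\<in>F. f d x * E d c b x",
          OF D U vf_scale[OF U(1) f E] vf_sum[OF U(1) f E] c])
  also have "D U (\<lambda>c b x. f e x * E e c b x) c a b x = pderiv_in c a (f e) x * E e c b x + f e x * D U (E e) c a b x"
    by (rule conn_leibniz[OF D U E f c])
  finally show ?case using insert by simp
qed

text \<open>On \<open>U \<inter> fst c\<close> every field is a combination of coordinate fields
  with smooth coefficients, and the Leibniz rule applies. Compatibility with restriction does the
  work usually done by cut-off functions.\<close>

lemma conn_local:
  assumes D: "affine_connection M A N D" and N: "openin M N" and U: "openin M U" "U \<subseteq> N"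
    and Y: "vector_field A U Y" and c: "c \<in> A" "x \<in> U" "x \<in> fst c"
  shows "D U Y c a i x = pderiv_in c a (Y c i) x + (\<Sum>d\<in>UNIV. christ D N c a d i x * Y c d x)"
proof -
  let ?W = "U \<inter> fst c"
  let ?Z = "\<lambda>c' b x. \<Sum>d\<in>UNIV. Y c d x * coord_field c d c' b x"
  have W: "openin M ?W" "?W \<subseteq> N" using U chart_open[OF c(1)] by auto
  have sf: "smooth_fun A ?W (Y c d)" for d
    by (rule smooth_fun_from_chart[OF c(1) W(1)]) (use smooth_in_subset[OF vf_smooth[OF Y c(1)]] in auto)
  have E: "vector_field A ?W (coord_field c d)" for d by (rule vf_coord_field[OF c(1)]) simp
  have "D ?W ?Z c a i x = D U Y c a i x"
    by (rule conn_restrict[OF D U Y W(1) _ vf_sum[OF W(1) sf E] _ c(1)])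
      (use c vf_trans[OF Y c(1)] in \<open>auto simp: coord_field_def mult.commute\<close>)
  also have "D ?W ?Z c a i x = (\<Sum>d\<in>UNIV. pderiv_in c a (Y c d) x * coord_field c d c i x + Y c d x * D ?W (coord_field c d) c a i x)"
    by (rule conn_sum[OF D W c(1) _ c(3) sf E]) (use c in auto)
  also have "\<dots> = pderiv_in c a (Y c i) x + (\<Sum>d\<in>UNIV. D ?W (coord_field c d) c a i x * Y c d x)"
    by (simp add: coord_field_self c sum.distrib mult.commute)
  finally have sum: "D U Y c a i x = \<dots>" by simp
  have "D ?W (coord_field c d) c a i x = christ D N c a d i x" for d
    unfolding christ_def
    by (rule conn_restrict[OF D _ _ vf_coord_field[OF c(1)] W(1) _ E _ c(1)]) (use c U N chart_open[OF c(1)] in auto)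
  then show ?thesis using sum by simp
qed

lemma christ_subset:
  assumes D: "affine_connection M A N D" and N: "openin M N" and U: "openin M U" "U \<subseteq> N" and c: "c \<in> A" "x \<in> U" "x \<in> fst c"
  shows "christ D U c a d i x = christ D N c a d i x"
  unfolding christ_def
  by (rule conn_restrict[OF D _ _ vf_coord_field[OF c(1)] _ _ vf_coord_field[OF c(1)] _ c(1)])
    (use c U N chart_open[OF c(1)] in auto)

lemma smooth_in_christ:
  assumes D: "affine_connection M A N D" and N: "openin M N" and c: "c \<in> A"
  shows "smooth_in c N (christ D N c a d i)"
proof -
  have "smooth_in c (N \<inter> fst c) (christ D N c a d i)"
    unfolding christ_def
    by (rule conn_smooth[OF D _ _ vf_coord_field[OF c] c]) (use N chart_open[OF c] in auto)
  then show ?thesis by (rule smooth_in_subset) simp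
qed

text \<open>Coordinate fields have constant components in their own chart, so their Lie bracket
  vanishes there.\<close>

lemma christ_sym:
  assumes D: "affine_connection M A N D" "torsion_free M A N D" and N: "openin M N" and c: "c \<in> A" "x \<in> N" "x \<in> fst c"
  shows "christ D N c a d i x = christ D N c d a i x"
proof -
  let ?V = "N \<inter> fst c"
  have V: "openin M ?V" "?V \<subseteq> N" using N chart_open[OF c(1)] by auto
  have E: "vector_field A ?V (coord_field c d)" for d by (rule vf_coord_field[OF c(1)]) simp
  have "cov D ?V (coord_field c a) (coord_field c d) c i x - cov D ?V (coord_field c d) (coord_field c a) c i x
     = lie_bracket (coord_field c a) (coord_field c d) c i x"
    using D(2) V E c unfolding torsion_free_def by blast
  moreover have "cov D ?V (coord_field c a) (coord_field c d) c i x = christ D N c a d i x" for a d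
    by (simp add: cov_def coord_field_self c christ_def)
  moreover have "pderiv_in c e (coord_field c d c i) x = 0" for e d
    using pderiv_cong[OF c(1) V(1), of x "coord_field c d c i" "\<lambda>x. kron i d" e] c
    by (simp add: coord_field_self)
  ultimately show ?thesis by (simp add: lie_bracket_def)
qed

lemma vf_cov:
  assumes D: "affine_connection M A N D" and U: "openin M U" "U \<subseteq> N" and Y: "vector_field A U Y" and Z: "vector_field A U Z"
  shows "vector_field A U (cov D U Y Z)"
  unfolding vector_field_iff
proof (intro conjI ballI allI)
  fix c b assume c: "c \<in> A"
  show "smooth_in c U (cov D U Y Z c b)"
    unfolding cov_def
    by (intro smooth_in_sum smooth_in_mult c U(1) vf_smooth[OF Y] conn_smooth[OF D U Z])
next
  fix c d x b assume c: "c \<in> A" and d: "d \<in> A" and "x \<in> U \<inter> fst c \<inter> fst d"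
  then have x: "x \<in> U" "x \<in> fst c" "x \<in> fst d" by auto
  have "cov D U Y Z d b x = (\<Sum>a\<in>UNIV. (\<Sum>j\<in>UNIV. jac c d a j x * Y c j x)
      * (\<Sum>i\<in>UNIV. jac d c i a x * (\<Sum>k\<in>UNIV. jac c d b k x * D U Z c i k x)))"
    unfolding cov_def vf_trans[OF Y c d x] conn_trans[OF D U Z c d x] by (simp add: sum_distrib_left mult.assoc)
  also have "\<dots> = (\<Sum>i\<in>UNIV. Y c i x * (\<Sum>k\<in>UNIV. jac c d b k x * D U Z c i k x))"
    by (rule contract_dual) (rule jac_inverse[OF c d x(2,3)])
  also have "\<dots> = (\<Sum>j\<in>UNIV. jac c d b j x * cov D U Y Z c j x)"
    unfolding cov_def sum_distrib_left by (subst sum.swap) (simp add: mult_ac)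
  finally show "cov D U Y Z d b x = (\<Sum>j\<in>UNIV. jac c d b j x * cov D U Y Z c j x)" .
qed

section \<open>Curvature of a connection in a chart\<close>

definition pchrist :: "('m, 'n) connection \<Rightarrow> 'm set \<Rightarrow> ('m, 'n) chart \<Rightarrow> 'n \<Rightarrow> 'n \<Rightarrow> 'n \<Rightarrow> real ^ 'n \<Rightarrow> real" where
  "pchrist D N c a d i = pull c (christ D N c a d i)"

lemma smooth_on_pchrist:
  assumes "affine_connection M A N D" "openin M N" "c \<in> A"
  shows "smooth_on (img c N) (pchrist D N c a d i)"
  using smooth_in_christ[OF assms] by (simp add: smooth_in_def pchrist_def)

lemma pchrist_sym:
  assumes "affine_connection M A N D" "torsion_free M A N D" "openin M N" "c \<in> A" "z \<in> img c N"
  shows "pchrist D N c a d i z = pchrist D N c d a i z"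
  using assms(5) christ_sym[OF assms(1-4)] assms(4) by (auto simp: img_def pchrist_def)

lemma conn_nabla:
  assumes D: "affine_connection M A N D" and N: "openin M N" and U: "openin M U" "U \<subseteq> N"
    and Y: "vector_field A U Y" and c: "c \<in> A" "x \<in> U" "x \<in> fst c"
  shows "D U Y c a i x = nabla (pchrist D N c) (\<lambda>i. pull c (Y c i)) a i (snd c x)"
  unfolding conn_local[OF assms] nabla_def pchrist_def pderiv_in_eq using c by simp

lemma curvature_identity:
  assumes D: "affine_connection M A N D" and N: "openin M N" and U: "openin M U" "U \<subseteq> N"
    and Y: "vector_field A U Y" and Z: "vector_field A U Z" and V: "vector_field A U V"
    and c: "c \<in> A" "x \<in> U" "x \<in> fst c"
  shows "cov D U Y (cov D U Z V) c i x - cov D U Z (cov D U Y V) c i x - cov D U (lie_bracket Y Z) V c i x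
     = (\<Sum>a\<in>UNIV. \<Sum>b\<in>UNIV. \<Sum>d\<in>UNIV. Y c a x * Z c b x * curv (pchrist D N c) a b i d (snd c x) * V c d x)"
proof -
  let ?S = "img c U" and ?p = "snd c x" and ?G = "pchrist D N c"
  have S: "open ?S" "?p \<in> ?S" using open_img[OF c(1) U(1)] img_memI[OF c(2,3)] by auto
  have G: "smooth_on ?S (?G a d i)" for a d i
    by (rule smooth_on_subset[OF smooth_on_pchrist[OF D N c(1)] img_mono[OF U(2)]])
  have sm: "smooth_on ?S (pull c (Y c i))" if "vector_field A U Y" for Y i
    using vf_smooth[OF that c(1)] by (simp add: smooth_in_def)
  have n: "nabla ?G v a i ?p = nabla ?G w a i ?p" if "\<And>i z. z \<in> ?S \<Longrightarrow> v i z = w i z" for v w a i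
    unfolding nabla_def using that S pd_cong_open[OF S, of "v i" "w i"] by simp
  have pc: "pull c (cov D U Y V c i) z = (\<Sum>b\<in>UNIV. pull c (Y c b) z * nabla ?G (\<lambda>i. pull c (V c i)) b i z)"
    if "z \<in> ?S" and "vector_field A U Y" for Y i z
    using that c by (auto simp: img_def cov_def conn_nabla[OF D N U V c(1)])
  have cc: "cov D U Y (cov D U Z V) c i x
     = (\<Sum>a\<in>UNIV. pull c (Y c a) ?p * nabla ?G (\<lambda>i p. \<Sum>b\<in>UNIV. pull c (Z c b) p * nabla ?G (\<lambda>i. pull c (V c i)) b i p) a i ?p)"
    if Y: "vector_field A U Y" and Z: "vector_field A U Z" for Y Z
    unfolding cov_def[of D U Y] conn_nabla[OF D N U vf_cov[OF D U Z V] c] using c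
    by (simp add: n[OF pc[OF _ Z]])
  have "cov D U (lie_bracket Y Z) V c i x
     = (\<Sum>a\<in>UNIV. (\<Sum>e\<in>UNIV. pull c (Y c e) ?p * pd e (pull c (Z c a)) ?p - pull c (Z c e) ?p * pd e (pull c (Y c a)) ?p) * nabla ?G (\<lambda>i. pull c (V c i)) a i ?p)"
    unfolding cov_def conn_nabla[OF D N U V c] lie_bracket_def pderiv_in_eq using c by simp
  then show ?thesis
    unfolding cc[OF Y Z] cc[OF Z Y]
    using curvature_in_coordinates[of ?S ?p ?G "\<lambda>i. pull c (V c i)" "\<lambda>i. pull c (Y c i)" "\<lambda>i. pull c (Z c i)" i,
        OF S G sm[OF V] sm[OF Y] sm[OF Z]] c by simp
qed

text \<open>The coordinate expression has the describing property by
  \<open>curvature_identity\<close>; testing any other candidate on coordinate fields near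
  \<open>x\<close> isolates its entries and shows uniqueness.\<close>

lemma riemann_eq:
  assumes D: "affine_connection M A N D" and N: "openin M N" and c: "c \<in> A" "x \<in> N" "x \<in> fst c"
  shows "riemann M A N D c x = (\<lambda>a b i d. curv (pchrist D N c) a b i d (snd c x))"
  unfolding riemann_def
proof (rule the_equality)
  show "\<forall>U Y Z V. openin M U \<longrightarrow> U \<subseteq> N \<longrightarrow> x \<in> U \<longrightarrow>
       vector_field A U Y \<longrightarrow> vector_field A U Z \<longrightarrow> vector_field A U V \<longrightarrow>
       (\<forall>i. cov D U Y (cov D U Z V) c i x - cov D U Z (cov D U Y V) c i x
              - cov D U (lie_bracket Y Z) V c i x
            = (\<Sum>a\<in>UNIV. \<Sum>b\<in>UNIV. \<Sum>d\<in>UNIV. Y c a x * Z c b x * curv (pchrist D N c) a b i d (snd c x) * V c d x))"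
    using curvature_identity[OF D N _ _ _ _ _ c(1) _ c(3)] by blast
next
  fix R
  assume R: "\<forall>U Y Z V. openin M U \<longrightarrow> U \<subseteq> N \<longrightarrow> x \<in> U \<longrightarrow>
       vector_field A U Y \<longrightarrow> vector_field A U Z \<longrightarrow> vector_field A U V \<longrightarrow>
       (\<forall>i. cov D U Y (cov D U Z V) c i x - cov D U Z (cov D U Y V) c i x
              - cov D U (lie_bracket Y Z) V c i x
            = (\<Sum>a\<in>UNIV. \<Sum>b\<in>UNIV. \<Sum>d\<in>UNIV. Y c a x * Z c b x * R a b i d * V c d x))"
  let ?V = "N \<inter> fst c"
  have V: "openin M ?V" "?V \<subseteq> N" "x \<in> ?V" using N chart_open[OF c(1)] c by auto
  have E: "vector_field A ?V (coord_field c d)" for d by (rule vf_coord_field[OF c(1)]) simp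
  have pick: "(\<Sum>a\<in>UNIV. \<Sum>b\<in>UNIV. \<Sum>d\<in>UNIV. kron a a0 * kron b b0 * Q a b d * kron d d0) = Q a0 b0 d0" for Q :: "'n \<Rightarrow> 'n \<Rightarrow> 'n \<Rightarrow> real" and a0 b0 d0
    by (simp add: mult.assoc sum_distrib_left[symmetric])
  have "R a b i d = curv (pchrist D N c) a b i d (snd c x)" for a b i d
  proof -
    have "(\<Sum>a'\<in>UNIV. \<Sum>b'\<in>UNIV. \<Sum>d'\<in>UNIV. coord_field c a c a' x * coord_field c b c b' x * R a' b' i d' * coord_field c d c d' x)
      = (\<Sum>a'\<in>UNIV. \<Sum>b'\<in>UNIV. \<Sum>d'\<in>UNIV. coord_field c a c a' x * coord_field c b c b' x * curv (pchrist D N c) a' b' i d' (snd c x) * coord_field c d c d' x)"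
      using R V E curvature_identity[OF D N V(1,2) E[of a] E[of b] E[of d] c(1) V(3) c(3), of i] by fastforce
    then show ?thesis unfolding coord_field_self[OF c(1,3)] pick .
  qed
  then show "R = (\<lambda>a b i d. curv (pchrist D N c) a b i d (snd c x))" by (intro ext)
qed

lemma riemann_subset:
  assumes D: "affine_connection M A N D" and N: "openin M N" and U: "openin M U" "U \<subseteq> N" and c: "c \<in> A" "x \<in> U" "x \<in> fst c"
  shows "riemann M A U D c x = riemann M A N D c x"
proof -
  have "curv (pchrist D U c) a b i d (snd c x) = curv (pchrist D N c) a b i d (snd c x)" for a b i d
    by (rule curv_cong[OF open_img[OF c(1) U(1)] img_memI[OF c(2,3)]])
      (use c christ_subset[OF D N U c(1)] in \<open>auto simp: img_def pchrist_def\<close>)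
  then show ?thesis
    using riemann_eq[OF affine_connection_subset[OF D U(2)] U(1) c] riemann_eq[OF D N c(1) _ c(3)] c U by auto
qed

section \<open>Projective changes of a connection\<close>

definition shift_conn :: "('m, 'n) connection \<Rightarrow> ('m, 'n) field1 \<Rightarrow> ('m, 'n) connection" where
  "shift_conn D \<Upsilon> = (\<lambda>U Y c a b x. D U Y c a b x + \<Upsilon> c a x * Y c b x + (\<Sum>e\<in>UNIV. \<Upsilon> c e x * Y c e x) * kron a b)"

lemma of_smooth: "one_form A N \<Upsilon> \<Longrightarrow> c \<in> A \<Longrightarrow> smooth_in c N (\<Upsilon> c a)"
  by (simp add: one_form_def smooth_components_iff)

lemma of_trans: "one_form A N \<Upsilon> \<Longrightarrow> c \<in> A \<Longrightarrow> d \<in> A \<Longrightarrow> x \<in> N \<Longrightarrow> x \<in> fst c \<Longrightarrow> x \<in> fst d \<Longrightarrow>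
   \<Upsilon> d a x = (\<Sum>i\<in>UNIV. jac d c i a x * \<Upsilon> c i x)"
  by (simp add: one_form_def)

lemma of_pairing:
  assumes "one_form A N \<Upsilon>" "vector_field A U Y" "U \<subseteq> N" "c \<in> A" "d \<in> A" "x \<in> U" "x \<in> fst c" "x \<in> fst d"
  shows "(\<Sum>e\<in>UNIV. \<Upsilon> d e x * Y d e x) = (\<Sum>e\<in>UNIV. \<Upsilon> c e x * Y c e x)"
proof -
  have "(\<Sum>e\<in>UNIV. \<Upsilon> d e x * Y d e x) = (\<Sum>a\<in>UNIV. (\<Sum>j\<in>UNIV. jac c d a j x * Y c j x) * (\<Sum>i\<in>UNIV. jac d c i a x * \<Upsilon> c i x))"
    using assms of_trans[OF assms(1), of c d x] vf_trans[OF assms(2), of c d x] by (auto simp: mult.commute)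
  also have "\<dots> = (\<Sum>i\<in>UNIV. Y c i x * \<Upsilon> c i x)"
    by (rule contract_dual) (rule jac_inverse[OF assms(4,5,7,8)])
  finally show ?thesis by (simp add: mult.commute)
qed

lemma shift_conn_affine:
  assumes D: "affine_connection M A N D" and N: "openin M N" and \<Upsilon>: "one_form A N \<Upsilon>"
  shows "affine_connection M A N (shift_conn D \<Upsilon>)"
  unfolding affine_connection_def
proof (intro allI impI conjI ballI)
  fix U Y assume U: "openin M U" "U \<subseteq> N" and Y: "vector_field A U Y"
  show "tensor_field_11 A U (shift_conn D \<Upsilon> U Y)"
    unfolding tensor_field_11_def smooth_components_iff
  proof (intro conjI allI ballI)
    fix a b c assume c: "c \<in> A"
    show "smooth_in c U (shift_conn D \<Upsilon> U Y c a b)"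
      unfolding shift_conn_def
      by (intro smooth_in_add smooth_in_mult smooth_in_sum smooth_in_const c U(1) conn_smooth[OF D U Y]
          vf_smooth[OF Y] smooth_in_subset[OF of_smooth[OF \<Upsilon>]]) (use U in auto)
  next
    fix c d x a b assume c: "c \<in> A" and d: "d \<in> A" and "x \<in> U \<inter> fst c \<inter> fst d"
    then have x: "x \<in> U" "x \<in> fst c" "x \<in> fst d" and xN: "x \<in> N" using U by auto
    have 1: "\<Upsilon> d a x * Y d b x = (\<Sum>i\<in>UNIV. \<Sum>j\<in>UNIV. jac d c i a x * jac c d b j x * (\<Upsilon> c i x * Y c j x))"
      unfolding of_trans[OF \<Upsilon> c d xN x(2,3)] vf_trans[OF Y c d x] sum_product by (simp add: mult_ac)
    have 2: "(\<Sum>i\<in>UNIV. \<Sum>j\<in>UNIV. jac d c i a x * jac c d b j x * (s * kron i j)) = s * kron a b" for s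
    proof -
      have "(\<Sum>i\<in>UNIV. \<Sum>j\<in>UNIV. jac d c i a x * jac c d b j x * (s * kron i j))
         = (\<Sum>i\<in>UNIV. \<Sum>j\<in>UNIV. s * jac d c i a x * (jac c d b j x * kron i j))"
        by (simp add: mult_ac)
      also have "\<dots> = s * (\<Sum>i\<in>UNIV. jac c d b i x * jac d c i a x)"
        unfolding sum_distrib_left[symmetric] kron_sum by (simp add: sum_distrib_left mult_ac)
      also have "(\<Sum>i\<in>UNIV. jac c d b i x * jac d c i a x) = kron a b"
        using jac_inverse[OF d c x(3,2), of b a] by (simp add: kron_commute)
      finally show ?thesis .
    qed
    show "shift_conn D \<Upsilon> U Y d a b x = (\<Sum>i\<in>UNIV. \<Sum>j\<in>UNIV. jac d c i a x * jac c d b j x * shift_conn D \<Upsilon> U Y c i j x)"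
      unfolding shift_conn_def distrib_left sum.distrib 2 1[symmetric] conn_trans[OF D U Y c d x, symmetric]
        of_pairing[OF \<Upsilon> Y U(2) c d x] ..
  qed
  {
    fix Z c x a b assume Z: "vector_field A U Z" and c: "c \<in> A" and "x \<in> U \<inter> fst c"
    then have x: "x \<in> U" "x \<in> fst c" by auto
    show "shift_conn D \<Upsilon> U (\<lambda>c b x. Y c b x + Z c b x) c a b x = shift_conn D \<Upsilon> U Y c a b x + shift_conn D \<Upsilon> U Z c a b x"
      unfolding shift_conn_def conn_add[OF D U Y Z c x] by (simp add: algebra_simps sum.distrib)
  next
    fix f c x a b assume f: "smooth_fun A U f" and c: "c \<in> A" and "x \<in> U \<inter> fst c"
    then have x: "x \<in> U" "x \<in> fst c" by auto
    show "shift_conn D \<Upsilon> U (\<lambda>c b x. f x * Y c b x) c a b x = pderiv_in c a f x * Y c b x + f x * shift_conn D \<Upsilon> U Y c a b x"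
      unfolding shift_conn_def conn_leibniz[OF D U Y f c x] by (simp add: algebra_simps sum_distrib_left)
  next
    fix V Z c x a b assume V: "openin M V" "V \<subseteq> U" and Z: "vector_field A V Z"
      and eq: "\<forall>c\<in>A. \<forall>x\<in>V \<inter> fst c. \<forall>b. Z c b x = Y c b x" and c: "c \<in> A" and "x \<in> V \<inter> fst c"
    then have x: "x \<in> V" "x \<in> fst c" by auto
    have "D V Z c a b x = D U Y c a b x"
      by (rule conn_restrict[OF D U Y V Z _ c x]) (use eq in auto)
    then show "shift_conn D \<Upsilon> V Z c a b x = shift_conn D \<Upsilon> U Y c a b x"
      unfolding shift_conn_def using eq c x by simp
  }
qed

text \<open>The correction to \<open>\<nabla>\<^sub>Y Z\<close> is
  \<open>\<Upsilon>(Y) Z + \<Upsilon>(Z) Y\<close>, symmetric in \<open>Y\<close> and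
  \<open>Z\<close>, and cancels in the torsion.\<close>

lemma shift_conn_torsion_free:
  assumes "torsion_free M A N D"
  shows "torsion_free M A N (shift_conn D \<Upsilon>)"
proof -
  have "cov (shift_conn D \<Upsilon>) U Y Z c b x = cov D U Y Z c b x + (\<Sum>a\<in>UNIV. \<Upsilon> c a x * Y c a x) * Z c b x + (\<Sum>a\<in>UNIV. \<Upsilon> c a x * Z c a x) * Y c b x" for U Y Z c b x
  proof -
    have "cov (shift_conn D \<Upsilon>) U Y Z c b x = (\<Sum>a\<in>UNIV. Y c a x * D U Z c a b x + (\<Upsilon> c a x * Y c a x) * Z c b x
       + (\<Sum>e\<in>UNIV. \<Upsilon> c e x * Z c e x) * (Y c a x * kron a b))"
      by (simp add: cov_def shift_conn_def algebra_simps)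
    also have "\<dots> = cov D U Y Z c b x + (\<Sum>a\<in>UNIV. \<Upsilon> c a x * Y c a x) * Z c b x + (\<Sum>a\<in>UNIV. \<Upsilon> c a x * Z c a x) * Y c b x"
      unfolding sum.distrib sum_distrib_left[symmetric] sum_distrib_right[symmetric] kron_sum cov_def ..
    finally show ?thesis .
  qed
  then show ?thesis using assms unfolding torsion_free_def by simp
qed

text \<open>The projective change is evaluated on the coordinate fields of \<open>c\<close>, whose
  components there are Kronecker symbols.\<close>

lemma proj_equivalent_pchrist:
  assumes D: "affine_connection M A N D" and N: "openin M N" and c: "c \<in> A" "z \<in> img c N"
    and eq: "\<And>U Y c x a b. openin M U \<Longrightarrow> U \<subseteq> N \<Longrightarrow> vector_field A U Y \<Longrightarrow> c \<in> A \<Longrightarrow> x \<in> U \<Longrightarrow> x \<in> fst c \<Longrightarrow>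
       D' U Y c a b x = D U Y c a b x + \<Upsilon> c a x * Y c b x + (\<Sum>e\<in>UNIV. \<Upsilon> c e x * Y c e x) * kron a b"
  shows "pchrist D' N c a d i z = proj_shift (pchrist D N c) (\<lambda>a. pull c (\<Upsilon> c a)) a d i z"
proof -
  obtain x where x: "x \<in> N" "x \<in> fst c" "z = snd c x" using c(2) by (auto simp: img_def)
  have "christ D' N c a d i x = christ D N c a d i x + \<Upsilon> c a x * kron d i + \<Upsilon> c d x * kron a i"
    unfolding christ_def using eq[of "N \<inter> fst c" "coord_field c d" c x a i] N chart_open[OF c(1)] vf_coord_field[OF c(1)] c x
    by (simp add: coord_field_self openin_Int kron_commute[of i d])
  then show ?thesis using c x by (simp add: pchrist_def proj_shift_def)
qed

end

lemma gram_form: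
  fixes t :: "'k::finite \<Rightarrow> 'n::finite \<Rightarrow> real"
  shows "(\<Sum>a\<in>UNIV. \<Sum>b\<in>UNIV. (\<Sum>k\<in>UNIV. t k a * t k b) * y a * z b)
     = (\<Sum>k\<in>UNIV. (\<Sum>a\<in>UNIV. t k a * y a) * (\<Sum>b\<in>UNIV. t k b * z b))"
proof -
  have "(\<Sum>a\<in>UNIV. \<Sum>b\<in>UNIV. (\<Sum>k\<in>UNIV. t k a * t k b) * y a * z b)
     = (\<Sum>a\<in>UNIV. \<Sum>k\<in>UNIV. \<Sum>b\<in>UNIV. (t k a * y a) * (t k b * z b))"
    unfolding sum_distrib_right by (rule sum.cong[OF refl], subst sum.swap) (simp add: mult_ac)
  also have "\<dots> = (\<Sum>k\<in>UNIV. \<Sum>a\<in>UNIV. \<Sum>b\<in>UNIV. (t k a * y a) * (t k b * z b))"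
    by (rule sum.swap)
  finally show ?thesis by (simp only: sum_product)
qed

context smooth_mfd
begin

subsection \<open>Parallel coframes\<close>

text \<open>Being parallel is expressed by differentiating the pairing with vector fields. Both
  sides of this equation transform as covectors, so it passes from \<open>c0\<close> to every chart
  without the inhomogeneous transformation law of Christoffel symbols.\<close>

lemma parallel_form_chart_independent:
  assumes D: "affine_connection M A U D" and U: "openin M U" and c0: "c0 \<in> A" "U \<subseteq> fst c0"
    and th: "one_form A U th"
    and par: "\<And>a b x. x \<in> U \<Longrightarrow> pderiv_in c0 a (th c0 b) x = (\<Sum>i\<in>UNIV. christ D U c0 a b i x * th c0 i x)"
    and V: "openin M V" "V \<subseteq> U" and Y: "vector_field A V Y" and c: "c \<in> A" "x \<in> V" "x \<in> fst c"
  shows "pderiv_in c e (\<lambda>y. \<Sum>a\<in>UNIV. th c a y * Y c a y) x = (\<Sum>a\<in>UNIV. th c a x * D V Y c e a x)"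
proof -
  have xU: "x \<in> U" "x \<in> fst c0" using V c c0 by auto
  have smt: "smooth_in c0 V (th c0 a)" for a using of_smooth[OF th c0(1)] V by (blast intro: smooth_in_subset)
  have smp: "smooth_in c0 V (\<lambda>y. th c0 a y * Y c0 a y)" for a
    by (intro smooth_in_mult c0(1) V(1) smt vf_smooth[OF Y])
  have base: "pderiv_in c0 e (\<lambda>y. \<Sum>a\<in>UNIV. th c0 a y * Y c0 a y) x = (\<Sum>a\<in>UNIV. th c0 a x * D V Y c0 e a x)" for e
  proof -
    have "(\<Sum>a\<in>UNIV. (\<Sum>i\<in>UNIV. christ D U c0 e a i x * th c0 i x) * Y c0 a x)
       = (\<Sum>i\<in>UNIV. th c0 i x * (\<Sum>a\<in>UNIV. christ D U c0 e a i x * Y c0 a x))"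
      unfolding sum_distrib_left sum_distrib_right by (subst sum.swap) (simp add: mult_ac)
    moreover have "pderiv_in c0 e (\<lambda>y. \<Sum>a\<in>UNIV. th c0 a y * Y c0 a y) x
       = (\<Sum>a\<in>UNIV. pderiv_in c0 e (th c0 a) x * Y c0 a x) + (\<Sum>a\<in>UNIV. th c0 a x * pderiv_in c0 e (Y c0 a) x)"
      by (simp add: pderiv_sum[OF smp c(2) xU(2)] pderiv_mult[OF smt vf_smooth[OF Y c0(1)] c(2) xU(2) c0(1)] sum.distrib)
    ultimately show ?thesis
      unfolding conn_local[OF D U V Y c0(1) c(2) xU(2)] par[OF xU(1)] by (simp add: distrib_left sum.distrib)
  qed
  have "pderiv_in c e (\<lambda>y. \<Sum>a\<in>UNIV. th c a y * Y c a y) x = pderiv_in c e (\<lambda>y. \<Sum>a\<in>UNIV. th c0 a y * Y c0 a y) x"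
    by (rule pderiv_cong[OF c(1) V(1) c(2,3)], rule of_pairing[OF th Y V(2) c0(1) c(1)]) (use V c0 in auto)
  also have "\<dots> = (\<Sum>j\<in>UNIV. jac c c0 j e x * pderiv_in c0 j (\<lambda>y. \<Sum>a\<in>UNIV. th c0 a y * Y c0 a y) x)"
    by (rule pderiv_chain[OF c(1) c0(1) c(3) xU(2) c(2)]) (intro smooth_in_sum c0(1) V(1) smp)
  also have "\<dots> = (\<Sum>b\<in>UNIV. th c0 b x * (\<Sum>j\<in>UNIV. jac c c0 j e x * D V Y c0 j b x))"
    unfolding base sum_distrib_left by (subst sum.swap) (simp add: mult_ac)
  also have "\<dots> = (\<Sum>j\<in>UNIV. (\<Sum>i\<in>UNIV. jac c c0 i e x * D V Y c0 i j x) * th c0 j x)"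
    by (simp add: mult.commute)
  also have "\<dots> = (\<Sum>a\<in>UNIV. (\<Sum>j\<in>UNIV. jac c0 c a j x * (\<Sum>i\<in>UNIV. jac c c0 i e x * D V Y c0 i j x)) * (\<Sum>i\<in>UNIV. jac c c0 i a x * th c0 i x))"
    by (rule contract_dual[symmetric]) (rule jac_inverse[OF c0(1) c(1) xU(2) c(3)])
  also have "\<dots> = (\<Sum>a\<in>UNIV. th c a x * D V Y c e a x)"
  proof (rule sum.cong[OF refl])
    fix a
    have "D V Y c e a x = (\<Sum>i\<in>UNIV. \<Sum>j\<in>UNIV. jac c c0 i e x * jac c0 c a j x * D V Y c0 i j x)"
      by (rule conn_trans[OF D V Y c0(1) c(1,2) xU(2) c(3)])
    also have "\<dots> = (\<Sum>j\<in>UNIV. jac c0 c a j x * (\<Sum>i\<in>UNIV. jac c c0 i e x * D V Y c0 i j x))"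
      unfolding sum_distrib_left by (subst sum.swap) (simp add: mult_ac)
    finally show "(\<Sum>j\<in>UNIV. jac c0 c a j x * (\<Sum>i\<in>UNIV. jac c c0 i e x * D V Y c0 i j x)) * (\<Sum>i\<in>UNIV. jac c c0 i a x * th c0 i x)
      = th c a x * D V Y c e a x"
      by (simp add: of_trans[OF th c0(1) c(1) xU(1,2) c(3)] mult.commute)
  qed
  finally show ?thesis .
qed

lemma det_jac_nonzero:
  assumes "c \<in> A" "d \<in> A" "x \<in> fst c" "x \<in> fst d"
  shows "det (\<chi> i a. jac c d i a x) \<noteq> 0"
proof -
  have "(\<chi> i a. jac d c i a x) ** (\<chi> i a. jac c d i a x) = mat 1"
    using jac_inverse[OF assms] by (simp add: matrix_matrix_mult_def vec_eq_iff mat_def kron_def)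
  then show ?thesis using det_mul[of "\<chi> i a. jac d c i a x" "\<chi> i a. jac c d i a x"] by auto
qed

lemma det_coframe_nonzero:
  fixes th :: "'n \<Rightarrow> ('m, 'n) field1"
  assumes th: "\<And>k. one_form A U (th k)" and c: "c \<in> A" "d \<in> A" "x \<in> U" "x \<in> fst c" "x \<in> fst d"
    and det: "det (\<chi> k a. th k c a x) \<noteq> 0"
  shows "det (\<chi> k a. th k d a x) \<noteq> 0"
proof -
  have "(\<chi> k a. th k d a x) = (\<chi> k a. th k c a x) ** (\<chi> i a. jac d c i a x)"
    using of_trans[OF th c] by (simp add: matrix_matrix_mult_def vec_eq_iff mult.commute)
  then show ?thesis using det det_jac_nonzero[OF c(2,1,5,4)] by (simp add: det_mul)
qed

text \<open>Testing on coordinate fields gives the component equation of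
  \<open>parallel_coframe_flat\<close>; the curvature is annihilated by each of the covectors and
  these span.\<close>

lemma parallel_coframe_curv_zero:
  fixes th :: "'n \<Rightarrow> ('m, 'n) field1"
  assumes D: "affine_connection M A U D" and U: "openin M U" 
    and th: "\<And>k. one_form A U (th k)"
    and par: "\<And>k V Y x e. openin M V \<Longrightarrow> V \<subseteq> U \<Longrightarrow> vector_field A V Y \<Longrightarrow> x \<in> V \<Longrightarrow> x \<in> fst c \<Longrightarrow>
       pderiv_in c e (\<lambda>y. \<Sum>a\<in>UNIV. th k c a y * Y c a y) x = (\<Sum>a\<in>UNIV. th k c a x * D V Y c e a x)"
    and c: "c \<in> A" "x \<in> U" "x \<in> fst c" and det: "det (\<chi> k a. th k c a x) \<noteq> 0"
  shows "curv (pchrist D U c) a b i d (snd c x) = 0"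
proof -
  let ?V = "U \<inter> fst c"
  have V: "openin M ?V" "?V \<subseteq> U" using U chart_open[OF c(1)] by auto
  have E: "vector_field A ?V (coord_field c b)" for b by (rule vf_coord_field[OF c(1)]) simp
  have p: "pderiv_in c e (th k c b) y = (\<Sum>i\<in>UNIV. christ D U c e b i y * th k c i y)" if y: "y \<in> U" "y \<in> fst c" for e k b y
  proof -
    have "pderiv_in c e (th k c b) y = pderiv_in c e (\<lambda>y. \<Sum>a\<in>UNIV. th k c a y * coord_field c b c a y) y"
      by (rule pderiv_cong[OF c(1) V(1)]) (use y in \<open>auto simp: coord_field_self[OF c(1)]\<close>)
    also have "\<dots> = (\<Sum>a\<in>UNIV. th k c a y * D ?V (coord_field c b) c e a y)"
      by (rule par[OF V E]) (use y in auto)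
    finally show ?thesis by (simp add: christ_def mult.commute)
  qed
  have S: "open (img c U)" "snd c x \<in> img c U" using open_img[OF c(1) U] img_memI[OF c(2,3)] by auto
  have "(\<Sum>i\<in>UNIV. curv (pchrist D U c) a b i d (snd c x) * pull c (th k c i) (snd c x)) = 0" for k
  proof (rule parallel_coframe_flat[OF S, of "pchrist D U c" "\<lambda>i. pull c (th k c i)"])
    show "smooth_on (img c U) (pchrist D U c a d i)" for a d i by (rule smooth_on_pchrist[OF D U c(1)])
    show "smooth_on (img c U) (pull c (th k c i))" for i using of_smooth[OF th c(1)] by (simp add: smooth_in_def)
    show "pd a (pull c (th k c b)) z = (\<Sum>i\<in>UNIV. pchrist D U c a b i z * pull c (th k c i) z)" if z: "z \<in> img c U" for a b z
    proof -
      obtain y where y: "y \<in> U" "y \<in> fst c" "z = snd c y" using z by (auto simp: img_def)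
      then show ?thesis using p[OF y(1,2)] c(1) by (simp add: pderiv_in_eq pchrist_def)
    qed
  qed
  then have "(\<Sum>i\<in>UNIV. th k c i x * curv (pchrist D U c) a b i d (snd c x)) = 0" for k
    using c by (simp add: mult.commute)
  then show ?thesis by (rule det_nonzero_vector_zero[OF det, where v = "\<lambda>i. curv (pchrist D U c) a b i d (snd c x)"])
qed

text \<open>With \<theta> the coframe matrix, the metric matrix is the transpose of \<theta> times
  \<theta>, so its determinant is the square of a nonzero number.\<close>

lemma coframe_metric:
  fixes th :: "'n \<Rightarrow> ('m, 'n) field1"
  assumes U: "openin M U" and th: "\<And>k. one_form A U (th k)"
    and det: "\<And>c x. c \<in> A \<Longrightarrow> x \<in> U \<Longrightarrow> x \<in> fst c \<Longrightarrow> det (\<chi> k a. th k c a x) \<noteq> 0"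
  shows "metric A U (\<lambda>c a b x. \<Sum>k\<in>UNIV. th k c a x * th k c b x)"
  unfolding metric_def smooth_components_iff
proof (intro conjI allI ballI)
  fix a b c assume c: "c \<in> A"
  show "smooth_in c U (\<lambda>x. \<Sum>k\<in>UNIV. th k c a x * th k c b x)"
    by (intro smooth_in_sum smooth_in_mult c U of_smooth[OF th])
next
  fix c d x a b assume c: "c \<in> A" and d: "d \<in> A" and "x \<in> U \<inter> fst c \<inter> fst d"
  then have x: "x \<in> U" "x \<in> fst c" "x \<in> fst d" by auto
  have "(\<Sum>k\<in>UNIV. th k d a x * th k d b x) = (\<Sum>k\<in>UNIV. (\<Sum>i\<in>UNIV. th k c i x * jac d c i a x) * (\<Sum>j\<in>UNIV. th k c j x * jac d c j b x))"
    by (simp add: of_trans[OF th c d x] mult.commute)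
  also have "\<dots> = (\<Sum>i\<in>UNIV. \<Sum>j\<in>UNIV. (\<Sum>k\<in>UNIV. th k c i x * th k c j x) * jac d c i a x * jac d c j b x)"
    by (rule gram_form[symmetric])
  finally show "(\<Sum>k\<in>UNIV. th k d a x * th k d b x) = (\<Sum>i\<in>UNIV. \<Sum>j\<in>UNIV. jac d c i a x * jac d c j b x * (\<Sum>k\<in>UNIV. th k c i x * th k c j x))"
    by (simp add: mult_ac)
next
  fix c x a b
  show "(\<Sum>k\<in>UNIV. th k c a x * th k c b x) = (\<Sum>k\<in>UNIV. th k c b x * th k c a x)" by (simp add: mult.commute)
next
  fix c x assume "c \<in> A" "x \<in> U \<inter> fst c"
  then have d: "det (\<chi> k a. th k c a x) \<noteq> 0" using det by simp
  have "(\<chi> a b. \<Sum>k\<in>UNIV. th k c a x * th k c b x) = transpose (\<chi> k a. th k c a x) ** (\<chi> k a. th k c a x)"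
    by (simp add: matrix_matrix_mult_def transpose_def vec_eq_iff)
  then show "det (\<chi> a b. \<Sum>k\<in>UNIV. th k c a x * th k c b x) \<noteq> 0" using d by (simp add: det_mul)
qed

lemma coframe_metric_compatible:
  fixes th :: "'n \<Rightarrow> ('m, 'n) field1"
  assumes th: "\<And>k. one_form A U (th k)"
    and par: "\<And>c k V Y x e. c \<in> A \<Longrightarrow> openin M V \<Longrightarrow> V \<subseteq> U \<Longrightarrow> vector_field A V Y \<Longrightarrow> x \<in> V \<Longrightarrow> x \<in> fst c \<Longrightarrow>
       pderiv_in c e (\<lambda>y. \<Sum>a\<in>UNIV. th k c a y * Y c a y) x = (\<Sum>a\<in>UNIV. th k c a x * D V Y c e a x)"
  shows "metric_compatible M A U (\<lambda>c a b x. \<Sum>k\<in>UNIV. th k c a x * th k c b x) D"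
  unfolding metric_compatible_def
proof (intro allI impI ballI)
  fix V Y Z c x e
  assume V: "openin M V" "V \<subseteq> U" and Y: "vector_field A V Y" and Z: "vector_field A V Z"
    and c: "c \<in> A" and "x \<in> V \<inter> fst c"
  then have x: "x \<in> V" "x \<in> fst c" by auto
  have smt: "smooth_in c V (\<lambda>y. \<Sum>a\<in>UNIV. th k c a y * Y c a y)" if Y: "vector_field A V Y" for k Y
    by (intro smooth_in_sum smooth_in_mult c V(1) vf_smooth[OF Y] smooth_in_subset[OF of_smooth[OF th]]) (use V in auto)
  have "pderiv_in c e (\<lambda>y. \<Sum>k\<in>UNIV. (\<Sum>a\<in>UNIV. th k c a y * Y c a y) * (\<Sum>b\<in>UNIV. th k c b y * Z c b y)) x
     = (\<Sum>k\<in>UNIV. (\<Sum>a\<in>UNIV. th k c a x * D V Y c e a x) * (\<Sum>b\<in>UNIV. th k c b x * Z c b x))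
     + (\<Sum>k\<in>UNIV. (\<Sum>a\<in>UNIV. th k c a x * Y c a x) * (\<Sum>b\<in>UNIV. th k c b x * D V Z c e b x))"
    by (simp add: pderiv_sum[OF smooth_in_mult[OF c V(1) smt[OF Y] smt[OF Z]] x] pderiv_mult[OF smt[OF Y] smt[OF Z] x c]
        par[OF c V Y x] par[OF c V Z x] sum.distrib)
  then show "pderiv_in c e (\<lambda>y. \<Sum>a\<in>UNIV. \<Sum>b\<in>UNIV. (\<Sum>k\<in>UNIV. th k c a y * th k c b y) * Y c a y * Z c b y) x
     = (\<Sum>a\<in>UNIV. \<Sum>b\<in>UNIV. (\<Sum>k\<in>UNIV. th k c a x * th k c b x) * D V Y c e a x * Z c b x
          + (\<Sum>k\<in>UNIV. th k c a x * th k c b x) * Y c a x * D V Z c e b x)"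
    unfolding sum.distrib gram_form .
qed

lemma metric_compatible_christ:
  assumes D: "affine_connection M A U D" and U: "openin M U" and g: "metric_compatible M A U g D" and c: "c \<in> A" "x \<in> U" "x \<in> fst c"
  shows "pderiv_in c e (g c a b) x = (\<Sum>i\<in>UNIV. christ D U c e a i x * g c i b x) + (\<Sum>i\<in>UNIV. christ D U c e b i x * g c a i x)"
proof -
  let ?V = "U \<inter> fst c"
  have V: "openin M ?V" "?V \<subseteq> U" "x \<in> ?V \<inter> fst c" using U chart_open[OF c(1)] c by auto
  have E: "vector_field A ?V (coord_field c b)" for b by (rule vf_coord_field[OF c(1)]) simp
  have pick: "(\<Sum>a'\<in>UNIV. \<Sum>b'\<in>UNIV. Q a' b' * kron a' a * kron b' b) = Q a b" for Q :: "'n \<Rightarrow> 'n \<Rightarrow> real"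
    by simp
  have "pderiv_in c e (g c a b) x = pderiv_in c e (\<lambda>y. \<Sum>a'\<in>UNIV. \<Sum>b'\<in>UNIV. g c a' b' y * coord_field c a c a' y * coord_field c b c b' y) x"
    by (rule pderiv_cong[OF c(1) V(1)]) (use c in \<open>auto simp: coord_field_self[OF c(1)]\<close>)
  also have "\<dots> = (\<Sum>a'\<in>UNIV. \<Sum>b'\<in>UNIV.
       g c a' b' x * D ?V (coord_field c a) c e a' x * coord_field c b c b' x
       + g c a' b' x * coord_field c a c a' x * D ?V (coord_field c b) c e b' x)"
    using g[unfolded metric_compatible_def, rule_format, OF V(1,2) E E c(1) V(3)] .
  also have "\<dots> = (\<Sum>a'\<in>UNIV. g c a' b x * christ D U c e a a' x) + (\<Sum>b'\<in>UNIV. \<Sum>a'\<in>UNIV. g c a' b' x * christ D U c e b b' x * kron a' a)"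
    unfolding sum.distrib coord_field_self[OF c(1,3)] christ_def[symmetric] kron_sum
    by (subst sum.swap[of "\<lambda>a' b'. g c a' b' x * kron a' a * christ D U c e b b' x"]) (simp add: mult_ac)
  finally show ?thesis by (simp add: mult.commute)
qed

end

subsection \<open>Projective three-manifolds\<close>

locale smooth_3mfd = smooth_mfd M A for M :: "'m topology" and A :: "('m, 3) chart set"
begin

abbreviation tfc :: "'m set \<Rightarrow> ('m, 3) connection set" where
  "tfc \<equiv> torsion_free_connections M A"

lemma tfcD: "D \<in> tfc N \<Longrightarrow> affine_connection M A N D" "D \<in> tfc N \<Longrightarrow> torsion_free M A N D"
  by (simp_all add: torsion_free_connections_def)

lemma tfc_subset: "D \<in> tfc N \<Longrightarrow> U \<subseteq> N \<Longrightarrow> D \<in> tfc U"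
  unfolding torsion_free_connections_def using affine_connection_subset torsion_free_subset by blast

lemma proj_weyl_zero_iff:
  assumes D: "D \<in> tfc N" and N: "openin M N" and c: "c \<in> A" "x \<in> N" "x \<in> fst c"
  shows "(\<forall>a b i d. proj_weyl M A N D c x a b i d = 0) \<longleftrightarrow>
     (\<exists>P. \<forall>a b i d. curv (pchrist D N c) a b i d (snd c x) = kron a i * P b d - kron b i * P a d + (P b a - P a b) * kron i d)"
  unfolding proj_weyl_eq riemann_eq[OF tfcD(1)[OF D] N c]
proof (rule weyl_zero_iff)
  show "curv (pchrist D N c) a b i d (snd c x) = - curv (pchrist D N c) b a i d (snd c x)" for a b i d
    by (rule curv_antisym)
  show "curv (pchrist D N c) a b i d (snd c x) + curv (pchrist D N c) b d i a (snd c x) + curv (pchrist D N c) d a i b (snd c x) = 0" for a b i d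
    by (rule first_bianchi_curv[OF open_img[OF c(1) N] img_memI[OF c(2,3)]]) (rule pchrist_sym[OF tfcD[OF D] N c(1)])
qed

text \<open>Links the Weyl tensor of a connection on the whole manifold with that on the
  neighbourhood carrying the Einstein metric.\<close>

lemma proj_weyl_subset:
  assumes "D \<in> tfc N" "openin M N" "openin M U" "U \<subseteq> N" "c \<in> A" "x \<in> U" "x \<in> fst c"
  shows "proj_weyl M A U D c x = proj_weyl M A N D c x"
  unfolding proj_weyl_eq riemann_subset[OF tfcD(1)[OF assms(1)] assms(2-)] ..

text \<open>In a chart the equivalence is a \<open>proj_shift\<close>, which adds only a Schouten
  term; both curvatures then admit the same Weyl parts, so the two descriptions coincide.\<close>

lemma proj_weyl_invariant:
  assumes D: "D \<in> tfc N" and D': "D' \<in> tfc N" and eq: "proj_equivalent M A N D D'" and N: "openin M N" and c: "c \<in> A" "x \<in> N" "x \<in> fst c"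
  shows "proj_weyl M A N D' c x = proj_weyl M A N D c x"
proof -
  from eq obtain \<Upsilon> where \<Upsilon>: "one_form A N \<Upsilon>"
    and sh: "\<And>U Y c x a b. openin M U \<Longrightarrow> U \<subseteq> N \<Longrightarrow> vector_field A U Y \<Longrightarrow> c \<in> A \<Longrightarrow> x \<in> U \<Longrightarrow> x \<in> fst c \<Longrightarrow>
       D' U Y c a b x = D U Y c a b x + \<Upsilon> c a x * Y c b x + (\<Sum>e\<in>UNIV. \<Upsilon> c e x * Y c e x) * kron a b"
  proof -
    from eq obtain \<Upsilon> where \<Upsilon>: "one_form A N \<Upsilon>"
      and sh: "\<forall>U Y. openin M U \<longrightarrow> U \<subseteq> N \<longrightarrow> vector_field A U Y \<longrightarrow> (\<forall>c\<in>A. \<forall>x\<in>U \<inter> fst c. \<forall>a b.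
         D' U Y c a b x = D U Y c a b x + \<Upsilon> c a x * Y c b x + (\<Sum>e\<in>UNIV. \<Upsilon> c e x * Y c e x) * kron a b)"
      unfolding proj_equivalent_def by (elim exE conjE)
    show ?thesis
      by (rule that[OF \<Upsilon>]) (rule sh[rule_format], assumption+, rule IntI, assumption+)
  qed
  let ?S = "img c N" and ?z = "snd c x" and ?G = "pchrist D N c" and ?u = "\<lambda>a. pull c (\<Upsilon> c a)"
  have S: "open ?S" "?z \<in> ?S" using open_img[OF c(1) N] img_memI[OF c(2,3)] by auto
  have "curv (pchrist D' N c) a b i d ?z = curv ?G a b i d ?z
     + (kron a i * schouten_shift ?G ?u b d ?z - kron b i * schouten_shift ?G ?u a d ?z)
     + (schouten_shift ?G ?u b a ?z - schouten_shift ?G ?u a b ?z) * kron i d" for a b i d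
  proof -
    have "curv (pchrist D' N c) a b i d ?z = curv (proj_shift ?G ?u) a b i d ?z"
      by (rule curv_cong[OF S]) (rule proj_equivalent_pchrist[OF tfcD(1)[OF D] N c(1) _ sh])
    also have "\<dots> = curv ?G a b i d ?z
     + (kron a i * schouten_shift ?G ?u b d ?z - kron b i * schouten_shift ?G ?u a d ?z)
     + (schouten_shift ?G ?u b a ?z - schouten_shift ?G ?u a b ?z) * kron i d"
    proof (rule curv_proj_shift)
      show "?G a d i differentiable (at ?z)" for a d i
        by (rule smooth_on_differentiable[OF smooth_on_pchrist[OF tfcD(1)[OF D] N c(1)] S(2)])
      show "pull c (\<Upsilon> c a) differentiable (at ?z)" for a
        by (rule smooth_in_differentiable[OF of_smooth[OF \<Upsilon> c(1)] c(2,3)])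
      show "?G a d i ?z = ?G d a i ?z" for a d i
        by (rule pchrist_sym[OF tfcD[OF D] N c(1) S(2)])
    qed
    finally show ?thesis .
  qed
  then have "weyl_form (\<lambda>a b i d. curv (pchrist D' N c) a b i d ?z) w \<longleftrightarrow> weyl_form (\<lambda>a b i d. curv ?G a b i d ?z) w" for w
    by (rule weyl_form_shift[where Q = "\<lambda>a b. schouten_shift ?G ?u a b ?z"])
  then show ?thesis
    unfolding proj_weyl_eq riemann_eq[OF tfcD(1)[OF D] N c] riemann_eq[OF tfcD(1)[OF D'] N c]
    by (intro arg_cong[where f = The] ext)
qed

lemma einstein_proj_weyl_zero:
  assumes U: "openin M U" and g: "einstein_metric M A U g" and D: "levi_civita M A U g D" and c: "c \<in> A" "x \<in> U" "x \<in> fst c"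
  shows "proj_weyl M A U D c x a b i d = 0"
proof -
  from g obtain D2 K where m: "metric A U g" and D2: "levi_civita M A U g D2"
    and ric: "\<And>c x a b. c \<in> A \<Longrightarrow> x \<in> U \<Longrightarrow> x \<in> fst c \<Longrightarrow> ricci M A U D2 c x a b = K * g c a b x"
    unfolding einstein_metric_def by blast
  have t: "D \<in> tfc U" "D2 \<in> tfc U" and co: "metric_compatible M A U g D" "metric_compatible M A U g D2"
    using D D2 by (auto simp: levi_civita_def)
  have gs: "g c a b y = g c b a y" and gd: "det (\<chi> a b. g c a b y) \<noteq> 0" if "y \<in> U" "y \<in> fst c" for a b y
    using m c(1) that unfolding metric_def by blast+
  have smg: "smooth_in c U (g c a b)" for a b using m c(1) by (simp add: metric_def smooth_components_iff)
  let ?S = "img c U" and ?z = "snd c x" and ?G = "pchrist D U c" and ?g = "\<lambda>a b. pull c (g c a b)"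
  have S: "open ?S" "?z \<in> ?S" using open_img[OF c(1) U] img_memI[OF c(2,3)] by auto
  \<comment> \<open>The Ricci equation is known for \<open>D2\<close>, the claim concerns
    \<open>D\<close>; both are Levi-Civita for \<open>g\<close>, so their Christoffel symbols agree
    and the equation carries over.\<close>
  have same: "christ D U c a b i y = christ D2 U c a b i y" if y: "y \<in> U" "y \<in> fst c" for a b i y
    by (rule levi_civita_symbols_unique[of "\<lambda>a b. g c a b y" "\<lambda>a b i. christ D U c a b i y" "\<lambda>e a b. pderiv_in c e (g c a b) y",
          OF gs[OF y] gd[OF y] christ_sym[OF tfcD[OF t(1)] U c(1) y] metric_compatible_christ[OF tfcD(1)[OF t(1)] U co(1) c(1) y]
            christ_sym[OF tfcD[OF t(2)] U c(1) y] metric_compatible_christ[OF tfcD(1)[OF t(2)] U co(2) c(1) y]])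
  have cs: "curv (pchrist D2 U c) a b i d ?z = curv ?G a b i d ?z" for a b i d
    by (rule curv_cong[OF S]) (use same c(1) in \<open>auto simp: img_def pchrist_def\<close>)
  have "\<exists>P. \<forall>a b i d. curv ?G a b i d ?z = kron a i * P b d - kron b i * P a d + (P b a - P a b) * kron i d"
  proof (rule einstein_imp_weyl_zero[where g = "\<lambda>a b. g c a b x" and K = K])
    show "curv ?G a b i d ?z = - curv ?G b a i d ?z" for a b i d by (rule curv_antisym)
    have "(\<Sum>i\<in>UNIV. curv ?G a b i p ?z * ?g i q ?z) + (\<Sum>i\<in>UNIV. curv ?G a b i q ?z * ?g p i ?z) = 0" for a b p q
    proof (rule metric_curv_antisym[OF S])
      show "smooth_on ?S (?G a d i)" for a d i by (rule smooth_on_pchrist[OF tfcD(1)[OF t(1)] U c(1)])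
      show "smooth_on ?S (?g a b)" for a b using smg by (simp add: smooth_in_def)
      show "pd e (?g a b) z = (\<Sum>i\<in>UNIV. ?G e a i z * ?g i b z) + (\<Sum>i\<in>UNIV. ?G e b i z * ?g a i z)" if z: "z \<in> ?S" for e a b z
      proof -
        obtain y where y: "y \<in> U" "y \<in> fst c" "z = snd c y" using z by (auto simp: img_def)
        then show ?thesis
          using metric_compatible_christ[OF tfcD(1)[OF t(1)] U co(1) c(1) y(1,2)] c(1) by (simp add: pderiv_in_eq pchrist_def)
      qed
    qed
    then show "(\<Sum>i\<in>UNIV. curv ?G a b i p ?z * g c i q x) + (\<Sum>i\<in>UNIV. curv ?G a b i q ?z * g c p i x) = 0" for a b p q
      using c by simp
    show "g c a b x = g c b a x" for a b by (rule gs[OF c(2,3)])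
    show "det (\<chi> a b. g c a b x) \<noteq> 0" by (rule gd[OF c(2,3)])
    show "(\<Sum>a\<in>UNIV. curv ?G a b a d ?z) = K * g c b d x" for b d
      using ric[OF c, of b d] unfolding ricci_def riemann_eq[OF tfcD(1)[OF t(2)] U c] cs .
  qed
  then show ?thesis using proj_weyl_zero_iff[OF t(1) U c] by blast
qed

lemma weyl_zero_imp_flat_metric:
  assumes D: "D \<in> tfc (topspace M)" and W: "\<And>c x a b i d. c \<in> A \<Longrightarrow> x \<in> fst c \<Longrightarrow> proj_weyl M A (topspace M) D c x a b i d = 0"
    and x: "x \<in> topspace M"
  shows "\<exists>U g D'. openin M U \<and> x \<in> U \<and> einstein_metric M A U g \<and> levi_civita M A U g D' \<and> D' \<in> tfc U \<and> proj_equivalent M A U D D'"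
proof -
  obtain c0 where c0: "c0 \<in> A" "x \<in> fst c0"
    using x smooth_manifold unfolding smooth_manifold_def by blast
  let ?N = "topspace M"
  have N: "openin M ?N" by simp
  have sub: "fst c \<subseteq> ?N" if "c \<in> A" for c by (rule chart_subset[OF that])
  let ?S = "img c0 ?N" and ?G = "pchrist D ?N c0"
  have S: "open ?S" "snd c0 x \<in> ?S" using open_img[OF c0(1) N] img_memI[OF x c0(2)] by auto
  have W': "\<exists>P. \<forall>a b i d. curv ?G a b i d z = kron a i * P b d - kron b i * P a d + (P b a - P a b) * kron i d" if z: "z \<in> ?S" for z
  proof -
    obtain y where y: "y \<in> ?N" "y \<in> fst c0" "z = snd c0 y" using z by (auto simp: img_def)
    then show ?thesis using proj_weyl_zero_iff[OF D N c0(1) y(1,2)] W[OF c0(1) y(2)] by simp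
  qed
  obtain T f u where T: "open T" "snd c0 x \<in> T" "T \<subseteq> ?S" and f: "\<And>k. smooth_on T (f k)" and u: "\<And>a. smooth_on T (u a)"
    and det: "\<And>z. z \<in> T \<Longrightarrow> det (\<chi> k a. pd a (f k) z :: real ^ 3 ^ 3) \<noteq> 0"
    and par: "\<And>a b k z. z \<in> T \<Longrightarrow> pd a (pd b (f k)) z = (\<Sum>i\<in>UNIV. proj_shift ?G u a b i z * pd i (f k) z)"
    by (rule projectively_flat_coordinates[of ?S "snd c0 x" ?G,
          OF S smooth_on_pchrist[OF tfcD(1)[OF D] N c0(1)] pchrist_sym[OF tfcD[OF D] N c0(1)] W']) blast+
  define U where "U = {y \<in> fst c0. snd c0 y \<in> T}"
  have U: "openin M U" "x \<in> U" "U \<subseteq> fst c0" "U \<subseteq> ?N"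
    using openin_chart_preimage[OF c0(1) T(1)] T c0 sub[OF c0(1)] by (auto simp: U_def)
  have UT: "snd c0 y \<in> T" if "y \<in> U" for y using that by (simp add: U_def)
  have imgU: "img c0 U = T"
    using T(3) U(3) by (auto simp: img_def U_def)
  have lift: "smooth_fun A U (\<lambda>y. h (snd c0 y))" if h: "smooth_on T h" for h
  proof (rule smooth_fun_from_chart[OF c0(1) U(1,3)])
    have "smooth_on T (pull c0 (\<lambda>y. h (snd c0 y))) \<longleftrightarrow> smooth_on T h"
      by (rule smooth_on_cong[OF T(1)]) (use c0(1) in \<open>auto simp: imgU[symmetric] img_def\<close>)
    then show "smooth_in c0 U (\<lambda>y. h (snd c0 y))" using h by (simp add: smooth_in_def imgU)
  qed
  \<comment> \<open>\<open>u\<close> is known only in the chart \<open>c0\<close>; the components in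
    other charts are those forced by the transformation law.\<close>
  define \<Upsilon> :: "('m, 3) field1" where "\<Upsilon> = (\<lambda>c a y. \<Sum>i\<in>UNIV. jac c c0 i a y * u i (snd c0 y))"
  have \<Upsilon>: "one_form A U \<Upsilon>"
    unfolding one_form_def smooth_components_iff
  proof (intro conjI allI ballI)
    fix a c assume c: "c \<in> A"
    have "smooth_in c U (jac c c0 i a)" for i
      by (rule smooth_in_subset[OF smooth_in_jac(1)[OF c c0(1)]]) (use U in auto)
    then show "smooth_in c U (\<Upsilon> c a)"
      using lift[OF u] c unfolding \<Upsilon>_def smooth_fun_iff by (intro smooth_in_sum smooth_in_mult c U(1)) auto
  next
    fix c d y a assume c: "c \<in> A" and d: "d \<in> A" and y: "y \<in> U \<inter> fst c \<inter> fst d"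
    have "\<Upsilon> d a y = (\<Sum>i\<in>UNIV. (\<Sum>j\<in>UNIV. jac d c j a y * jac c c0 i j y) * u i (snd c0 y))"
      unfolding \<Upsilon>_def using jac_trans[OF d c c0(1), of y] y U by auto
    also have "\<dots> = (\<Sum>j\<in>UNIV. jac d c j a y * \<Upsilon> c j y)"
      unfolding \<Upsilon>_def sum_distrib_left sum_distrib_right by (subst sum.swap) (simp add: mult.assoc)
    finally show "\<Upsilon> d a y = (\<Sum>j\<in>UNIV. jac d c j a y * \<Upsilon> c j y)" .
  qed
  have \<Upsilon>0: "\<Upsilon> c0 a y = u a (snd c0 y)" if "y \<in> U" for a y
    using that U jac_refl[OF c0(1), of y] by (auto simp: \<Upsilon>_def)
  define D' where "D' = shift_conn D \<Upsilon>"
  have DU: "D \<in> tfc U" by (rule tfc_subset[OF D U(4)])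
  have D': "D' \<in> tfc U"
    unfolding torsion_free_connections_def D'_def
    using shift_conn_affine[OF tfcD(1)[OF DU] U(1) \<Upsilon>] shift_conn_torsion_free[OF tfcD(2)[OF DU]] by simp
  have eq: "proj_equivalent M A U D D'"
    unfolding proj_equivalent_def D'_def shift_conn_def using \<Upsilon> by blast
  have ch: "christ D' U c0 a b i y = proj_shift ?G u a b i (snd c0 y)" if y: "y \<in> U" for a b i y
  proof -
    have yc: "y \<in> fst c0" using y U by blast
    have "pchrist D' U c0 a b i (snd c0 y) = proj_shift (pchrist D U c0) (\<lambda>a. pull c0 (\<Upsilon> c0 a)) a b i (snd c0 y)"
      by (rule proj_equivalent_pchrist[OF tfcD(1)[OF DU] U(1) c0(1) img_memI[OF y yc]]) (simp add: D'_def shift_conn_def)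
    then show ?thesis
      using christ_subset[OF tfcD(1)[OF D] N U(1,4) c0(1) y yc] \<Upsilon>0[OF y] c0(1) yc
      by (simp add: pchrist_def proj_shift_def)
  qed
  \<comment> \<open>The differentials of the affine coordinates, computed in every chart; the chain
    rule makes them 1-forms.\<close>
  define th :: "3 \<Rightarrow> ('m, 3) field1" where "th = (\<lambda>k c a. pderiv_in c a (\<lambda>y. f k (snd c0 y)))"
  have th: "one_form A U (th k)" for k
    unfolding one_form_def smooth_components_iff th_def
  proof (intro conjI allI ballI)
    fix a c assume c: "c \<in> A"
    show "smooth_in c U (pderiv_in c a (\<lambda>y. f k (snd c0 y)))"
      using lift[OF f] c by (intro smooth_in_pderiv c U(1)) (simp add: smooth_fun_iff)
  next
    fix c d y a assume c: "c \<in> A" and d: "d \<in> A" and y: "y \<in> U \<inter> fst c \<inter> fst d"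
    show "pderiv_in d a (\<lambda>y. f k (snd c0 y)) y = (\<Sum>i\<in>UNIV. jac d c i a y * pderiv_in c i (\<lambda>y. f k (snd c0 y)) y)"
      by (rule pderiv_chain[OF d c, of y U]) (use y lift[OF f] c in \<open>auto simp: smooth_fun_iff\<close>)
  qed
  have th0: "th k c0 a y = pd a (f k) (snd c0 y)" if y: "y \<in> U" for k a y
    unfolding th_def pderiv_in_eq
    by (rule pd_cong_open[OF T(1) UT[OF y]]) (use c0(1) in \<open>auto simp: imgU[symmetric] img_def\<close>)
  have thpar0: "pderiv_in c0 a (th k c0 b) y = (\<Sum>i\<in>UNIV. christ D' U c0 a b i y * th k c0 i y)" if y: "y \<in> U" for a b k y
  proof -
    have "pderiv_in c0 a (th k c0 b) y = pd a (pd b (f k)) (snd c0 y)"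
      unfolding pderiv_in_eq
      by (rule pd_cong_open[OF T(1) UT[OF y]]) (use c0(1) th0 in \<open>auto simp: imgU[symmetric] img_def\<close>)
    then show ?thesis using par[OF UT[OF y]] by (simp add: ch[OF y] th0[OF y])
  qed
  have thpar: "pderiv_in c e (\<lambda>y. \<Sum>a\<in>UNIV. th k c a y * Y c a y) y = (\<Sum>a\<in>UNIV. th k c a y * D' V Y c e a y)"
    if "c \<in> A" "openin M V" "V \<subseteq> U" "vector_field A V Y" "y \<in> V" "y \<in> fst c" for c k V Y y e
    by (rule parallel_form_chart_independent[OF tfcD(1)[OF D'] U(1) c0(1) U(3) th thpar0 that(2-4,1,5,6)])
  have thdet: "det (\<chi> k a. th k c a y) \<noteq> 0" if "c \<in> A" "y \<in> U" "y \<in> fst c" for c y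
    by (rule det_coframe_nonzero[where c = c0 and U = U, OF th c0(1) that(1,2) _ that(3)])
      (use U that det[OF UT[OF that(2)]] in \<open>auto simp: th0\<close>)
  define g :: "('m, 3) field2" where "g = (\<lambda>c a b x. \<Sum>k\<in>UNIV. th k c a x * th k c b x)"
  have g: "metric A U g" unfolding g_def by (rule coframe_metric[OF U(1) th thdet])
  have lc: "levi_civita M A U g D'"
    unfolding levi_civita_def g_def by (intro conjI D' coframe_metric_compatible th thpar)
  \<comment> \<open>A nondegenerate parallel coframe annihilates the whole curvature, so the
    Einstein constant is 0.\<close>
  have "ricci M A U D' c y a b = 0 * g c a b y" if c: "c \<in> A" "y \<in> U" "y \<in> fst c" for c y a b
    unfolding ricci_def riemann_eq[OF tfcD(1)[OF D'] U(1) c]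
    by (simp add: parallel_coframe_curv_zero[of U D' th c y, OF tfcD(1)[OF D'] U(1) th thpar[OF c(1)] c thdet[OF c]])
  then have "einstein_metric M A U g"
    unfolding einstein_metric_def using g lc by (intro conjI exI[of _ D'] exI[of _ 0]) auto
  with U(1,2) lc D' eq show ?thesis by (intro exI conjI)
qed

end

theorem corollary8p3:
  fixes M :: "'m topology" and A :: "('m, 3) chart set" and p :: "('m, 3) connection set"
  assumes "smooth_manifold M A"
    and "p \<in> projective_structures M A"
  shows "(\<forall>D\<in>p. \<forall>D'\<in>p. \<forall>c\<in>A. \<forall>x\<in>fst c. \<forall>a b i d.
            proj_weyl M A (topspace M) D c x a b i d = proj_weyl M A (topspace M) D' c x a b i d) \<and>
         (\<forall>D\<in>p. (\<forall>c\<in>A. \<forall>x\<in>fst c. \<forall>a b i d.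
            proj_weyl M A (topspace M) D c x a b i d = 0) \<longleftrightarrow> locally_einstein M A p)"
proof -
  interpret smooth_3mfd M A by unfold_locales (rule assms(1))
  let ?N = "topspace M"
  have N: "openin M ?N" by simp
  from assms(2) obtain D0 where "D0 \<in> tfc ?N" and p: "p = {(D, D'). D \<in> tfc ?N \<and> D' \<in> tfc ?N \<and> proj_equivalent M A ?N D D'} `` {D0}"
    unfolding projective_structures_def by (elim quotientE)
  then have D0: "D0 \<in> tfc ?N" and mem: "\<And>D. D \<in> p \<longleftrightarrow> D \<in> tfc ?N \<and> proj_equivalent M A ?N D0 D" by auto
  have sub: "x \<in> ?N" if "c \<in> A" "x \<in> fst c" for c x using chart_subset[OF that(1)] that(2) by blast
  have inv: "proj_weyl M A ?N D c x = proj_weyl M A ?N D0 c x" if "D \<in> p" "c \<in> A" "x \<in> fst c" for D c x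
    using that(1) proj_weyl_invariant[OF D0 _ _ N that(2) sub[OF that(2,3)] that(3)] unfolding mem by blast
  have flat: "locally_einstein M A p"
    if D: "D \<in> p" and W: "\<forall>c\<in>A. \<forall>x\<in>fst c. \<forall>a b i d. proj_weyl M A ?N D c x a b i d = 0" for D
    unfolding locally_einstein_def
  proof
    fix x assume x: "x \<in> ?N"
    have t: "D \<in> tfc ?N" using D mem by blast
    have "\<exists>U g D'. openin M U \<and> x \<in> U \<and> einstein_metric M A U g \<and> levi_civita M A U g D' \<and> D' \<in> tfc U \<and> proj_equivalent M A U D D'"
      by (rule weyl_zero_imp_flat_metric[OF t W[rule_format] x])
    then obtain U g D' where U: "openin M U" "x \<in> U" "einstein_metric M A U g" "levi_civita M A U g D'"
      and D': "D' \<in> tfc U" "proj_equivalent M A U D D'"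
      by (elim exE conjE)
    have "D' \<in> restrict_proj M A p U" unfolding restrict_proj_def using D D' by auto
    with U show "\<exists>U g D. openin M U \<and> x \<in> U \<and> einstein_metric M A U g \<and> levi_civita M A U g D \<and> D \<in> restrict_proj M A p U"
      by (intro exI conjI)
  qed
  have weyl: "proj_weyl M A ?N D c x a b i d = 0"
    if le: "locally_einstein M A p" and D: "D \<in> p" and c: "c \<in> A" "x \<in> fst c" for D c x a b i d
  proof -
    have x: "x \<in> ?N" by (rule sub[OF c])
    obtain U g D' where U: "openin M U" "x \<in> U" and g: "einstein_metric M A U g" "levi_civita M A U g D'"
      and r: "D' \<in> restrict_proj M A p U"
      using le[unfolded locally_einstein_def, rule_format, OF x] by (elim exE conjE)
    then obtain D1 where D': "D' \<in> tfc U" and D1: "D1 \<in> p" and eq: "proj_equivalent M A U D1 D'"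
      unfolding restrict_proj_def by auto
    have UN: "U \<subseteq> ?N" by (rule openin_subset[OF U(1)])
    have t: "D1 \<in> tfc ?N" using D1 mem by blast
    \<comment> \<open>The Einstein connection on \<open>U\<close> is equivalent there to some
      \<open>D1\<close> in \<open>p\<close>, not necessarily to \<open>D\<close>. Invariance on
      \<open>M\<close> leads from \<open>D\<close> to \<open>D1\<close>, restriction leads to
      \<open>U\<close>, and invariance on \<open>U\<close> leads to \<open>D'\<close>.\<close>
    have "proj_weyl M A ?N D c x = proj_weyl M A ?N D1 c x" using inv[OF D c] inv[OF D1 c] by simp
    also have "\<dots> = proj_weyl M A U D1 c x" by (rule proj_weyl_subset[OF t N U(1) UN c(1) U(2) c(2), symmetric])
    also have "\<dots> = proj_weyl M A U D' c x"
      by (rule proj_weyl_invariant[OF tfc_subset[OF t UN] D' eq U(1) c(1) U(2) c(2), symmetric])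
    finally show ?thesis using einstein_proj_weyl_zero[OF U(1) g c(1) U(2) c(2)] by simp
  qed
  show ?thesis
  proof (intro conjI ballI allI iffI)
    show "proj_weyl M A ?N D c x a b i d = proj_weyl M A ?N D' c x a b i d"
      if "D \<in> p" "D' \<in> p" "c \<in> A" "x \<in> fst c" for D D' c x a b i d
      using inv[OF that(1,3,4)] inv[OF that(2-4)] by simp
    show "locally_einstein M A p" if "D \<in> p" "\<forall>c\<in>A. \<forall>x\<in>fst c. \<forall>a b i d. proj_weyl M A ?N D c x a b i d = 0" for D
      by (rule flat[OF that])
    show "proj_weyl M A ?N D c x a b i d = 0" if "D \<in> p" "locally_einstein M A p" "c \<in> A" "x \<in> fst c" for D c x a b i d
      by (rule weyl[OF that(2,1,3,4)])
  qed
qed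

end
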